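(* Let $d\ge 2$ and let $\Xi=(\xi_0,\xi_1,\xi_2,\dots)$ be a time-homogeneous Markov process on $\Sigma\subseteq\mathbb{R}^d$ such that all of the following hold: (1) there is a constant $B<\infty$ with $\Pr_x(\|\theta\|\le B)=1$ for all $x\in\Sigma$; (2) $\mu(x)=0$ for all $x\in\Sigma$; (3) there exists $\varepsilon_0>0$ such that $\operatorname{tr}M(x)\ge\varepsilon_0$ for all $x\in\Sigma$; (4) there exist constants $U,V$ with $0<U\le V<\infty$ for which \[ \lim_{r\to\infty}\sup_{x\in\Sigma:\|x\|\ge r}\bigl|\hat{x}^{\top}M(x)\hat{x}-U\bigr|=0,\qquad \lim_{r\to\infty}\sup_{x\in\Sigma:\|x\|\ge r}\bigl|\operatorname{tr}M(x)-V\bigr|=0; \] (5) $2U<V$. Then a.s., for any $h\in(0,\infty)$ and $k\in\mathbb{N}$, there are infinitely many $(h,k)$ cut annuli for $\Xi$.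
   Context: $\Sigma$ is an unbounded, measurable subset of $\mathbb{R}^d$ with $0\in\Sigma$. $\Xi$ is a time-homogeneous Markov process with $\Pr(\xi_n\in\Sigma)=1$ for all $n$, and $\Pr_x(\cdot)=\Pr(\cdot\mid\xi_0=x)$, with expectation $\mathbb{E}_x$, denotes its law started from $x\in\Sigma$. Set $\theta_n:=\xi_{n+1}-\xi_n$ and $\theta:=\theta_0$. Vectors are column vectors, $\|\cdot\|$ is the Euclidean norm, and $\hat{x}:=x/\|x\|$ for $x\ne 0$. The mean drift is $\mu(x):=\mathbb{E}_x\theta\in\mathbb{R}^d$ and the increment covariance is the $d\times d$ matrix $M(x):=\mathbb{E}_x(\theta\theta^{\top})$; both are well defined under (1). For $h>0$ and $k\in\mathbb{N}$, an $(h,k)$ cut annulus for $\Xi$ is an annulus $\{z\in\mathbb{R}^d: a<\|z\|<b\}$ centred at the origin, of width $b-a$ at least $h$, for which there exist $m\in\mathbb{Z}_+$ and $\ell\ge k-1$ such that $\xi_0,\dots,\xi_{m-1}$ lie in the bounded complement of the annulus ($\|z\|\le a$), $\xi_{m+\ell+1},\xi_{m+\ell+2},\dots$ lie in the unbounded complement of the annulus ($\|z\|\ge b$), and $\xi_m,\xi_{m+1},\dots,\xi_{m+\ell}$ lie inside the annulus with $\|\xi_m\|<\|\xi_{m+1}\|<\cdots<\|\xi_{m+\ell}\|$. (Equivalently, the corresponding interval $(a,b)$ is a cut interval for the process $\|\xi_n\|$.) *)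

theory Defs
  imports "HOL-Probability.Probability"
begin

definition natural_filtration ::
    "'w measure \<Rightarrow> (nat \<Rightarrow> 'w \<Rightarrow> 'a::topological_space) \<Rightarrow> nat \<Rightarrow> 'w measure" where
  "natural_filtration P X n =
     sigma (space P) (\<Union>i\<in>{..n}. {X i -` A \<inter> space P | A. A \<in> sets borel})"

text \<open>
  A time-homogeneous Markov process \<open>X\<close> on the state space \<open>S\<close>, with one-step transition
  kernel \<open>K\<close> and arbitrary initial law. The measure \<open>K x\<close> is the law of \<open>X 1\<close> for the process
  started from \<open>x\<close>. The variables are only required to lie in \<open>S\<close> almost surely; off \<open>S\<close> the
  kernel is unconstrained, which affects the Markov property on a null set only.
\<close>

locale markov_process = prob_space P
  for P :: "'w measure" +
  fixes X :: "nat \<Rightarrow> 'w \<Rightarrow> 'a::topological_space"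
    and S :: "'a set"
    and K :: "'a \<Rightarrow> 'a measure"
  assumes state_space_measurable: "S \<in> sets borel"
    and process_measurable: "\<And>n. X n \<in> borel_measurable P"
    and process_in_state_space: "\<And>n. AE w in P. X n w \<in> S"
    and kernel: "K \<in> restrict_space borel S \<rightarrow>\<^sub>M prob_algebra (restrict_space borel S)"
    and markov_property:
      "\<And>n A. A \<in> sets (restrict_space borel S) \<Longrightarrow>
         AE w in P. real_cond_exp P (natural_filtration P X n)
                      (indicator {w \<in> space P. X (Suc n) w \<in> A}) w
                    = measure (K (X n w)) A"

text \<open>
  Under the law started from \<open>x\<close> we have \<open>X 0 = x\<close>, so the increment \<open>X 1 - X 0\<close> is \<open>y - x\<close>
  with \<open>y\<close> distributed according to \<open>K x\<close>.
\<close>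

definition mean_drift :: "(real^'d \<Rightarrow> (real^'d) measure) \<Rightarrow> real^'d \<Rightarrow> real^'d" where
  "mean_drift K x = (LINT y|K x. y - x)"

definition incr_cov :: "(real^'d \<Rightarrow> (real^'d) measure) \<Rightarrow> real^'d \<Rightarrow> real^'d^'d" where
  "incr_cov K x = (LINT y|K x. (\<chi> i j. (y - x) $ i * (y - x) $ j))"

definition cut_annulus ::
    "real \<Rightarrow> nat \<Rightarrow> (nat \<Rightarrow> 'a::real_normed_vector) \<Rightarrow> 'a set \<Rightarrow> bool" where
  "cut_annulus h k x A \<longleftrightarrow>
     (\<exists>a b. 0 \<le> a \<and> h \<le> b - a \<and> A = {z. a < norm z \<and> norm z < b} \<and>
        (\<exists>m l. k \<le> l + 1 \<and>
           (\<forall>n<m. norm (x n) \<le> a) \<and>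
           (\<forall>n>m + l. b \<le> norm (x n)) \<and>
           (\<forall>n\<in>{m..m + l}. x n \<in> A) \<and>
           (\<forall>n\<in>{m..<m + l}. norm (x n) < norm (x (Suc n)))))"

end

theory Submission
  imports Defs
begin

text \<open>
  Write \<open>R n = norm (\<xi> n)\<close>. A Taylor expansion shows that, far from the origin,
  \<open>R n powr -\<gamma>\<close> is a supermartingale for small \<open>\<gamma> > 0\<close> (this is where \<open>2 * U < V\<close> enters) and
  \<open>R n powr -\<beta>\<close> is a submartingale for large \<open>\<beta>\<close>. Optional stopping gives, up to constants, that
  the process first passing level \<open>r\<close> never returns below it with probability \<open>1 / r\<close>, and reaches
  \<open>s > r\<close> before returning with probability at most \<open>1 / (s - r) + 1 / r\<close>.
  Let \<open>E r\<close> be the event that, from its first passage over \<open>r\<close>, the norm climbs steadily through the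
  annulus \<open>{r..r + H}\<close> and never returns to it. Then \<open>E r\<close> has probability of order \<open>1 / r\<close> and
  \<open>E r \<inter> E s\<close> at most of order \<open>(1 / (s - r) + 1 / r) / s\<close>, also conditionally on the past, so the
  second moment method on a window \<open>a \<le> r < b\<close> with \<open>ln b\<close> large compared with \<open>ln a\<close> shows that some
  \<open>E r\<close> occurs with conditional probability bounded below; a zero-one law makes this probability 1.
  One occurrence of \<open>E r\<close> is enough for infinitely many cut annuli, since the outer radius can be moved.
\<close>

section \<open>Expansion of powers of the norm\<close>

lemma powr_Taylor_bound:
  fixes \<alpha> z :: real
  assumes \<alpha>: "\<alpha> > 0" and z: "\<bar>z\<bar> \<le> 1/2"
  shows "\<bar>(1 + z) powr (-\<alpha>) - (1 - \<alpha> * z + \<alpha> * (\<alpha> + 1) / 2 * z\<^sup>2)\<bar>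
           \<le> \<alpha> * (\<alpha> + 1) * (\<alpha> + 2) * (1/2) powr (-\<alpha> - 3) * \<bar>z\<bar>^3"
proof (cases "z = 0")
  case False
  define D :: "nat \<Rightarrow> real \<Rightarrow> real" where
    "D m t = (if m = 0 then (1 + t) powr (-\<alpha>)
              else if m = 1 then - \<alpha> * (1 + t) powr (-\<alpha> - 1)
              else if m = 2 then \<alpha> * (\<alpha> + 1) * (1 + t) powr (-\<alpha> - 2)
              else - \<alpha> * (\<alpha> + 1) * (\<alpha> + 2) * (1 + t) powr (-\<alpha> - 3))" for m t
  have der: "(D m has_real_derivative D (Suc m) t) (at t)" if "m < 3" "-1/2 \<le> t" for m t
  proof -
    have pos: "1 + t > 0" using that by linarith
    have "(\<lambda>t. (1 + t) powr (-\<alpha>)) = D 0" "(\<lambda>t. - \<alpha> * (1 + t) powr (-\<alpha> - 1)) = D 1"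
      "(\<lambda>t. \<alpha> * (\<alpha> + 1) * (1 + t) powr (-\<alpha> - 2)) = D 2"
      by (auto simp: D_def fun_eq_iff)
    moreover have "((\<lambda>t. (1 + t) powr (-\<alpha>)) has_real_derivative D 1 t) (at t)"
      using pos by (auto intro!: derivative_eq_intros simp: D_def)
    moreover have "((\<lambda>t. - \<alpha> * (1 + t) powr (-\<alpha> - 1)) has_real_derivative D 2 t) (at t)"
      using pos by (auto intro!: derivative_eq_intros simp: D_def algebra_simps)
    moreover have "((\<lambda>t. \<alpha> * (\<alpha> + 1) * (1 + t) powr (-\<alpha> - 2)) has_real_derivative D 3 t) (at t)"
      using pos by (auto intro!: derivative_eq_intros simp: D_def algebra_simps)
    moreover have "m = 0 \<or> m = 1 \<or> m = 2" using that by auto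
    ultimately show ?thesis by (auto simp: numeral_2_eq_2 numeral_3_eq_3)
  qed
  have "\<exists>t. (if z < 0 then z < t \<and> t < 0 else 0 < t \<and> t < z) \<and>
        D 0 z = (\<Sum>m<3. D m 0 / fact m * (z - 0) ^ m) + D 3 t / fact 3 * (z - 0) ^ 3"
    by (rule Taylor[where a="-1/2" and b="1/2"]) (use der z False in auto)
  then obtain t where t0: "if z < 0 then z < t \<and> t < 0 else 0 < t \<and> t < z"
    and eq: "D 0 z = (\<Sum>m<3. D m 0 / fact m * z ^ m) + D 3 t / fact 3 * z ^ 3"
    by auto
  from t0 have t: "\<bar>t\<bar> \<le> \<bar>z\<bar>" by (simp split: if_splits)
  have t2: "1/2 \<le> 1 + t" using t z by linarith
  have c: "\<alpha> * (\<alpha> + 1) * (\<alpha> + 2) \<ge> 0" using \<alpha> by simp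
  have "(1 + z) powr (-\<alpha>) - (1 - \<alpha> * z + \<alpha> * (\<alpha> + 1) / 2 * z\<^sup>2) = D 3 t / 6 * z ^ 3"
    using eq by (simp add: D_def numeral_3_eq_3 numeral_2_eq_2)
  also have "\<bar>\<dots>\<bar> = \<bar>D 3 t\<bar> / 6 * \<bar>z\<bar>^3" by (simp add: abs_mult power_abs)
  also have "\<dots> \<le> \<bar>D 3 t\<bar> * \<bar>z\<bar>^3" by (intro mult_right_mono) auto
  also have "\<bar>D 3 t\<bar> = \<alpha> * (\<alpha> + 1) * (\<alpha> + 2) * (1 + t) powr (-\<alpha> - 3)"
    using \<alpha> by (simp add: D_def abs_mult)
  also have "\<dots> \<le> \<alpha> * (\<alpha> + 1) * (\<alpha> + 2) * (1/2) powr (-\<alpha> - 3)"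
    using \<alpha> t2 by (intro mult_left_mono powr_mono2') (auto simp: c)
  finally show ?thesis by (simp add: mult_right_mono)
qed auto

lemma norm_powr_expansion:
  fixes \<alpha> B e :: real
  assumes \<alpha>: "\<alpha> > 0" and B: "B > 0" and e: "e > 0"
  obtains \<rho> where "\<rho> > 0"
    "\<And>x \<theta> :: 'a :: real_inner. norm x \<ge> \<rho> \<Longrightarrow> norm \<theta> \<le> B \<Longrightarrow>
       \<bar>norm (x + \<theta>) powr (-2 * \<alpha>) - norm x powr (-2 * \<alpha>) *
          (1 - \<alpha> * (2 * (x \<bullet> \<theta>) + (norm \<theta>)\<^sup>2) / (norm x)\<^sup>2 + 2 * \<alpha> * (\<alpha> + 1) * (sgn x \<bullet> \<theta>)\<^sup>2 / (norm x)\<^sup>2)\<bar>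
       \<le> e * norm x powr (-2 * \<alpha>) / (norm x)\<^sup>2"
proof -
  define C where "C = \<alpha> * (\<alpha> + 1) * (\<alpha> + 2) * (1/2) powr (-\<alpha> - 3)"
  have C: "C > 0" using \<alpha> by (simp add: C_def)
  define L where "L = 27 * C * B^3 + \<alpha> * (\<alpha> + 1) / 2 * (5 * B^3)"
  define \<rho> where "\<rho> = Max {6 * B, L / e}"
  have \<rho>: "\<rho> \<ge> 6 * B" "\<rho> \<ge> L / e" by (auto simp: \<rho>_def)
  then have \<rho>0: "\<rho> > 0" using B by linarith
  show ?thesis
  proof (rule that[OF \<rho>0])
    fix x \<theta> :: 'a
    assume x: "norm x \<ge> \<rho>" and \<theta>: "norm \<theta> \<le> B"
    define r where "r = norm x"
    have r: "r > 0" "r \<ge> 6 * B" using x \<rho> \<rho>0 by (auto simp: r_def)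
    have "L / e \<le> r" using x \<rho> by (simp add: r_def)
    then have rL: "e * r \<ge> L" using e by (simp add: field_simps)
    define u where "u = sgn x \<bullet> \<theta>"
    define w where "w = norm \<theta>"
    have w: "0 \<le> w" "w \<le> B" using \<theta> by (auto simp: w_def)
    have xu: "x \<bullet> \<theta> = r * u" using r by (auto simp: u_def r_def sgn_div_norm)
    have u: "\<bar>u\<bar> \<le> B"
    proof -
      have "\<bar>u\<bar> \<le> norm (sgn x) * norm \<theta>" unfolding u_def by (rule Cauchy_Schwarz_ineq2)
      also have "\<dots> \<le> 1 * norm \<theta>" by (intro mult_right_mono) (auto simp: norm_sgn)
      finally show ?thesis using \<theta> by simp
    qed
    define z where "z = (2 * r * u + w\<^sup>2) / r\<^sup>2"
    have zb: "\<bar>z\<bar> \<le> 3 * B / r"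
    proof -
      have "\<bar>2 * r * u + w\<^sup>2\<bar> \<le> 2 * r * B + B * B"
      proof -
        have "\<bar>2 * r * u + w\<^sup>2\<bar> \<le> 2 * r * \<bar>u\<bar> + w * w" using r
          by (intro order.trans[OF abs_triangle_ineq]) (auto simp: abs_mult power2_eq_square)
        also have "\<dots> \<le> 2 * r * B + B * B" using r u w B by (intro add_mono mult_mono) auto
        finally show ?thesis .
      qed
      also have "\<dots> \<le> 3 * B * r" using r B by (simp add: algebra_simps)
      finally have "\<bar>z\<bar> \<le> 3 * B * r / r\<^sup>2" using r by (simp add: z_def divide_right_mono)
      also have "\<dots> = 3 * B / r" using r by (simp add: power2_eq_square)
      finally show ?thesis .
    qed
    also have "3 * B / r \<le> 1/2" using r by (simp add: field_simps)
    finally have z: "\<bar>z\<bar> \<le> 1/2" .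
    have "(norm (x + \<theta>))\<^sup>2 = (norm x)\<^sup>2 + 2 * (x \<bullet> \<theta>) + (norm \<theta>)\<^sup>2"
      by (simp add: power2_norm_eq_inner inner_add inner_commute)
    also have "\<dots> = r\<^sup>2 * (1 + z)" using r by (simp add: xu z_def r_def[symmetric] w_def field_simps)
    finally have n2: "(norm (x + \<theta>))\<^sup>2 = r\<^sup>2 * (1 + z)" .
    have npos: "norm (x + \<theta>) > 0"
    proof -
      have "(norm (x + \<theta>))\<^sup>2 > 0" unfolding n2 using r z by simp
      then show ?thesis by (simp add: power2_eq_square zero_less_mult_iff)
    qed
    have "norm (x + \<theta>) powr (-2 * \<alpha>) = ((norm (x + \<theta>)) powr 2) powr (-\<alpha>)"
      by (subst powr_powr) simp
    also have "(norm (x + \<theta>)) powr 2 = r\<^sup>2 * (1 + z)" using n2 npos by (simp add: powr_numeral)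
    also have "\<dots> powr (-\<alpha>) = (r powr 2) powr (-\<alpha>) * (1 + z) powr (-\<alpha>)"
      using r z by (simp add: powr_mult powr_numeral)
    also have "(r powr 2) powr (-\<alpha>) = r powr (-2 * \<alpha>)" by (subst powr_powr) simp
    finally have np: "norm (x + \<theta>) powr (-2 * \<alpha>) = r powr (-2 * \<alpha>) * (1 + z) powr (-\<alpha>)" .
    define E where "E = 1 - \<alpha> * (2 * (x \<bullet> \<theta>) + (norm \<theta>)\<^sup>2) / (norm x)\<^sup>2 + 2 * \<alpha> * (\<alpha> + 1) * (sgn x \<bullet> \<theta>)\<^sup>2 / (norm x)\<^sup>2"
    have E: "E = 1 - \<alpha> * z + 2 * \<alpha> * (\<alpha> + 1) * u\<^sup>2 / r\<^sup>2"
      by (simp add: E_def z_def xu u_def w_def r_def[symmetric] mult.assoc)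
    have z2: "z\<^sup>2 - 4 * u\<^sup>2 / r\<^sup>2 = (4 * r * u * w\<^sup>2 + w^4) / r^4"
      using r by (simp add: z_def field_simps power2_eq_square power4_eq_xxxx)
    have "\<bar>4 * r * u * w\<^sup>2 + w^4\<bar> \<le> 4 * r * B * B\<^sup>2 + B^4"
    proof -
      have "\<bar>4 * r * u * w\<^sup>2 + w^4\<bar> \<le> 4 * r * \<bar>u\<bar> * w\<^sup>2 + w^4" using r
        by (intro order.trans[OF abs_triangle_ineq]) (auto simp: abs_mult)
      also have "\<dots> \<le> 4 * r * B * B\<^sup>2 + B^4" using r u w B by (intro add_mono mult_mono power_mono) auto
      finally show ?thesis .
    qed
    also have "\<dots> \<le> 5 * B^3 * r"
    proof -
      have "B^4 \<le> B^3 * r" using r B by (simp add: power4_eq_xxxx power3_eq_cube)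
      then show ?thesis by (simp add: power2_eq_square power3_eq_cube algebra_simps)
    qed
    finally have z2b: "\<bar>z\<^sup>2 - 4 * u\<^sup>2 / r\<^sup>2\<bar> \<le> 5 * B^3 * r / r^4" 
      unfolding z2 using r by (simp add: divide_right_mono)
    have z3: "\<bar>z\<bar>^3 \<le> 27 * B^3 / r^3"
      using power_mono[OF zb, of 3] by (simp add: power_divide power_mult_distrib)
    have "(1 + z) powr (-\<alpha>) - E = ((1 + z) powr (-\<alpha>) - (1 - \<alpha> * z + \<alpha> * (\<alpha> + 1) / 2 * z\<^sup>2))
             + \<alpha> * (\<alpha> + 1) / 2 * (z\<^sup>2 - 4 * u\<^sup>2 / r\<^sup>2)"
      unfolding E by (simp add: field_simps)
    also have "\<bar>\<dots>\<bar> \<le> \<bar>(1 + z) powr (-\<alpha>) - (1 - \<alpha> * z + \<alpha> * (\<alpha> + 1) / 2 * z\<^sup>2)\<bar>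
             + \<alpha> * (\<alpha> + 1) / 2 * \<bar>z\<^sup>2 - 4 * u\<^sup>2 / r\<^sup>2\<bar>"
      using \<alpha> by (intro order.trans[OF abs_triangle_ineq]) (auto simp: abs_mult)
    also have "\<dots> \<le> C * (27 * B^3 / r^3) + \<alpha> * (\<alpha> + 1) / 2 * (5 * B^3 * r / r^4)"
    proof (intro add_mono mult_left_mono)
      have "\<bar>(1 + z) powr (-\<alpha>) - (1 - \<alpha> * z + \<alpha> * (\<alpha> + 1) / 2 * z\<^sup>2)\<bar> \<le> C * \<bar>z\<bar>^3"
        using powr_Taylor_bound[OF \<alpha> z] by (simp add: C_def)
      also have "\<dots> \<le> C * (27 * B^3 / r^3)" using C z3 by (intro mult_left_mono) auto
      finally show "\<bar>(1 + z) powr (-\<alpha>) - (1 - \<alpha> * z + \<alpha> * (\<alpha> + 1) / 2 * z\<^sup>2)\<bar> \<le> C * (27 * B^3 / r^3)" .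
    qed (use z2b \<alpha> in auto)
    also have "\<dots> = L / r^3" using r by (simp add: L_def field_simps power3_eq_cube power4_eq_xxxx)
    also have "\<dots> \<le> e * r / r^3" using r rL by (intro divide_right_mono) auto
    also have "\<dots> = e / r\<^sup>2" using r by (simp add: power2_eq_square power3_eq_cube)
    finally have fin: "\<bar>(1 + z) powr (-\<alpha>) - E\<bar> \<le> e / r\<^sup>2" .
    have "\<bar>norm (x + \<theta>) powr (-2 * \<alpha>) - norm x powr (-2 * \<alpha>) * E\<bar>
        = r powr (-2 * \<alpha>) * \<bar>(1 + z) powr (-\<alpha>) - E\<bar>"
      unfolding np r_def[symmetric] right_diff_distrib[symmetric] by (simp add: abs_mult)
    also have "\<dots> \<le> r powr (-2 * \<alpha>) * (e / r\<^sup>2)" using fin by (intro mult_left_mono) auto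
    finally show "\<bar>norm (x + \<theta>) powr (-2 * \<alpha>) - norm x powr (-2 * \<alpha>) *
          (1 - \<alpha> * (2 * (x \<bullet> \<theta>) + (norm \<theta>)\<^sup>2) / (norm x)\<^sup>2 + 2 * \<alpha> * (\<alpha> + 1) * (sgn x \<bullet> \<theta>)\<^sup>2 / (norm x)\<^sup>2)\<bar>
       \<le> e * norm x powr (-2 * \<alpha>) / (norm x)\<^sup>2"
      by (simp add: E_def r_def mult.commute)
  qed
qed

section \<open>Processes with asymptotically critical drift on the half-line\<close>

lemma sum_inverse_pairs_le:
  fixes a b :: nat
  assumes "1 \<le> a"
  defines "S \<equiv> \<Sum>i\<in>{a..<b}. 1 / real i"
  shows "(\<Sum>i\<in>{a..<b}. \<Sum>j\<in>{a..<b}. if i < j then (1 / (real j - real i) + 1 / real i) / real j else 0)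
    \<le> 2 * S * harm b"
proof -
  have "(\<Sum>i\<in>{a..<b}. if i < j then 1 / (real j - real i) + 1 / real i else 0) \<le> 2 * harm b"
    if j: "j \<in> {a..<b}" for j
  proof -
    have "(\<Sum>i\<in>{a..<b}. if i < j then 1 / (real j - real i) + 1 / real i else 0)
        = (\<Sum>i\<in>{a..<j}. 1 / (real j - real i)) + (\<Sum>i\<in>{a..<j}. 1 / real i)"
    proof -
      have "(\<Sum>i\<in>{a..<b}. if i < j then 1 / (real j - real i) + 1 / real i else 0)
          = (\<Sum>i\<in>{a..<j}. 1 / (real j - real i) + 1 / real i)"
        using j by (intro sum.mono_neutral_cong_right) auto
      then show ?thesis by (simp add: sum.distrib)
    qed
    also have "(\<Sum>i\<in>{a..<j}. 1 / (real j - real i)) = (\<Sum>k\<in>(\<lambda>i. j - i) ` {a..<j}. 1 / real k)"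
      by (subst sum.reindex) (auto simp: inj_on_def of_nat_diff)
    also have "\<dots> \<le> (\<Sum>k\<in>{1..b}. 1 / real k)" using j by (intro sum_mono2) auto
    also have "(\<Sum>i\<in>{a..<j}. 1 / real i) \<le> (\<Sum>k\<in>{1..b}. 1 / real k)"
      using j assms by (intro sum_mono2) auto
    finally show ?thesis by (simp add: harm_def inverse_eq_divide)
  qed
  then have "(\<Sum>j\<in>{a..<b}. 1 / real j * (\<Sum>i\<in>{a..<b}. if i < j then 1 / (real j - real i) + 1 / real i else 0))
      \<le> (\<Sum>j\<in>{a..<b}. 1 / real j * (2 * harm b))"
    by (intro sum_mono mult_left_mono) auto
  also have "\<dots> = 2 * S * harm b" by (simp add: S_def sum_distrib_right sum_distrib_left mult_ac)
  also have "(\<Sum>j\<in>{a..<b}. 1 / real j * (\<Sum>i\<in>{a..<b}. if i < j then 1 / (real j - real i) + 1 / real i else 0))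
     = (\<Sum>j\<in>{a..<b}. \<Sum>i\<in>{a..<b}. if i < j then (1 / (real j - real i) + 1 / real i) / real j else 0)"
    unfolding sum_distrib_left by (intro sum.cong refl) auto
  finally show ?thesis by (subst sum.swap)
qed

lemma (in prob_space) second_moment_bound:
  assumes I: "finite I" and D: "D \<in> events" and E: "\<And>i. i \<in> I \<Longrightarrow> E i \<in> events"
  shows "2 * t * (\<Sum>i\<in>I. prob (D \<inter> E i)) - t\<^sup>2 * (\<Sum>i\<in>I. \<Sum>j\<in>I. prob (D \<inter> E i \<inter> E j))
    \<le> prob (D \<inter> (\<Union>i\<in>I. E i))"
proof -
  define Z where "Z w = (\<Sum>i\<in>I. indicator (E i) w :: real)" for w
  have int: "integrable M (indicator A :: 'a \<Rightarrow> real)" if "A \<in> events" for A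
    using that by (simp add: emeasure_eq_measure)
  have meas: "(\<integral>w. indicator A w \<partial>M) = prob A" if "A \<in> events" for A
    using sets.sets_into_space[OF that] by (simp add: Int_absorb2)
  have sets: "D \<inter> E i \<in> events" "D \<inter> E i \<inter> E j \<in> events" if "i \<in> I" "j \<in> I" for i j
    using D E that by auto
  have un: "D \<inter> (\<Union>i\<in>I. E i) \<in> events" using D E I by auto
  have eq: "2 * t * (\<Sum>i\<in>I. indicator (D \<inter> E i) w) - t\<^sup>2 * (\<Sum>i\<in>I. \<Sum>j\<in>I. indicator (D \<inter> E i \<inter> E j) w)
      = indicator D w * (2 * t * Z w - t\<^sup>2 * (Z w)\<^sup>2)" for w
  proof -
    have "(\<Sum>i\<in>I. indicator (D \<inter> E i) w) = indicator D w * Z w"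
      unfolding Z_def sum_distrib_left by (simp add: indicator_inter_arith)
    moreover have "(\<Sum>i\<in>I. \<Sum>j\<in>I. indicator (D \<inter> E i \<inter> E j) w) = indicator D w * (Z w)\<^sup>2"
    proof -
      have "(\<Sum>i\<in>I. \<Sum>j\<in>I. indicator (D \<inter> E i \<inter> E j) w)
          = (\<Sum>i\<in>I. \<Sum>j\<in>I. indicator D w * (indicator (E i) w * indicator (E j) w :: real))"
        by (simp add: indicator_inter_arith mult.assoc)
      then show ?thesis unfolding Z_def power2_eq_square sum_product by (simp only: sum_distrib_left)
    qed
    ultimately show ?thesis by (simp add: algebra_simps)
  qed
  have int1: "integrable M (\<lambda>w. 2 * t * (\<Sum>i\<in>I. indicator (D \<inter> E i) w))"
    using int sets by (intro Bochner_Integration.integrable_mult_right Bochner_Integration.integrable_sum) auto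
  have int2: "integrable M (\<lambda>w. t\<^sup>2 * (\<Sum>i\<in>I. \<Sum>j\<in>I. indicator (D \<inter> E i \<inter> E j) w))"
    using int sets by (intro Bochner_Integration.integrable_mult_right Bochner_Integration.integrable_sum) auto
  have "2 * t * (\<Sum>i\<in>I. prob (D \<inter> E i)) - t\<^sup>2 * (\<Sum>i\<in>I. \<Sum>j\<in>I. prob (D \<inter> E i \<inter> E j))
     = (\<integral>w. 2 * t * (\<Sum>i\<in>I. indicator (D \<inter> E i) w) - t\<^sup>2 * (\<Sum>i\<in>I. \<Sum>j\<in>I. indicator (D \<inter> E i \<inter> E j) w) \<partial>M)"
    unfolding Bochner_Integration.integral_diff[OF int1 int2]
    using int sets by (simp add: Bochner_Integration.integral_sum meas cong: sum.cong)
  also have "\<dots> \<le> (\<integral>w. indicator (D \<inter> (\<Union>i\<in>I. E i)) w \<partial>M)"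
  proof (rule integral_mono[OF Bochner_Integration.integrable_diff[OF int1 int2] int[OF un]])
    fix w
    show "2 * t * (\<Sum>i\<in>I. indicator (D \<inter> E i) w) - t\<^sup>2 * (\<Sum>i\<in>I. \<Sum>j\<in>I. indicator (D \<inter> E i \<inter> E j) w)
        \<le> indicator (D \<inter> (\<Union>i\<in>I. E i)) w"
    proof (cases "w \<in> (\<Union>i\<in>I. E i)")
      case True
      \<comment> \<open>this replaces the Cauchy-Schwarz inequality of the second moment method; \<open>t\<close> is optimised later\<close>
      have "2 * t * Z w - t\<^sup>2 * (Z w)\<^sup>2 \<le> 1"
        using zero_le_power2[of "1 - t * Z w"] by (simp add: power2_eq_square algebra_simps)
      then show ?thesis unfolding eq using True by (auto simp: indicator_def)
    next
      case False
      then have "Z w = 0" unfolding Z_def by (intro sum.neutral) (auto simp: indicator_def)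
      then show ?thesis unfolding eq by simp
    qed
  qed
  also have "\<dots> = prob (D \<inter> (\<Union>i\<in>I. E i))"
    by (rule meas[OF un])
  finally show ?thesis .
qed

lemma (in prob_space) prob_UN_le:
  fixes X Y :: "nat \<Rightarrow> 'a set"
  assumes "disjoint_family X" "disjoint_family Y" "\<And>i. X i \<in> events" "\<And>i. Y i \<in> events"
    and "\<And>i. prob (X i) \<le> c * prob (Y i)"
  shows "prob (\<Union>i. X i) \<le> c * prob (\<Union>i. Y i)"
  by (rule sums_le[OF assms(5) finite_measure_UNION sums_mult[OF finite_measure_UNION]])
    (use assms in auto)

locale lamperti = prob_space P for P :: "'w measure" +
  fixes F :: "nat \<Rightarrow> 'w measure" and R :: "nat \<Rightarrow> 'w \<Rightarrow> real"
    and B r\<^sub>0 \<delta> p \<epsilon> \<beta> \<gamma> :: real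
  assumes filtration: "subalgebra P (F n)" "m \<le> n \<Longrightarrow> sets (F m) \<subseteq> sets (F n)"
    and adapted: "R n \<in> borel_measurable (F n)"
    and nonneg: "0 \<le> R n w"
    and step: "\<bar>R (Suc n) w - R n w\<bar> \<le> B"
    and const_bounds: "0 < B" "0 < \<delta>" "0 < p" "0 < \<epsilon>" "1 \<le> \<beta>" "0 < \<gamma>" "\<gamma> \<le> 1" "1 \<le> r\<^sub>0" "2 * B \<le> r\<^sub>0"
    and climb: "D \<in> sets (F n) \<Longrightarrow> (\<And>w. w \<in> D \<Longrightarrow> r\<^sub>0 \<le> R n w) \<Longrightarrow>
      p * prob D \<le> prob {w \<in> D. R n w + \<delta> \<le> R (Suc n) w}"
    and supermart: "D \<in> sets (F n) \<Longrightarrow> (\<And>w. w \<in> D \<Longrightarrow> r\<^sub>0 \<le> R n w) \<Longrightarrow>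
      (\<integral>w. indicator D w * R (Suc n) w powr -\<gamma> \<partial>P) \<le> (\<integral>w. indicator D w * R n w powr -\<gamma> \<partial>P)"
    and submart: "D \<in> sets (F n) \<Longrightarrow> (\<And>w. w \<in> D \<Longrightarrow> r\<^sub>0 \<le> R n w) \<Longrightarrow>
      (\<integral>w. indicator D w * R n w powr -\<beta> \<partial>P) \<le> (\<integral>w. indicator D w * R (Suc n) w powr -\<beta> \<partial>P)"
    and spread: "D \<in> sets (F n) \<Longrightarrow> (\<And>w. w \<in> D \<Longrightarrow> R n w \<le> s) \<Longrightarrow>
      \<epsilon> * prob D + (\<integral>w. indicator D w * (R n w)\<^sup>2 \<partial>P) \<le> (\<integral>w. indicator D w * (R (Suc n) w)\<^sup>2 \<partial>P)"
begin

lemma space_F [simp]: "space (F n) = space P"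
  using filtration(1)[of n] by (simp add: subalgebra_def)

lemma sets_F: "A \<in> sets (F n) \<Longrightarrow> A \<in> sets P"
  using filtration(1)[of n] by (auto simp: subalgebra_def)

lemma sets_F_mono: "A \<in> sets (F m) \<Longrightarrow> m \<le> n \<Longrightarrow> A \<in> sets (F n)"
  using filtration(2) by auto

lemma R_F: "m \<le> n \<Longrightarrow> R m \<in> borel_measurable (F n)"
  using adapted[of m] filtration(2)[of m n] by (auto simp: measurable_def)

lemma R_P [measurable]: "R n \<in> borel_measurable P"
  using measurable_from_subalg[OF filtration(1) adapted] .

lemma borel_measurable_F: "f \<in> borel_measurable (F n) \<Longrightarrow> f \<in> borel_measurable P"
  using measurable_from_subalg[OF filtration(1)] .

lemma R_in_F:
  assumes "m \<le> n" "I \<in> sets borel"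
  shows "{w \<in> space P. R m w \<in> I} \<in> sets (F n)"
  using measurable_sets[OF R_F[OF assms(1)] assms(2)] by (simp add: vimage_def Int_def conj_commute)

lemma sets_F_Collect_conj:
  "D \<in> sets (F n) \<Longrightarrow> {w \<in> space P. Q w} \<in> sets (F n) \<Longrightarrow> {w \<in> D. Q w} \<in> sets (F n)"
proof -
  assume a: "D \<in> sets (F n)" "{w \<in> space P. Q w} \<in> sets (F n)"
  have "{w \<in> D. Q w} = D \<inter> {w \<in> space P. Q w}" using sets.sets_into_space[OF a(1)] by auto
  then show ?thesis using a by auto
qed

lemma integrable_bounded:
  fixes g :: "'w \<Rightarrow> real"
  assumes "g \<in> borel_measurable P" "D \<in> sets P" "\<And>w. w \<in> D \<Longrightarrow> \<bar>g w\<bar> \<le> c"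
  shows "integrable P (\<lambda>w. indicator D w * g w)"
proof (rule integrable_const_bound[of _ "\<bar>c\<bar>"])
  show "AE w in P. norm (indicator D w * g w) \<le> \<bar>c\<bar>"
    using assms(3) by (intro AE_I2) (fastforce simp: indicator_def)
qed (use assms in measurable)

lemma integral_indicator_mult_const:
  "D \<in> sets P \<Longrightarrow> (\<integral>w. indicator D w * (c::real) \<partial>P) = c * prob D"
  using sets.sets_into_space[of D P] by (simp add: Int_absorb2 mult.commute)

lemma integral_ge_const:
  assumes "g \<in> borel_measurable P" "D \<in> sets P" "\<And>w. w \<in> D \<Longrightarrow> \<bar>g w\<bar> \<le> c" "\<And>w. w \<in> D \<Longrightarrow> a \<le> g w"
  shows "a * prob D \<le> (\<integral>w. indicator D w * g w \<partial>P)"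
proof -
  have "(\<integral>w. indicator D w * a \<partial>P) \<le> (\<integral>w. indicator D w * g w \<partial>P)"
    using assms by (intro integral_mono integrable_bounded[where c="\<bar>a\<bar>"] integrable_bounded[where c=c])
      (auto simp: indicator_def)
  then show ?thesis using assms(2) by (simp only: integral_indicator_mult_const)
qed

lemma integral_le_const:
  assumes "g \<in> borel_measurable P" "D \<in> sets P" "\<And>w. w \<in> D \<Longrightarrow> \<bar>g w\<bar> \<le> c" "\<And>w. w \<in> D \<Longrightarrow> g w \<le> a"
  shows "(\<integral>w. indicator D w * g w \<partial>P) \<le> a * prob D"
proof -
  have "(\<integral>w. indicator D w * g w \<partial>P) \<le> (\<integral>w. indicator D w * a \<partial>P)"
    using assms by (intro integral_mono integrable_bounded[where c="\<bar>a\<bar>"] integrable_bounded[where c=c])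
      (auto simp: indicator_def)
  then show ?thesis using assms(2) by (simp only: integral_indicator_mult_const)
qed

primrec stopped :: "real set \<Rightarrow> nat \<Rightarrow> nat \<Rightarrow> 'w \<Rightarrow> real" where
  "stopped I m 0 w = R m w"
| "stopped I m (Suc j) w = (if stopped I m j w \<in> I then R (m + Suc j) w else stopped I m j w)"

lemma stopped_measurable:
  assumes "I \<in> sets borel"
  shows "stopped I m j \<in> borel_measurable (F (m + j))"
proof (induction j)
  case 0
  have "stopped I m 0 = R m" by auto
  then show ?case using R_F[of m m] by simp
next
  case (Suc j)
  have [measurable]: "stopped I m j \<in> borel_measurable (F (m + Suc j))"
    using Suc filtration(2)[of "m + j" "m + Suc j"] by (auto simp: measurable_def)
  have [measurable]: "R (m + Suc j) \<in> borel_measurable (F (m + Suc j))" by (rule R_F) simp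
  have [measurable]: "I \<in> sets borel" by fact
  have "(\<lambda>w. if stopped I m j w \<in> I then R (m + Suc j) w else stopped I m j w)
      \<in> borel_measurable (F (m + Suc j))" by measurable
  then show ?case by (simp add: fun_eq_iff cong: measurable_cong)
qed

lemma stopped_inside: "stopped I m j w \<in> I \<Longrightarrow> stopped I m j w = R (m + j) w"
  by (induction j) (auto split: if_splits)

lemma stopped_in_iff: "stopped I m j w \<in> I \<longleftrightarrow> (\<forall>i\<le>j. R (m + i) w \<in> I)"
  by (induction j) (auto simp: le_Suc_eq)

lemma stopped_exit:
  assumes "\<And>i. i < j \<Longrightarrow> R (m + i) w \<in> I" "R (m + j) w \<notin> I" "j \<le> k"
  shows "stopped I m k w = R (m + j) w"
  using assms(3)
proof (induction k rule: dec_induct)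
  case base
  show ?case
  proof (cases j)
    case (Suc i)
    have "stopped I m i w \<in> I" unfolding stopped_in_iff using assms(1) Suc by auto
    then show ?thesis using Suc by simp
  qed simp
qed (use assms(2) in simp)

lemma optional_stopping:
  fixes f :: "real \<Rightarrow> real"
  assumes I: "I \<in> sets borel" and f: "f \<in> borel_measurable borel" and bd: "\<And>x. \<bar>f x\<bar> \<le> c"
    and drift: "\<And>n D. D \<in> sets (F n) \<Longrightarrow> (\<And>w. w \<in> D \<Longrightarrow> R n w \<in> I) \<Longrightarrow>
      a * prob D + (\<integral>w. indicator D w * f (R n w) \<partial>P) \<le> (\<integral>w. indicator D w * f (R (Suc n) w) \<partial>P)"
    and D: "D \<in> sets (F m)"
  shows "a * (\<Sum>j<J. prob {w \<in> D. stopped I m j w \<in> I}) + (\<integral>w. indicator D w * f (R m w) \<partial>P)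
      \<le> (\<integral>w. indicator D w * f (stopped I m J w) \<partial>P)"
proof (induction J)
  case (Suc J)
  define A where "A = {w \<in> D. stopped I m J w \<in> I}"
  have A: "A \<in> sets (F (m + J))"
  proof -
    have "{w \<in> space P. stopped I m J w \<in> I} \<in> sets (F (m + J))"
      using measurable_sets[OF stopped_measurable[OF I, of m J] I]
      by (simp add: vimage_def Int_def conj_commute[of "_ \<in> space P"])
    then show ?thesis unfolding A_def by (rule sets_F_Collect_conj[OF sets_F_mono[OF D le_add1]])
  qed
  have mS [measurable]: "stopped I m j \<in> borel_measurable P" for j
    by (rule borel_measurable_F[OF stopped_measurable[OF I]])
  note [measurable] = f
  have ints: "integrable P (\<lambda>w. indicator D w * f (stopped I m J w))"
    "integrable P (\<lambda>w. indicator A w * f (R (m + Suc J) w))"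
    "integrable P (\<lambda>w. indicator A w * f (R (m + J) w))"
    using bd sets_F[OF D] sets_F[OF A] by (intro integrable_bounded[where c=c]; simp)+
  have "(\<integral>w. indicator D w * f (stopped I m (Suc J) w) \<partial>P) = (\<integral>w. indicator D w * f (stopped I m J w)
      + (indicator A w * f (R (m + Suc J) w) - indicator A w * f (R (m + J) w)) \<partial>P)"
  proof (intro Bochner_Integration.integral_cong refl)
    fix w
    show "indicator D w * f (stopped I m (Suc J) w) = indicator D w * f (stopped I m J w)
      + (indicator A w * f (R (m + Suc J) w) - indicator A w * f (R (m + J) w))"
      using stopped_inside[of I m J w]
      by (cases "stopped I m J w \<in> I") (auto simp: A_def indicator_def)
  qed
  also have "\<dots> = (\<integral>w. indicator D w * f (stopped I m J w) \<partial>P)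
      + ((\<integral>w. indicator A w * f (R (m + Suc J) w) \<partial>P) - (\<integral>w. indicator A w * f (R (m + J) w) \<partial>P))"
    using ints by simp
  finally have "(\<integral>w. indicator D w * f (stopped I m (Suc J) w) \<partial>P) = \<dots>" .
  moreover have "a * prob A + (\<integral>w. indicator A w * f (R (m + J) w) \<partial>P) \<le> (\<integral>w. indicator A w * f (R (m + Suc J) w) \<partial>P)"
    using drift[OF A] by (auto simp: A_def stopped_inside stopped_in_iff)
  ultimately show ?case using Suc.IH by (simp add: A_def[symmetric] algebra_simps)
qed simp

lemma prob_R_bounded: "prob {w \<in> space P. \<forall>n. R n w \<le> s} = 0"
proof (cases "s \<ge> 0")
  case False
  then have "\<not> R 0 w \<le> s" for w using nonneg[of 0 w] by linarith
  then have "{w \<in> space P. \<forall>n. R n w \<le> s} = {}" by blast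
  then show ?thesis by (simp only: measure_empty)
next
  case True
  define f where "f x = min (x\<^sup>2) ((s + B)\<^sup>2)" for x :: real
  define q where "q = prob {w \<in> space P. \<forall>n. R n w \<le> s}"
  have f: "\<bar>f x\<bar> \<le> (s + B)\<^sup>2" for x by (auto simp: f_def min_def)
  have fm: "f \<in> borel_measurable borel" unfolding f_def by measurable
  have fR: "f (R n w) = (R n w)\<^sup>2" if "R n w \<le> s + B" for n w
    using that nonneg[of n w] power_mono[of "R n w" "s + B" 2] by (simp add: f_def)
  have dr: "\<epsilon> * prob D + (\<integral>w. indicator D w * f (R n w) \<partial>P) \<le> (\<integral>w. indicator D w * f (R (Suc n) w) \<partial>P)"
    if D: "D \<in> sets (F n)" "\<And>w. w \<in> D \<Longrightarrow> R n w \<in> {..s}" for n D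
  proof -
    have "(\<integral>w. indicator D w * f (R n w) \<partial>P) = (\<integral>w. indicator D w * (R n w)\<^sup>2 \<partial>P)"
    proof (intro Bochner_Integration.integral_cong refl)
      fix w
      show "indicator D w * f (R n w) = indicator D w * (R n w)\<^sup>2"
        using D(2)[of w] const_bounds(1) by (cases "w \<in> D") (auto intro!: fR)
    qed
    moreover have "(\<integral>w. indicator D w * f (R (Suc n) w) \<partial>P) = (\<integral>w. indicator D w * (R (Suc n) w)\<^sup>2 \<partial>P)"
    proof (intro Bochner_Integration.integral_cong refl)
      fix w
      show "indicator D w * f (R (Suc n) w) = indicator D w * (R (Suc n) w)\<^sup>2"
        using D(2)[of w] step[of n w] by (cases "w \<in> D") (auto intro!: fR)
    qed
    ultimately show ?thesis using spread[OF D(1), of s] D(2) by simp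
  qed
  have "real J * (\<epsilon> * q) \<le> (s + B)\<^sup>2" for J
  proof -
    have sm: "stopped {..s} 0 j \<in> borel_measurable P" for j
      by (rule borel_measurable_F[OF stopped_measurable]) simp
    have "\<epsilon> * (\<Sum>j<J. q) \<le> \<epsilon> * (\<Sum>j<J. prob {w \<in> space P. stopped {..s} 0 j w \<in> {..s}})"
    proof (intro mult_left_mono sum_mono)
      fix j
      note [measurable] = sm[of j]
      show "q \<le> prob {w \<in> space P. stopped {..s} 0 j w \<in> {..s}}" unfolding q_def
        by (rule finite_measure_mono) (unfold stopped_in_iff, auto)
    qed (use const_bounds in auto)
    also have "\<dots> \<le> \<epsilon> * (\<Sum>j<J. prob {w \<in> space P. stopped {..s} 0 j w \<in> {..s}})
        + (\<integral>w. indicator (space P) w * f (R 0 w) \<partial>P)"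
      by (simp add: f_def)
    also have "\<dots> \<le> (\<integral>w. indicator (space P) w * f (stopped {..s} 0 J w) \<partial>P)"
      by (rule optional_stopping[OF _ fm f dr]) (use sets.top[of "F 0"] in auto)
    also have "\<dots> \<le> (s + B)\<^sup>2 * prob (space P)"
      by (rule integral_le_const[where c="(s+B)\<^sup>2"]) (use f fm sm[of J] in \<open>auto simp: f_def\<close>)
    finally show ?thesis by (simp add: prob_space algebra_simps)
  qed
  then have "\<epsilon> * q \<le> 0"
    by (meson ex_less_of_nat_mult not_le)
  then have "q \<le> 0" using const_bounds by (simp add: mult_le_0_iff)
  then show ?thesis by (simp add: q_def antisym)
qed

lemma AE_unbounded: "AE w in P. \<forall>s m. \<exists>j. s < R (m + j) w"
proof -
  have "AE w in P. \<forall>k::nat. \<exists>n. real k < R n w"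
  proof (intro AE_all_countable[THEN iffD2] allI)
    fix k :: nat
    have "AE w in P. w \<notin> {w \<in> space P. \<forall>n. R n w \<le> real k}"
      using prob_R_bounded[of "real k"] by (intro AE_not_in) (auto simp: null_sets_def emeasure_eq_measure)
    then show "AE w in P. \<exists>n. real k < R n w"
      by (rule AE_mp) (intro AE_I2, auto simp: not_le)
  qed
  then show ?thesis
  proof (rule AE_mp, intro AE_I2 impI allI)
    fix w s m assume w: "\<forall>k::nat. \<exists>n. real k < R n w"
    obtain k :: nat where k: "Max (insert s ((\<lambda>i. R i w) ` {..m})) \<le> real k" using real_arch_simple by blast
    obtain n where n: "real k < R n w" using w by blast
    have "R i w \<le> real k" if "i \<le> m" for i
      by (rule order_trans[OF Max_ge k]) (use that in auto)
    then have "m \<le> n" using n by (meson leD le_cases)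
    moreover have "s \<le> real k"
      by (rule order_trans[OF Max_ge k]) auto
    ultimately show "\<exists>j. s < R (m + j) w" using n by (intro exI[of _ "n - m"]) auto
  qed
qed

lemma escape:
  assumes b: "r\<^sub>0 \<le> b" and D: "D \<in> sets (F m)" "\<And>w. w \<in> D \<Longrightarrow> b + 1 \<le> R m w"
  shows "\<gamma> / (4 * b) * prob D \<le> prob {w \<in> D. \<forall>j. b \<le> R (m + j) w}"
proof -
  have b1: "b \<ge> 1" "b > B" using b const_bounds by auto
  define f where "f x = max x b powr -\<gamma>" for x
  have fm [measurable]: "f \<in> borel_measurable borel" unfolding f_def by measurable
  have fb: "\<bar>f x\<bar> \<le> b powr -\<gamma>" for x
    unfolding f_def using b1 const_bounds by (auto intro!: powr_mono2')
  have dr: "0 * prob D + (\<integral>w. indicator D w * - f (R n w) \<partial>P) \<le> (\<integral>w. indicator D w * - f (R (Suc n) w) \<partial>P)"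
    if D: "D \<in> sets (F n)" "\<And>w. w \<in> D \<Longrightarrow> R n w \<in> {b..}" for n D
  proof -
    have low: "R (Suc n) w \<ge> b - B" if "w \<in> D" for w using D(2)[OF that] step[of n w] by auto
    have "(\<integral>w. indicator D w * f (R (Suc n) w) \<partial>P) \<le> (\<integral>w. indicator D w * R (Suc n) w powr -\<gamma> \<partial>P)"
    proof (rule integral_mono)
      show "integrable P (\<lambda>w. indicator D w * f (R (Suc n) w))"
        by (rule integrable_bounded[where c="b powr -\<gamma>"]) (use fb sets_F[OF D(1)] in auto)
      show "integrable P (\<lambda>w. indicator D w * R (Suc n) w powr -\<gamma>)"
        by (rule integrable_bounded[where c="(b - B) powr -\<gamma>"])
          (use sets_F[OF D(1)] low b1 const_bounds in \<open>auto intro!: powr_mono2'\<close>)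
      fix w
      show "indicator D w * f (R (Suc n) w) \<le> indicator D w * R (Suc n) w powr -\<gamma>"
        using low[of w] b1 const_bounds by (cases "w \<in> D") (auto simp: f_def intro!: powr_mono2')
    qed
    also have "\<dots> \<le> (\<integral>w. indicator D w * R n w powr -\<gamma> \<partial>P)"
      using supermart[OF D(1)] D(2) b by force
    also have "\<dots> = (\<integral>w. indicator D w * f (R n w) \<partial>P)"
      using D(2) by (intro Bochner_Integration.integral_cong refl)
        (auto simp: indicator_def f_def max_absorb1)
    finally show ?thesis by simp
  qed
  have DP: "D \<in> sets P" using sets_F[OF D(1)] .
  have sm: "stopped {b..} m J \<in> borel_measurable P" for J
    by (rule borel_measurable_F[OF stopped_measurable]) simp
  have bound: "b powr -\<gamma> * prob {w \<in> D. \<exists>j\<le>J. R (m + j) w < b} \<le> (b + 1) powr -\<gamma> * prob D" for J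
  proof -
    note [measurable] = DP sm
    define A where "A = {w \<in> D. \<exists>j\<le>J. R (m + j) w < b}"
    have [measurable]: "A \<in> sets P" unfolding A_def by measurable
    have fA: "f (stopped {b..} m J w) = b powr -\<gamma>" if "w \<in> A" for w
    proof -
      have "stopped {b..} m J w \<notin> {b..}" using that unfolding stopped_in_iff A_def by (auto simp: not_le)
      then show ?thesis by (simp add: f_def)
    qed
    have "b powr -\<gamma> * prob A \<le> (\<integral>w. indicator A w * f (stopped {b..} m J w) \<partial>P)"
      by (rule integral_ge_const[where c="b powr -\<gamma>"]) (use fA fb in auto)
    also have "\<dots> \<le> (\<integral>w. indicator D w * f (stopped {b..} m J w) \<partial>P)"
      by (intro integral_mono integrable_bounded[where c="b powr -\<gamma>"])
        (use fb in \<open>auto simp: A_def indicator_def f_def\<close>)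
    also have "\<dots> \<le> (\<integral>w. indicator D w * f (R m w) \<partial>P)"
      using optional_stopping[of "{b..}" "\<lambda>x. - f x" "b powr -\<gamma>" 0, OF _ _ _ dr D(1), of J] fb by simp
    also have "\<dots> \<le> (b + 1) powr -\<gamma> * prob D"
      by (rule integral_le_const[where c="b powr -\<gamma>"])
        (use fb D(2) b1 const_bounds in \<open>auto simp: f_def le_max_iff_disj intro!: powr_mono2'\<close>)
    finally show ?thesis by (simp add: A_def)
  qed
  note [measurable] = DP
  have "(\<lambda>J. prob {w \<in> D. \<exists>j\<le>J. R (m + j) w < b}) \<longlonglongrightarrow> prob (\<Union>J. {w \<in> D. \<exists>j\<le>J. R (m + j) w < b})"
    by (rule finite_Lim_measure_incseq) (auto simp: incseq_def intro: order_trans)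
  moreover have "(\<Union>J. {w \<in> D. \<exists>j\<le>J. R (m + j) w < b}) = {w \<in> D. \<exists>j. R (m + j) w < b}" by auto
  ultimately have "b powr -\<gamma> * prob {w \<in> D. \<exists>j. R (m + j) w < b} \<le> (b + 1) powr -\<gamma> * prob D"
    using bound by (intro LIMSEQ_le_const2[where X="\<lambda>J. b powr -\<gamma> * prob {w \<in> D. \<exists>j\<le>J. R (m + j) w < b}"])
      (auto intro!: tendsto_intros)
  then have "prob {w \<in> D. \<exists>j. R (m + j) w < b} \<le> (b + 1) powr -\<gamma> / b powr -\<gamma> * prob D"
    using b1 by (simp add: field_simps)
  also have "(b + 1) powr -\<gamma> / b powr -\<gamma> = ((b + 1) / b) powr -\<gamma>" using b1 by (simp add: powr_divide)
  also have "\<dots> \<le> 1 - \<gamma> / (4 * b)"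
  proof -
    define t where "t = \<gamma> * ln ((b + 1) / b)"
    have "- ln ((b + 1) / b) = ln (b / (b + 1))" using b1 by (simp add: ln_div)
    also have "\<dots> \<le> b / (b + 1) - 1" using b1 by (intro ln_le_minus_one) auto
    also have "\<dots> = - 1 / (b + 1)" using b1 by (simp add: field_simps)
    finally have "1 / (b + 1) \<le> ln ((b + 1) / b)" by simp
    then have t1: "\<gamma> / (b + 1) \<le> t" using const_bounds mult_left_mono[of _ _ \<gamma>] by (fastforce simp: t_def)
    have "ln ((b + 1) / b) \<le> (b + 1) / b - 1" using b1 by (intro ln_le_minus_one) auto
    also have "\<dots> = 1 / b" using b1 by (simp add: field_simps)
    also have "\<dots> \<le> 1" using b1 by simp
    finally have "t \<le> 1" unfolding t_def using const_bounds b1 mult_mono[of \<gamma> 1 "ln ((b + 1) / b)" 1] by simp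
    have t0: "t \<ge> 0" unfolding t_def using const_bounds b1 by (intro mult_nonneg_nonneg) auto
    have "((b + 1) / b) powr -\<gamma> = exp (- t)" using b1 by (simp add: powr_def t_def)
    also have "\<dots> \<le> 1 / (1 + t)" using t0 exp_ge_add_one_self[of t] by (simp add: exp_minus field_simps)
    also have "\<dots> \<le> 1 - t / 2" using t0 \<open>t \<le> 1\<close> mult_left_mono[of t 1 t] by (simp add: field_simps)
    also have "\<dots> \<le> 1 - (\<gamma> / (b + 1)) / 2" using divide_right_mono[OF t1, of 2] by simp
    also have "\<dots> \<le> 1 - \<gamma> / (4 * b)" using b1 const_bounds by (simp add: field_simps)
    finally show ?thesis .
  qed
  finally have "prob {w \<in> D. \<exists>j. R (m + j) w < b} \<le> (1 - \<gamma> / (4 * b)) * prob D"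
    by (simp add: mult_right_mono)
  moreover have "prob {w \<in> D. \<forall>j. b \<le> R (m + j) w} = prob D - prob {w \<in> D. \<exists>j. R (m + j) w < b}"
  proof -
    have "{w \<in> D. \<forall>j. b \<le> R (m + j) w} = D - {w \<in> D. \<exists>j. R (m + j) w < b}"
      unfolding not_less[symmetric] by blast
    then show ?thesis by (simp add: finite_measure_Diff)
  qed
  ultimately show ?thesis by (simp add: algebra_simps)
qed

lemma reach:
  assumes r: "r\<^sub>0 \<le> r" and s: "r + B \<le> s"
    and D: "D \<in> sets (F m)" "\<And>w. w \<in> D \<Longrightarrow> r < R m w" "\<And>w. w \<in> D \<Longrightarrow> R m w \<le> r + B"
  shows "prob {w \<in> D. \<exists>j. s < R (m + j) w \<and> (\<forall>i<j. r < R (m + i) w)} \<le> 4 * B * \<beta> * (1 / (s - r) + 1 / r) * prob D"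
proof -
  define \<rho> where "\<rho> = r - B"
  have \<rho>: "\<rho> > 0" "r \<le> 2 * \<rho>" "\<rho> < s" using r s const_bounds by (auto simp: \<rho>_def)
  define f where "f x = max x \<rho> powr -\<beta>" for x
  have fm [measurable]: "f \<in> borel_measurable borel" unfolding f_def by measurable
  have fb: "\<bar>f x\<bar> \<le> \<rho> powr -\<beta>" for x
    unfolding f_def using \<rho> const_bounds by (auto intro!: powr_mono2')
  let ?I = "{r<..s}"
  have dr: "0 * prob D + (\<integral>w. indicator D w * f (R n w) \<partial>P) \<le> (\<integral>w. indicator D w * f (R (Suc n) w) \<partial>P)"
    if D: "D \<in> sets (F n)" "\<And>w. w \<in> D \<Longrightarrow> R n w \<in> ?I" for n D
  proof -
    have *: "R n w \<ge> \<rho>" "R (Suc n) w \<ge> \<rho>" if "w \<in> D" for w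
      using D(2)[OF that] step[of n w] const_bounds by (auto simp: \<rho>_def)
    have "(\<integral>w. indicator D w * f (R n w) \<partial>P) = (\<integral>w. indicator D w * R n w powr -\<beta> \<partial>P)"
      "(\<integral>w. indicator D w * f (R (Suc n) w) \<partial>P) = (\<integral>w. indicator D w * R (Suc n) w powr -\<beta> \<partial>P)"
      using * by (auto intro!: Bochner_Integration.integral_cong simp: indicator_def f_def max_absorb1)
    moreover have "r\<^sub>0 \<le> R n w" if "w \<in> D" for w using D(2)[OF that] r by auto
    ultimately show ?thesis using submart[OF D(1)] by simp
  qed
  have DP [measurable]: "D \<in> sets P" using sets_F[OF D(1)] .
  have sm [measurable]: "stopped ?I m J \<in> borel_measurable P" for J
    by (rule borel_measurable_F[OF stopped_measurable]) simp
  \<comment> \<open>\<open>f \<le> \<rho> powr -\<beta>\<close> also holds on paths still inside \<open>?I\<close> at time \<open>J\<close>, so their probability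
    need not tend to 0\<close>
  let ?A = "\<lambda>J. {w \<in> D. \<exists>j\<le>J. s < R (m + j) w \<and> (\<forall>i<j. r < R (m + i) w)}"
  have bound: "(\<rho> powr -\<beta> - s powr -\<beta>) * prob (?A J) \<le> (\<rho> powr -\<beta> - (r + B) powr -\<beta>) * prob D" for J
  proof -
    have A [measurable]: "?A J \<in> sets P" by measurable
    have fA: "f (stopped ?I m J w) \<le> s powr -\<beta>" if "w \<in> ?A J" for w
    proof -
      have ex: "\<exists>j. j \<le> J \<and> s < R (m + j) w \<and> (\<forall>i<j. r < R (m + i) w)" using that by auto
      define k where "k = (LEAST j. j \<le> J \<and> s < R (m + j) w \<and> (\<forall>i<j. r < R (m + i) w))"
      have k: "k \<le> J" "s < R (m + k) w" "\<forall>i<k. r < R (m + i) w"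
        using LeastI_ex[OF ex, folded k_def] by blast+
      have "R (m + i) w \<le> s" if "i < k" for i
      proof (rule ccontr)
        assume "\<not> ?thesis"
        then have "i \<le> J \<and> s < R (m + i) w \<and> (\<forall>i'<i. r < R (m + i') w)" using that k by auto
        then have "k \<le> i" unfolding k_def by (rule Least_le)
        then show False using that by simp
      qed
      then have "stopped ?I m J w = R (m + k) w"
        using k by (intro stopped_exit) auto
      then show ?thesis using k \<rho> const_bounds by (auto simp: f_def intro!: powr_mono2')
    qed
    have "(r + B) powr -\<beta> * prob D \<le> (\<integral>w. indicator D w * f (R m w) \<partial>P)"
      by (rule integral_ge_const[where c="\<rho> powr -\<beta>"])
        (use fb D(2,3) \<rho> const_bounds in \<open>auto simp: f_def \<rho>_def intro!: powr_mono2'\<close>)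
    also have "\<dots> \<le> (\<integral>w. indicator D w * f (stopped ?I m J w) \<partial>P)"
      using optional_stopping[of ?I f "\<rho> powr -\<beta>" 0, OF _ _ _ dr D(1), of J] fb by simp
    also have "\<dots> \<le> (\<integral>w. indicator D w * \<rho> powr -\<beta> - indicator (?A J) w * (\<rho> powr -\<beta> - s powr -\<beta>) \<partial>P)"
    proof (rule integral_mono)
      show "integrable P (\<lambda>w. indicator D w * f (stopped ?I m J w))"
        by (rule integrable_bounded[where c="\<rho> powr -\<beta>"]) (use fb in auto)
      show "integrable P (\<lambda>w. indicator D w * \<rho> powr -\<beta> - indicator (?A J) w * (\<rho> powr -\<beta> - s powr -\<beta>))"
        by (intro Bochner_Integration.integrable_diff integrable_bounded[where c="\<bar>\<rho> powr -\<beta>\<bar>"]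
            integrable_bounded[where c="\<bar>\<rho> powr -\<beta> - s powr -\<beta>\<bar>"]) auto
      fix w
      show "indicator D w * f (stopped ?I m J w)
          \<le> indicator D w * \<rho> powr -\<beta> - indicator (?A J) w * (\<rho> powr -\<beta> - s powr -\<beta>)"
        using fA[of w] fb[of "stopped ?I m J w"] by (auto simp: indicator_def)
    qed
    also have "\<dots> = \<rho> powr -\<beta> * prob D - (\<rho> powr -\<beta> - s powr -\<beta>) * prob (?A J)"
      using DP A by (subst Bochner_Integration.integral_diff)
        (simp_all only: integral_indicator_mult_const integrable_bounded[OF borel_measurable_const _ order_refl])
    finally show ?thesis by (simp add: algebra_simps)
  qed
  let ?U = "{w \<in> D. \<exists>j. s < R (m + j) w \<and> (\<forall>i<j. r < R (m + i) w)}"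
  have "(\<lambda>J. prob (?A J)) \<longlonglongrightarrow> prob (\<Union>J. ?A J)"
    by (rule finite_Lim_measure_incseq) (auto simp: incseq_def intro: order_trans)
  moreover have "(\<Union>J. ?A J) = ?U" by auto
  ultimately have "(\<rho> powr -\<beta> - s powr -\<beta>) * prob ?U \<le> (\<rho> powr -\<beta> - (r + B) powr -\<beta>) * prob D"
    using bound by (intro LIMSEQ_le_const2[where X="\<lambda>J. (\<rho> powr -\<beta> - s powr -\<beta>) * prob (?A J)"])
      (auto intro!: tendsto_intros)
  moreover have "\<rho> powr -\<beta> * ((s - \<rho>) / s) \<le> \<rho> powr -\<beta> - s powr -\<beta>"
  proof -
    have "s powr -\<beta> = \<rho> powr -\<beta> * (s / \<rho>) powr -\<beta>" using \<rho> by (simp add: powr_divide)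
    also have "(s / \<rho>) powr -\<beta> \<le> (s / \<rho>) powr -1" using \<rho> const_bounds by (intro powr_mono) auto
    also have "\<dots> = \<rho> / s" using \<rho> by (simp add: powr_minus_divide)
    finally have "s powr -\<beta> \<le> \<rho> powr -\<beta> * (\<rho> / s)" by (simp add: mult_left_mono)
    then show ?thesis using \<rho> by (simp add: field_simps)
  qed
  moreover have "\<rho> powr -\<beta> - (r + B) powr -\<beta> \<le> \<rho> powr -\<beta> * (2 * B * \<beta> / \<rho>)"
  proof -
    have eq: "(r + B) powr -\<beta> = \<rho> powr -\<beta> * ((r + B) / \<rho>) powr -\<beta>"
      using \<rho> const_bounds r by (simp add: powr_divide)
    have "ln ((r + B) / \<rho>) \<le> (r + B) / \<rho> - 1" using \<rho> const_bounds r by (intro ln_le_minus_one) auto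
    also have "\<dots> = 2 * B / \<rho>" using \<rho> by (simp add: field_simps \<rho>_def)
    finally have "\<beta> * ln ((r + B) / \<rho>) \<le> \<beta> * (2 * B / \<rho>)" using const_bounds by (intro mult_left_mono) auto
    then have "1 - 2 * B * \<beta> / \<rho> \<le> 1 + - \<beta> * ln ((r + B) / \<rho>)" by (simp add: mult_ac)
    also have "\<dots> \<le> exp (- \<beta> * ln ((r + B) / \<rho>))" by (rule exp_ge_add_one_self)
    also have "\<dots> = ((r + B) / \<rho>) powr -\<beta>" using \<rho> const_bounds r by (simp add: powr_def)
    finally have "\<rho> powr -\<beta> * (1 - 2 * B * \<beta> / \<rho>) \<le> \<rho> powr -\<beta> * ((r + B) / \<rho>) powr -\<beta>"
      by (rule mult_left_mono) simp
    then show ?thesis unfolding eq by (simp add: algebra_simps)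
  qed
  ultimately have "\<rho> powr -\<beta> * ((s - \<rho>) / s) * prob ?U \<le> \<rho> powr -\<beta> * (2 * B * \<beta> / \<rho>) * prob D"
    by (meson mult_right_mono measure_nonneg order_trans)
  then have "\<rho> powr -\<beta> * ((s - \<rho>) / s * prob ?U) \<le> \<rho> powr -\<beta> * (2 * B * \<beta> / \<rho> * prob D)"
    by (simp only: mult.assoc)
  then have "(s - \<rho>) / s * prob ?U \<le> 2 * B * \<beta> / \<rho> * prob D"
    using \<rho> by (subst (asm) mult_le_cancel_left_pos) auto
  then have "prob ?U \<le> 2 * B * \<beta> / \<rho> * (s / (s - \<rho>)) * prob D" using \<rho> by (simp add: field_simps)
  also have "2 * B * \<beta> / \<rho> * (s / (s - \<rho>)) = 2 * B * \<beta> * (1 / \<rho> + 1 / (s - \<rho>))"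
    using \<rho> by (simp add: field_simps)
  also have "\<dots> \<le> 2 * B * \<beta> * (2 / r + 2 / (s - r))"
  proof (intro mult_left_mono add_mono)
    show "1 / \<rho> \<le> 2 / r" using \<rho> r const_bounds by (simp add: field_simps)
    have "s - r > 0" using s const_bounds by simp
    then have "1 / (s - \<rho>) \<le> 1 / (s - r)" using const_bounds by (intro divide_left_mono) (auto simp: \<rho>_def)
    also have "\<dots> \<le> 2 / (s - r)" using \<open>s - r > 0\<close> by (simp add: divide_right_mono)
    finally show "1 / (s - \<rho>) \<le> 2 / (s - r)" .
  qed (use const_bounds in auto)
  finally show ?thesis by (simp add: mult_right_mono algebra_simps)
qed

lemma sets_F_Ball:
  fixes I :: "nat set"
  assumes "D \<in> sets (F n)" "\<And>i. i \<in> I \<Longrightarrow> {w \<in> space P. Q i w} \<in> sets (F n)"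
  shows "{w \<in> D. \<forall>i\<in>I. Q i w} \<in> sets (F n)"
proof -
  have "(\<Inter>i. if i \<in> I then {w \<in> space P. Q i w} else space P) \<in> sets (F n)"
    using assms(2) sets.top[of "F n"] by (intro sets.countable_INT) auto
  moreover have "{w \<in> D. \<forall>i\<in>I. Q i w} = D \<inter> (\<Inter>i. if i \<in> I then {w \<in> space P. Q i w} else space P)"
    using sets.sets_into_space[OF assms(1)] by (auto split: if_splits)
  ultimately show ?thesis using assms(1) by auto
qed

lemma sets_F_Bex:
  fixes I :: "nat set"
  assumes "D \<in> sets (F n)" "\<And>i. i \<in> I \<Longrightarrow> {w \<in> space P. Q i w} \<in> sets (F n)"
  shows "{w \<in> D. \<exists>i\<in>I. Q i w} \<in> sets (F n)"
proof -
  have "{w \<in> D. \<exists>i\<in>I. Q i w} = D \<inter> (\<Union>i\<in>I. {w \<in> space P. Q i w})"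
    using sets.sets_into_space[OF assms(1)] by auto
  then show ?thesis using assms by auto
qed

definition first_passage :: "real \<Rightarrow> nat \<Rightarrow> 'w set" where
  "first_passage r m = {w \<in> space P. r < R m w \<and> (\<forall>i<m. R i w \<le> r)}"

lemma first_passage_F: "first_passage r m \<in> sets (F m)"
proof -
  have "{w \<in> {w \<in> space P. R m w \<in> {r<..}}. \<forall>i\<in>{..<m}. R i w \<in> {..r}} \<in> sets (F m)"
    by (intro sets_F_Ball R_in_F) auto
  then show ?thesis by (simp add: first_passage_def Ball_def)
qed

lemma first_passage_events [measurable]: "first_passage r m \<in> events"
  using sets_F[OF first_passage_F] .

lemma first_passage_unique: "w \<in> first_passage r m \<Longrightarrow> w \<in> first_passage r n \<Longrightarrow> m = n"
  by (metis (mono_tags, lifting) first_passage_def leD linorder_neqE_nat mem_Collect_eq)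

lemma disjoint_first_passage: "(\<And>m. X m \<subseteq> first_passage r m) \<Longrightarrow> disjoint_family X"
  unfolding disjoint_family_on_def using first_passage_unique by blast

lemma first_passage_step: "w \<in> first_passage r m \<Longrightarrow> 0 < m \<Longrightarrow> R m w \<le> r + B"
  using step[of "m - 1" w] by (cases m) (force simp: first_passage_def)+

lemma prob_UN_first_passage:
  assumes D: "D \<in> events"
  shows "prob (\<Union>m. D \<inter> first_passage r m) = prob D"
proof (rule finite_measure_eq_AE)
  show "AE w in P. w \<in> (\<Union>m. D \<inter> first_passage r m) \<longleftrightarrow> w \<in> D"
  proof (rule AE_mp[OF AE_unbounded], intro AE_I2 impI)
    fix w assume w: "w \<in> space P" "\<forall>s m. \<exists>j. s < R (m + j) w"
    have ex: "\<exists>n. r < R n w" using w(2)[rule_format, of r 0] by auto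
    define m where "m = (LEAST n. r < R n w)"
    have "r < R m w" using LeastI_ex[OF ex] by (simp add: m_def)
    moreover have "R i w \<le> r" if "i < m" for i using not_less_Least[of i "\<lambda>n. r < R n w"] that
      by (simp add: m_def not_less)
    ultimately have "w \<in> first_passage r m" using w by (simp add: first_passage_def)
    then show "w \<in> (\<Union>m. D \<inter> first_passage r m) \<longleftrightarrow> w \<in> D" by auto
  qed
qed (use D in measurable)

lemma climb_iterate:
  assumes D: "D \<in> sets (F m)" "\<And>w. w \<in> D \<Longrightarrow> r\<^sub>0 \<le> R m w"
  shows "{w \<in> D. \<forall>j<N. R (m + j) w + \<delta> \<le> R (m + Suc j) w} \<in> sets (F (m + N))
    \<and> p ^ N * prob D \<le> prob {w \<in> D. \<forall>j<N. R (m + j) w + \<delta> \<le> R (m + Suc j) w}"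
proof (induction N)
  case 0
  then show ?case using D by simp
next
  case (Suc N)
  define E where "E = {w \<in> D. \<forall>j<N. R (m + j) w + \<delta> \<le> R (m + Suc j) w}"
  have E: "E \<in> sets (F (m + N))" "p ^ N * prob D \<le> prob E" using Suc unfolding E_def by blast+
  have "{w \<in> D. \<forall>j<Suc N. R (m + j) w + \<delta> \<le> R (m + Suc j) w} = {w \<in> E. R (m + N) w + \<delta> \<le> R (Suc (m + N)) w}"
    unfolding E_def All_less_Suc by auto
  moreover have "{w \<in> E. R (m + N) w + \<delta> \<le> R (Suc (m + N)) w} \<in> sets (F (Suc (m + N)))"
  proof -
    have [measurable]: "R (m + N) \<in> borel_measurable (F (Suc (m + N)))"
      "R (Suc (m + N)) \<in> borel_measurable (F (Suc (m + N)))" by (rule R_F, simp)+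
    have "{w \<in> space (F (Suc (m + N))). R (m + N) w + \<delta> \<le> R (Suc (m + N)) w} \<in> sets (F (Suc (m + N)))"
      by measurable
    then have "{w \<in> space P. R (m + N) w + \<delta> \<le> R (Suc (m + N)) w} \<in> sets (F (Suc (m + N)))" by simp
    moreover have "E \<in> sets (F (Suc (m + N)))" by (rule sets_F_mono[OF E(1)]) simp
    ultimately show ?thesis by (intro sets_F_Collect_conj[of E])
  qed
  moreover have "p * prob E \<le> prob {w \<in> E. R (m + N) w + \<delta> \<le> R (Suc (m + N)) w}"
  proof (rule climb[OF E(1)])
    fix w assume w: "w \<in> E"
    have asc: "\<forall>j<N. R (m + j) w + \<delta> \<le> R (m + Suc j) w" and wD: "w \<in> D"
      using w unfolding E_def by blast+
    have "R m w \<le> R (m + j) w" if "j \<le> N" for j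
      using that
    proof (induction j)
      case (Suc j)
      have "R m w \<le> R (m + j) w" using Suc by simp
      also have "\<dots> \<le> R (m + Suc j) w" using asc[rule_format, of j] Suc.prems const_bounds(2) by simp
      finally show ?case .
    qed simp
    then show "r\<^sub>0 \<le> R (m + N) w" using D(2)[OF wD] order_trans by blast
  qed
  moreover have "p ^ Suc N * prob D \<le> p * prob E"
    using E(2) const_bounds(3) by (simp add: mult.assoc mult_left_mono)
  ultimately show ?case by simp
qed

text \<open>The condition \<open>0 < m\<close> bounds the overshoot over level \<open>r\<close> at the first passage by \<open>B\<close>.\<close>

definition cut_at :: "nat \<Rightarrow> nat \<Rightarrow> nat \<Rightarrow> nat \<Rightarrow> 'w set" where
  "cut_at H N r m = {w \<in> first_passage r m. 0 < m \<and> (\<forall>j<N. R (m + j) w + \<delta> \<le> R (m + Suc j) w)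
     \<and> (\<forall>j. real r + real H \<le> R (m + N + j) w)}"

lemma cut_at_events [measurable]: "cut_at H N r m \<in> events"
  unfolding cut_at_def by measurable

lemma cut_at_increasing:
  assumes "w \<in> cut_at H N r m" "j \<le> N"
  shows "real r + j * \<delta> < R (m + j) w"
  using assms(2)
proof (induction j)
  case 0
  then show ?case using assms(1) by (simp add: cut_at_def first_passage_def)
next
  case (Suc j)
  have "R (m + j) w + \<delta> \<le> R (m + Suc j) w" using assms(1) Suc.prems by (simp add: cut_at_def)
  then show ?case using Suc by (simp add: algebra_simps)
qed

lemma cut_at_stays_above:
  assumes "w \<in> cut_at H N r m" "0 < H"
  shows "real r < R (m + j) w"
proof (cases "j \<le> N")
  case True
  have "0 \<le> j * \<delta>" using const_bounds by simp
  then show ?thesis using cut_at_increasing[OF assms(1) True] by linarith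
next
  case False
  have "real r + real H \<le> R (m + N + (j - N)) w" using assms by (simp add: cut_at_def)
  then show ?thesis using False assms(2) by simp
qed

definition crossing :: "nat \<Rightarrow> nat \<Rightarrow> nat \<Rightarrow> 'w set" where
  "crossing H N r = (\<Union>m. cut_at H N r m)"

lemma crossing_events [measurable]: "crossing H N r \<in> events"
  unfolding crossing_def by measurable

definition past_below :: "nat \<Rightarrow> 'w set \<Rightarrow> real \<Rightarrow> bool" where
  "past_below n D r \<longleftrightarrow> D \<in> sets (F n) \<and> (\<forall>w\<in>D. \<forall>i\<le>n. R i w \<le> r)"

lemma past_below_first_passage:
  assumes "past_below n D r"
  shows "D \<inter> first_passage r m \<in> sets (F m)" "w \<in> D \<inter> first_passage r m \<Longrightarrow> R m w \<le> r + B"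
    "m \<le> n \<Longrightarrow> D \<inter> first_passage r m = {}"
proof -
  show empty: "D \<inter> first_passage r m = {}" if "m \<le> n"
    using assms that by (force simp: past_below_def first_passage_def)
  show "D \<inter> first_passage r m \<in> sets (F m)"
  proof (cases "m \<le> n")
    case False
    then have "D \<in> sets (F m)" using assms sets_F_mono[of D n m] by (simp add: past_below_def)
    then show ?thesis using first_passage_F by auto
  qed (simp add: empty)
  assume "w \<in> D \<inter> first_passage r m"
  then show "R m w \<le> r + B" using empty by (intro first_passage_step) (auto simp: not_le intro: gr0I)
qed

lemma crossing_lower:
  assumes D: "past_below n D r" and r: "r\<^sub>0 \<le> real r" and N: "real H + 1 \<le> N * \<delta>"
  shows "\<gamma> * p ^ N / (4 * (1 + real H)) * (1 / r) * prob D \<le> prob (D \<inter> crossing H N r)"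
proof -
  define c where "c = \<gamma> * p ^ N / (4 * (1 + real H)) * (1 / r)"
  have r1: "real r \<ge> 1" using r const_bounds by simp
  have c: "c > 0" using r1 const_bounds by (auto simp: c_def)
  have DP: "D \<in> events" using D sets_F by (auto simp: past_below_def)
  have "prob (D \<inter> first_passage r m) \<le> 1 / c * prob (D \<inter> cut_at H N r m)" for m
  proof (cases "m = 0")
    case True
    then show ?thesis using past_below_first_passage(3)[OF D, of m] by (simp add: cut_at_def)
  next
    case False
    define X where "X = D \<inter> first_passage r m"
    have X: "X \<in> sets (F m)" unfolding X_def by (rule past_below_first_passage[OF D])
    have Xr: "real r < R m w" if "w \<in> X" for w using that by (simp add: X_def first_passage_def)
    define Y where "Y = {w \<in> X. \<forall>j<N. R (m + j) w + \<delta> \<le> R (m + Suc j) w}"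
    have Y: "Y \<in> sets (F (m + N))" "p ^ N * prob X \<le> prob Y"
    proof -
      have "r\<^sub>0 \<le> R m w" if "w \<in> X" for w using Xr[OF that] r by simp
      then show "Y \<in> sets (F (m + N))" "p ^ N * prob X \<le> prob Y"
        using climb_iterate[OF X, of N] unfolding Y_def by blast+
    qed
    have Yr: "real r + real H + 1 \<le> R (m + N) w" if w: "w \<in> Y" for w
    proof -
      have asc: "\<forall>j<N. R (m + j) w + \<delta> \<le> R (m + Suc j) w" and wX: "w \<in> X"
        using w unfolding Y_def by blast+
      have "R m w + j * \<delta> \<le> R (m + j) w" if "j \<le> N" for j
        using that
      proof (induction j)
        case (Suc j)
        then show ?case using asc[rule_format, of j] by (simp add: algebra_simps)
      qed simp
      from this[of N] show ?thesis using N Xr[OF wX] by simp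
    qed
    have "\<gamma> / (4 * (real r + real H)) * prob Y \<le> prob {w \<in> Y. \<forall>j. real r + real H \<le> R (m + N + j) w}"
      by (rule escape) (use r Y Yr in auto)
    also have "{w \<in> Y. \<forall>j. real r + real H \<le> R (m + N + j) w} = D \<inter> cut_at H N r m"
      unfolding Y_def X_def cut_at_def using False by blast
    finally have 1: "\<gamma> / (4 * (real r + real H)) * prob Y \<le> prob (D \<inter> cut_at H N r m)" .
    have "c * prob X = \<gamma> / (4 * (real r * (1 + real H))) * (p ^ N * prob X)"
      by (simp add: c_def algebra_simps)
    also have "\<dots> \<le> \<gamma> / (4 * (real r + real H)) * prob Y"
    proof (rule mult_mono[OF _ Y(2)])
      show "\<gamma> / (4 * (real r * (1 + real H))) \<le> \<gamma> / (4 * (real r + real H))"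
      proof (rule divide_left_mono)
        have "real H \<le> real r * real H" using r1 by (simp add: mult_le_cancel_right1)
        then show "4 * (real r + real H) \<le> 4 * (real r * (1 + real H))" by (simp add: algebra_simps)
        show "0 < 4 * (real r * (1 + real H)) * (4 * (real r + real H))"
          using r1 by (intro mult_pos_pos) auto
      qed (use const_bounds in auto)
    qed (use const_bounds r1 in auto)
    also note 1
    finally have "c * prob X \<le> prob (D \<inter> cut_at H N r m)" .
    then show ?thesis using c by (simp add: X_def field_simps)
  qed
  then have "prob (\<Union>m. D \<inter> first_passage r m) \<le> 1 / c * prob (\<Union>m. D \<inter> cut_at H N r m)"
    using DP by (intro prob_UN_le disjoint_first_passage[of _ r]) (auto simp: cut_at_def)
  also have "(\<Union>m. D \<inter> cut_at H N r m) = D \<inter> crossing H N r" by (auto simp: crossing_def)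
  finally have "c * prob D \<le> prob (D \<inter> crossing H N r)"
    using c unfolding prob_UN_first_passage[OF DP] by (simp add: field_simps)
  then show ?thesis by (simp add: c_def)
qed

lemma reach_from_near:
  assumes r: "r\<^sub>0 \<le> r" and s: "r < s"
    and D: "D \<in> sets (F m)" "\<And>w. w \<in> D \<Longrightarrow> r < R m w" "\<And>w. w \<in> D \<Longrightarrow> R m w \<le> r + B"
  shows "prob {w \<in> D. \<exists>j. s < R (m + j) w \<and> (\<forall>i<j. r < R (m + i) w)} \<le> 8 * B * \<beta> * (1 / (s - r) + 1 / r) * prob D"
proof (cases "r + B \<le> s")
  case True
  have "prob {w \<in> D. \<exists>j. s < R (m + j) w \<and> (\<forall>i<j. r < R (m + i) w)} \<le> 4 * B * \<beta> * (1 / (s - r) + 1 / r) * prob D"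
    by (rule reach) (use r True D in auto)
  also have "\<dots> \<le> 8 * B * \<beta> * (1 / (s - r) + 1 / r) * prob D"
    using const_bounds r s by (intro mult_right_mono) auto
  finally show ?thesis .
next
  case False
  have "1 \<le> B / (s - r)" using False s by simp
  also have "\<dots> \<le> 8 * \<beta> * (B / (s - r))" using const_bounds s mult_right_mono[of 1 "8 * \<beta>" "B / (s - r)"] by simp
  also have "\<dots> \<le> 8 * B * \<beta> * (1 / (s - r) + 1 / r)" using const_bounds r by (simp add: algebra_simps)
  finally have "1 * prob D \<le> 8 * B * \<beta> * (1 / (s - r) + 1 / r) * prob D" by (rule mult_right_mono) simp
  moreover have "prob {w \<in> D. \<exists>j. s < R (m + j) w \<and> (\<forall>i<j. r < R (m + i) w)} \<le> prob D"
    using sets_F[OF D(1)] by (intro finite_measure_mono) auto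
  ultimately show ?thesis by simp
qed

lemma stay_above:
  assumes s: "r\<^sub>0 \<le> s"
    and D: "D \<in> sets (F m)" "\<And>w. w \<in> D \<Longrightarrow> s < R m w" "\<And>w. w \<in> D \<Longrightarrow> R m w \<le> s + B"
  shows "prob {w \<in> D. \<forall>j. s < R (m + j) w} \<le> 16 * B * \<beta> / s * prob D"
proof -
  have s0: "s > 0" using s const_bounds by simp
  note [measurable] = sets_F[OF D(1)]
  have "prob {w \<in> D. \<forall>j. s < R (m + j) w} \<le> prob {w \<in> D. \<exists>j. 2 * s < R (m + j) w \<and> (\<forall>i<j. s < R (m + i) w)}"
  proof (rule finite_measure_mono_AE)
    show "AE w in P. w \<in> {w \<in> D. \<forall>j. s < R (m + j) w} \<longrightarrow> w \<in> {w \<in> D. \<exists>j. 2 * s < R (m + j) w \<and> (\<forall>i<j. s < R (m + i) w)}"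
      by (rule AE_mp[OF AE_unbounded]) (intro AE_I2, blast)
  qed measurable
  also have "\<dots> \<le> 8 * B * \<beta> * (1 / (2 * s - s) + 1 / s) * prob D"
    by (rule reach_from_near) (use s s0 D in auto)
  also have "8 * B * \<beta> * (1 / (2 * s - s) + 1 / s) = 16 * B * \<beta> / s" by simp
  finally show ?thesis .
qed

lemma crossing_upper:
  assumes D: "past_below n D r" and r: "r\<^sub>0 \<le> real r" and H: "0 < H"
  shows "prob (D \<inter> crossing H N r) \<le> 16 * B * \<beta> / r * prob D"
proof -
  have DP [measurable]: "D \<in> events" using D sets_F by (auto simp: past_below_def)
  define X where "X k = D \<inter> first_passage r k" for k
  have X: "X k \<in> sets (F k)" for k unfolding X_def by (rule past_below_first_passage[OF D])
  note [measurable] = sets_F[OF X]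
  have "prob (D \<inter> crossing H N r) \<le> prob (\<Union>k. {w \<in> X k. \<forall>j. r < R (k + j) w})"
  proof (rule finite_measure_mono)
    show "D \<inter> crossing H N r \<subseteq> (\<Union>k. {w \<in> X k. \<forall>j. r < R (k + j) w})"
    proof
      fix w assume "w \<in> D \<inter> crossing H N r"
      then obtain m where w: "w \<in> D" "w \<in> cut_at H N r m" by (auto simp: crossing_def)
      then have "w \<in> X m" by (simp add: X_def cut_at_def)
      then show "w \<in> (\<Union>k. {w \<in> X k. \<forall>j. r < R (k + j) w})" using cut_at_stays_above[OF w(2) H] by blast
    qed
  qed measurable
  also have "\<dots> \<le> 16 * B * \<beta> / r * prob (\<Union>k. X k)"
    by (intro prob_UN_le disjoint_first_passage[of _ r] stay_above r X past_below_first_passage(2)[OF D])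
      (auto simp: X_def, auto simp: first_passage_def)
  also have "prob (\<Union>k. X k) = prob D" unfolding X_def by (rule prob_UN_first_passage[OF DP])
  finally show ?thesis .
qed

lemma crossing_pair_upper:
  assumes D: "past_below n D r" and r: "r\<^sub>0 \<le> real r" and rs: "r < s" and H: "0 < H"
  shows "prob (D \<inter> crossing H N r \<inter> crossing H N s)
    \<le> (16 * B * \<beta>)\<^sup>2 * ((1 / (real s - real r) + 1 / r) / s) * prob D"
proof -
  have DP [measurable]: "D \<in> events" using D sets_F by (auto simp: past_below_def)
  have Ds: "past_below n D s" using D rs by (force simp: past_below_def)
  define V where "V k = {w \<in> D \<inter> first_passage s k. \<exists>m\<in>{..k}. w \<in> first_passage r m \<and> (\<forall>i\<in>{m..<k}. r < R i w)}" for k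
  define W where "W m = {w \<in> D \<inter> first_passage r m. \<exists>j. s < R (m + j) w \<and> (\<forall>i<j. r < R (m + i) w)}" for m
  have V: "V k \<in> sets (F k)" for k unfolding V_def
  proof (rule sets_F_Bex)
    show "D \<inter> first_passage s k \<in> sets (F k)" by (rule past_below_first_passage[OF Ds])
    fix m assume m: "m \<in> {..k}"
    have "{w \<in> first_passage r m. \<forall>i\<in>{m..<k}. R i w \<in> {real r<..}} \<in> sets (F k)"
    proof (rule sets_F_Ball)
      show "first_passage r m \<in> sets (F k)" by (rule sets_F_mono[OF first_passage_F]) (use m in simp)
      show "{w \<in> space P. R i w \<in> {real r<..}} \<in> sets (F k)" if "i \<in> {m..<k}" for i
        by (rule R_in_F) (use that in auto)
    qed
    moreover have "{w \<in> space P. w \<in> first_passage r m \<and> (\<forall>i\<in>{m..<k}. r < R i w)}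
        = {w \<in> first_passage r m. \<forall>i\<in>{m..<k}. R i w \<in> {real r<..}}"
      by (auto simp: first_passage_def)
    ultimately show "{w \<in> space P. w \<in> first_passage r m \<and> (\<forall>i\<in>{m..<k}. r < R i w)} \<in> sets (F k)" by simp
  qed
  note [measurable] = sets_F[OF V]
  have [measurable]: "W m \<in> events" for m unfolding W_def by measurable
  have "prob (D \<inter> crossing H N r \<inter> crossing H N s) \<le> prob (\<Union>k. {w \<in> V k. \<forall>j. s < R (k + j) w})"
  proof (rule finite_measure_mono)
    show "D \<inter> crossing H N r \<inter> crossing H N s \<subseteq> (\<Union>k. {w \<in> V k. \<forall>j. s < R (k + j) w})"
    proof
      fix w assume "w \<in> D \<inter> crossing H N r \<inter> crossing H N s"
      then obtain m k where w: "w \<in> D" "w \<in> cut_at H N r m" "w \<in> cut_at H N s k" by (auto simp: crossing_def)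
      have "m \<le> k"
      proof (rule ccontr)
        assume "\<not> m \<le> k"
        then have "R k w \<le> r" using w(2) by (auto simp: cut_at_def first_passage_def)
        moreover have "s < R k w" using w(3) by (auto simp: cut_at_def first_passage_def)
        ultimately show False using rs by simp
      qed
      moreover have "r < R i w" if "i \<ge> m" for i using cut_at_stays_above[OF w(2) H, of "i - m"] that by simp
      ultimately have "w \<in> V k" using w by (auto simp: V_def cut_at_def)
      then show "w \<in> (\<Union>k. {w \<in> V k. \<forall>j. s < R (k + j) w})" using cut_at_stays_above[OF w(3) H] by auto
    qed
  qed measurable
  also have "\<dots> \<le> 16 * B * \<beta> / s * prob (\<Union>k. V k)"
  proof (intro prob_UN_le disjoint_first_passage[of _ s] stay_above V)
    show "r\<^sub>0 \<le> real s" using r rs by simp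
    show "R k w \<le> s + B" if "w \<in> V k" for k w
      using past_below_first_passage(2)[OF Ds, of w k] that by (auto simp: V_def)
  qed (auto simp: V_def, auto simp: first_passage_def)
  also have "prob (\<Union>k. V k) \<le> prob (\<Union>m. W m)"
  proof (rule finite_measure_mono)
    show "(\<Union>k. V k) \<subseteq> (\<Union>m. W m)"
    proof
      fix w assume "w \<in> (\<Union>k. V k)"
      then obtain k m where w: "w \<in> D" "w \<in> first_passage s k" "m \<le> k" "w \<in> first_passage r m"
        "\<forall>i\<in>{m..<k}. r < R i w" by (auto simp: V_def)
      have "s < R (m + (k - m)) w \<and> (\<forall>i<k - m. r < R (m + i) w)"
        using w by (auto simp: first_passage_def)
      then show "w \<in> (\<Union>m. W m)" using w unfolding W_def by blast
    qed
  qed measurable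
  also have "prob (\<Union>m. W m) \<le> 8 * B * \<beta> * (1 / (real s - real r) + 1 / r) * prob (\<Union>m. D \<inter> first_passage r m)"
    unfolding W_def
  proof (intro prob_UN_le disjoint_first_passage[of _ r] reach_from_near r past_below_first_passage[OF D])
  qed (use rs in \<open>auto simp: first_passage_def\<close>)
  also have "\<dots> \<le> 16 * B * \<beta> * (1 / (real s - real r) + 1 / r) * prob D"
    unfolding prob_UN_first_passage[OF DP] using const_bounds rs by (intro mult_right_mono) auto
  finally show ?thesis using const_bounds
    by (simp add: power2_eq_square mult_left_mono divide_right_mono algebra_simps add_divide_distrib)
qed

lemma crossing_window:
  assumes H: "0 < H" and N: "real H + 1 \<le> N * \<delta>"
  obtains c where "0 < c" "\<And>n D r. past_below n D r \<Longrightarrow> c * prob D \<le> prob (D \<inter> (\<Union>i. crossing H N i))"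
proof -
  define c\<^sub>0 where "c\<^sub>0 = \<gamma> * p ^ N / (4 * (1 + real H))"
  define K where "K = 16 * B * \<beta> + (16 * B * \<beta>)\<^sup>2"
  have c0: "c\<^sub>0 > 0" and K: "K > 0" using const_bounds by (auto simp: c\<^sub>0_def K_def add_pos_pos)
  show ?thesis
  proof (rule that[of "c\<^sub>0\<^sup>2 / (9 * K)"])
    show "0 < c\<^sub>0\<^sup>2 / (9 * K)" using c0 K by simp
    fix n D r assume D: "past_below n D r"
    have DP [measurable]: "D \<in> events" using D sets_F by (auto simp: past_below_def)
    obtain a :: nat where a: "max r r\<^sub>0 \<le> real a" using real_arch_simple by blast
    have a1: "1 \<le> a" using a const_bounds by simp
    obtain b where b: "2 * harm a + 2 \<le> (harm b :: real)"
      using harm_at_top unfolding filterlim_at_top_dense eventually_sequentially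
      by (meson dual_order.refl less_imp_le)
    define S where "S = (\<Sum>i\<in>{a..<b}. 1 / real i)"
    have ab: "a \<le> b"
    proof (rule ccontr)
      assume "\<not> a \<le> b"
      then have "harm b \<le> (harm a :: real)" by (intro harm_mono) auto
      then show False using b harm_nonneg[of a, where 'a=real] by linarith
    qed
    have "harm b = harm a + (\<Sum>i\<in>{a<..b}. 1 / real i)"
    proof -
      have "{1..b} = {1..a} \<union> {a<..b}" using ab by auto
      moreover have "{1..a} \<inter> {a<..b} = {}" by auto
      ultimately show ?thesis by (simp only: harm_def inverse_eq_divide sum.union_disjoint finite_atLeastAtMost finite_greaterThanAtMost)
    qed
    also have "(\<Sum>i\<in>{a<..b}. 1 / real i) \<le> S + 1"
    proof -
      have "(\<Sum>i\<in>{a<..b}. 1 / real i) \<le> (\<Sum>i\<in>insert b {a..<b}. 1 / real i)" by (intro sum_mono2) auto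
      also have "\<dots> = S + 1 / real b" by (simp add: S_def)
      also have "1 / real b \<le> 1" using a1 ab by simp
      finally show ?thesis by simp
    qed
    finally have hS: "harm b \<le> harm a + S + 1" by simp
    then have S1: "1 \<le> S" and S2: "harm b \<le> 2 * S"
      using b harm_nonneg[of a, where 'a=real] by linarith+
    have past: "past_below n D (real i)" if "a \<le> i" for i
      using D a that unfolding past_below_def by (meson max.bounded_iff of_nat_mono order_trans)
    have r0: "r\<^sub>0 \<le> real i" if "a \<le> i" for i using a that by (simp add: max_def split: if_splits)
    define G where "G i j = (if i < j then (1 / (real j - real i) + 1 / real i) / real j else 0)" for i j :: nat
    have G0: "G i j \<ge> 0" for i j by (auto simp: G_def)
    have low: "c\<^sub>0 * S * prob D \<le> (\<Sum>i\<in>{a..<b}. prob (D \<inter> crossing H N i))"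
      unfolding S_def sum_distrib_left sum_distrib_right c\<^sub>0_def
      by (intro sum_mono crossing_lower[OF past r0 N]) auto
    have pair: "prob (D \<inter> crossing H N i \<inter> crossing H N j) \<le> K * prob D * G i j" if "a \<le> i" "i < j" for i j
    proof -
      have "prob (D \<inter> crossing H N i \<inter> crossing H N j) \<le> (16 * B * \<beta>)\<^sup>2 * G i j * prob D"
        using crossing_pair_upper[OF past r0 that(2) H, of N] that by (simp add: G_def)
      also have "\<dots> \<le> K * G i j * prob D"
        using const_bounds G0 by (intro mult_right_mono) (auto simp: K_def)
      finally show ?thesis by (simp add: mult_ac)
    qed
    have "prob (D \<inter> crossing H N i \<inter> crossing H N j)
        \<le> K * prob D * ((if i = j then 1 / real i else 0) + G i j + G j i)" if ij: "a \<le> i" "a \<le> j" for i j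
    proof -
      consider "i = j" | "i < j" | "j < i" by linarith
      then show ?thesis
      proof cases
        case 1
        have "prob (D \<inter> crossing H N i \<inter> crossing H N j) = prob (D \<inter> crossing H N i)"
          by (simp add: 1 Int_assoc)
        also have "\<dots> \<le> 16 * B * \<beta> / i * prob D" by (rule crossing_upper[OF past r0 H]) (use ij in auto)
        also have "\<dots> \<le> K / i * prob D"
          by (intro mult_right_mono divide_right_mono) (auto simp: K_def)
        finally show ?thesis using 1 by (simp add: G_def)
      next
        case 2
        then show ?thesis using pair[OF ij(1) 2] G0[of j i] by (simp add: G_def)
      next
        case 3
        have "D \<inter> crossing H N i \<inter> crossing H N j = D \<inter> crossing H N j \<inter> crossing H N i" by blast
        then show ?thesis using pair[OF ij(2) 3] 3 by (simp add: G_def)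
      qed
    qed
    then have "(\<Sum>i\<in>{a..<b}. \<Sum>j\<in>{a..<b}. prob (D \<inter> crossing H N i \<inter> crossing H N j))
        \<le> (\<Sum>i\<in>{a..<b}. \<Sum>j\<in>{a..<b}. K * prob D * ((if i = j then 1 / real i else 0) + G i j + G j i))"
      by (intro sum_mono) auto
    also have "\<dots> = K * prob D * (S + (\<Sum>i\<in>{a..<b}. \<Sum>j\<in>{a..<b}. G i j) + (\<Sum>i\<in>{a..<b}. \<Sum>j\<in>{a..<b}. G j i))"
      by (simp add: sum.distrib sum_distrib_left[symmetric] S_def sum.delta)
    also have "(\<Sum>i\<in>{a..<b}. \<Sum>j\<in>{a..<b}. G j i) = (\<Sum>i\<in>{a..<b}. \<Sum>j\<in>{a..<b}. G i j)"
      by (rule sum.swap)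
    also have "K * prob D * (S + (\<Sum>i\<in>{a..<b}. \<Sum>j\<in>{a..<b}. G i j) + (\<Sum>i\<in>{a..<b}. \<Sum>j\<in>{a..<b}. G i j))
      \<le> K * prob D * (S * S + 2 * S * (2 * S) + 2 * S * (2 * S))"
    proof (intro mult_left_mono add_mono)
      have "(\<Sum>i\<in>{a..<b}. \<Sum>j\<in>{a..<b}. G i j) \<le> 2 * S * harm b"
        unfolding G_def S_def by (rule sum_inverse_pairs_le[OF a1])
      also have "\<dots> \<le> 2 * S * (2 * S)" using S1 S2 by (intro mult_left_mono) auto
      finally show "(\<Sum>i\<in>{a..<b}. \<Sum>j\<in>{a..<b}. G i j) \<le> 2 * S * (2 * S)" .
      then show "(\<Sum>i\<in>{a..<b}. \<Sum>j\<in>{a..<b}. G i j) \<le> 2 * S * (2 * S)" .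
      show "S \<le> S * S" using S1 by simp
    qed (use K in auto)
    finally have upp: "(\<Sum>i\<in>{a..<b}. \<Sum>j\<in>{a..<b}. prob (D \<inter> crossing H N i \<inter> crossing H N j))
        \<le> 9 * K * S\<^sup>2 * prob D" by (simp add: power2_eq_square algebra_simps)
    define t where "t = c\<^sub>0 / (9 * K * S)"
    have t: "t > 0" using c0 K S1 by (simp add: t_def)
    have "c\<^sub>0\<^sup>2 / (9 * K) * prob D = 2 * t * (c\<^sub>0 * S * prob D) - t\<^sup>2 * (9 * K * S\<^sup>2 * prob D)"
      using K S1 by (simp add: t_def field_simps power2_eq_square)
    also have "\<dots> \<le> 2 * t * (\<Sum>i\<in>{a..<b}. prob (D \<inter> crossing H N i))
        - t\<^sup>2 * (\<Sum>i\<in>{a..<b}. \<Sum>j\<in>{a..<b}. prob (D \<inter> crossing H N i \<inter> crossing H N j))"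
      using low upp t by (intro diff_mono mult_left_mono) auto
    also have "\<dots> \<le> prob (D \<inter> (\<Union>i\<in>{a..<b}. crossing H N i))"
      by (rule second_moment_bound) auto
    also have "\<dots> \<le> prob (D \<inter> (\<Union>i. crossing H N i))" by (intro finite_measure_mono) auto
    finally show "c\<^sub>0\<^sup>2 / (9 * K) * prob D \<le> prob (D \<inter> (\<Union>i. crossing H N i))" .
  qed
qed

text \<open>The zero-one law: the complement of the crossing event is a limit of events in the
  \<open>F n\<close>, each of which the crossing event meets in a fixed proportion.\<close>

lemma AE_crossing:
  assumes H: "0 < H" and N: "real H + 1 \<le> N * \<delta>"
  shows "AE w in P. \<exists>i m. w \<in> cut_at H N i m"
proof -
  obtain c where c: "0 < c"
    and window: "\<And>n D r. past_below n D r \<Longrightarrow> c * prob D \<le> prob (D \<inter> (\<Union>i. crossing H N i))"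
    using crossing_window[OF H N] by metis
  define C where "C = (\<Union>i. crossing H N i)"
  have C [measurable]: "C \<in> events" unfolding C_def by measurable
  have F_bound: "c * prob D \<le> prob (D \<inter> C)" if D: "D \<in> sets (F n)" for n D
  proof -
    define X where "X k = {w \<in> D. \<forall>i\<in>{..n}. R i w \<in> {..real k}}" for k :: nat
    have X: "X k \<in> sets (F n)" for k
      unfolding X_def by (rule sets_F_Ball[OF D]) (rule R_in_F, auto)
    note [measurable] = sets_F[OF X] sets_F[OF D]
    have "past_below n (X k) (real k)" for k using X[of k] by (simp add: past_below_def X_def)
    then have 1: "c * prob (X k) \<le> prob (D \<inter> C)" for k
      by (rule order_trans[OF window finite_measure_mono]) (auto simp: C_def X_def)
    have "X k \<subseteq> X l" if "k \<le> l" for k l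
    proof -
      have "x \<le> real k \<Longrightarrow> x \<le> real l" for x using that by linarith
      then show ?thesis by (auto simp: X_def)
    qed
    then have "(\<lambda>k. prob (X k)) \<longlonglongrightarrow> prob (\<Union>k. X k)"
      by (intro finite_Lim_measure_incseq) (auto simp: incseq_def)
    moreover have "(\<Union>k. X k) = D"
    proof -
      have "\<exists>k. w \<in> X k" if w: "w \<in> D" for w
      proof -
        obtain k :: nat where k: "Max ((\<lambda>i. R i w) ` {..n}) \<le> real k" using real_arch_simple by blast
        have "R i w \<le> real k" if "i \<le> n" for i by (rule order_trans[OF Max_ge k]) (use that in auto)
        then show ?thesis using w by (auto simp: X_def)
      qed
      then show ?thesis by (auto simp: X_def)
    qed
    ultimately have "(\<lambda>k. c * prob (X k)) \<longlonglongrightarrow> c * prob D" by (auto intro!: tendsto_intros)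
    then show ?thesis by (rule LIMSEQ_le_const2) (use 1 in auto)
  qed
  define A where "A k i m = {w \<in> first_passage i m. 0 < m \<and> (\<forall>j<N. R (m + j) w + \<delta> \<le> R (m + Suc j) w)
     \<and> (\<forall>j\<le>k. real i + real H \<le> R (m + N + j) w)}" for k i m
  have AF: "\<exists>n. A k i m \<in> sets (F n)" for k i m
  proof (cases "m = 0")
    case True
    then show ?thesis by (simp add: A_def)
  next
    case False
    show ?thesis
    proof (intro exI)
      let ?n = "m + N + k"
      have "{w \<in> {w \<in> first_passage i m. \<forall>j\<in>{..<N}. R (m + Suc j) w - R (m + j) w \<in> {\<delta>..}}.
          \<forall>j\<in>{..k}. R (m + N + j) w \<in> {real i + real H..}} \<in> sets (F ?n)"
      proof (intro sets_F_Ball)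
        show "first_passage i m \<in> sets (F ?n)" by (rule sets_F_mono[OF first_passage_F]) simp
        show "{w \<in> space P. R (m + N + j) w \<in> {real i + real H..}} \<in> sets (F ?n)" if "j \<in> {..k}" for j
          by (rule R_in_F) (use that in auto)
        fix j assume j: "j \<in> {..<N}"
        have [measurable]: "R (m + Suc j) \<in> borel_measurable (F ?n)" "R (m + j) \<in> borel_measurable (F ?n)"
          by (rule R_F, use j in simp)+
        have "{w \<in> space (F ?n). R (m + Suc j) w - R (m + j) w \<in> {\<delta>..}} \<in> sets (F ?n)" by measurable
        then show "{w \<in> space P. R (m + Suc j) w - R (m + j) w \<in> {\<delta>..}} \<in> sets (F ?n)" by simp
      qed
      moreover have "{w \<in> {w \<in> first_passage i m. \<forall>j\<in>{..<N}. R (m + Suc j) w - R (m + j) w \<in> {\<delta>..}}.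
          \<forall>j\<in>{..k}. R (m + N + j) w \<in> {real i + real H..}} = A k i m"
      proof -
        have "(x - y \<in> {\<delta>..}) = (y + \<delta> \<le> x)" for x y by auto
        then show ?thesis using False unfolding A_def Ball_def by auto
      qed
      ultimately show "A k i m \<in> sets (F ?n)" by simp
    qed
  qed
  define Q where "Q M k = space P - (\<Union>i\<in>{..M}. \<Union>m\<in>{..M}. A k i m)" for M k :: nat
  define Q' where "Q' M = space P - (\<Union>i\<in>{..M}. \<Union>m\<in>{..M}. cut_at H N i m)" for M :: nat
  have QF: "\<exists>n. Q M k \<in> sets (F n)" for M k
  proof -
    obtain n where n: "A k i m \<in> sets (F (n i m))" for i m using AF[of k] by metis
    define n' where "n' = Max ((\<lambda>(i, m). n i m) ` ({..M} \<times> {..M}))"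
    have "A k i m \<in> sets (F n')" if "i \<le> M" "m \<le> M" for i m
      by (rule sets_F_mono[OF n]) (use that in \<open>auto simp: n'_def intro!: Max_ge\<close>)
    then have "Q M k \<in> sets (F n')"
      unfolding Q_def using sets.top[of "F n'"] by (intro sets.Diff sets.finite_UN) auto
    then show ?thesis by blast
  qed
  have QP [measurable]: "Q M k \<in> events" for M k using QF sets_F by blast
  have Q'P [measurable]: "Q' M \<in> events" for M unfolding Q'_def by measurable
  have Q'_bound: "c * prob (Q' M) \<le> prob (Q' M \<inter> C)" for M
  proof -
    have mono: "A l i m \<subseteq> A k i m" if "k \<le> l" for k l i m unfolding A_def using that by auto
    have inc: "incseq (Q M)" unfolding incseq_def Q_def
      by (intro allI impI Diff_mono UN_mono subset_refl mono)
    have un: "(\<Union>k. Q M k) = Q' M"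
    proof -
      have "\<exists>k. w \<in> Q M k" if w: "w \<in> Q' M" for w
      proof -
        have "\<exists>k. w \<notin> A k i m" if "i \<le> M" "m \<le> M" for i m
        proof (rule ccontr)
          assume "\<not> ?thesis"
          then have "w \<in> cut_at H N i m" unfolding A_def cut_at_def by blast
          then show False using w that by (auto simp: Q'_def)
        qed
        then obtain k where k: "w \<notin> A (k i m) i m" if "i \<le> M" "m \<le> M" for i m by metis
        define k' where "k' = Max ((\<lambda>(i, m). k i m) ` ({..M} \<times> {..M}))"
        have "w \<notin> A k' i m" if "i \<le> M" "m \<le> M" for i m
        proof -
          have "k i m \<le> k'" unfolding k'_def using that by (intro Max_ge) auto
          then show ?thesis using k[OF that] mono[of "k i m" k' i m] by auto
        qed
        then have "w \<in> Q M k'" using w by (auto simp: Q_def Q'_def)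
        then show ?thesis ..
      qed
      then have "Q' M \<subseteq> (\<Union>k. Q M k)" by auto
      moreover have "Q M k \<subseteq> Q' M" for k
      proof -
        have "cut_at H N i m \<subseteq> A k i m" for i m unfolding A_def cut_at_def by blast
        then show ?thesis unfolding Q_def Q'_def by (intro Diff_mono UN_mono subset_refl)
      qed
      ultimately show ?thesis by (intro equalityI UN_least)
    qed
    have "(\<lambda>k. prob (Q M k)) \<longlonglongrightarrow> prob (\<Union>k. Q M k)"
      by (rule finite_Lim_measure_incseq[OF _ inc]) auto
    then have "(\<lambda>k. c * prob (Q M k)) \<longlonglongrightarrow> c * prob (Q' M)" unfolding un by (intro tendsto_intros)
    moreover have "c * prob (Q M k) \<le> prob (Q' M \<inter> C)" for k
    proof -
      obtain n where "Q M k \<in> sets (F n)" using QF by blast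
      then have "c * prob (Q M k) \<le> prob (Q M k \<inter> C)" by (rule F_bound)
      also have "\<dots> \<le> prob (Q' M \<inter> C)" using un by (intro finite_measure_mono) auto
      finally show ?thesis .
    qed
    ultimately show ?thesis by (intro LIMSEQ_le_const2) auto
  qed
  have dec: "decseq Q'" unfolding decseq_def Q'_def by fastforce
  have int: "(\<Inter>M. Q' M) = space P - C"
  proof -
    have "w \<notin> Q' (max i m)" if "w \<in> cut_at H N i m" for w i m 
    proof -
      have "w \<in> (\<Union>i'\<in>{..max i m}. \<Union>m'\<in>{..max i m}. cut_at H N i' m')"
        by (intro UN_I[of i] UN_I[of m]) (use that in auto)
      then show ?thesis unfolding Q'_def by blast
    qed
    then have "w \<notin> (\<Inter>M. Q' M)" if "w \<in> C" for w using that unfolding C_def crossing_def by blast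
    moreover have "space P - C \<subseteq> (\<Inter>M. Q' M)" by (auto simp: C_def crossing_def Q'_def)
    moreover have "(\<Inter>M. Q' M) \<subseteq> space P" by (auto simp: Q'_def)
    ultimately show ?thesis by blast
  qed
  have "(\<lambda>M. prob (Q' M)) \<longlonglongrightarrow> prob (\<Inter>M. Q' M)"
    by (rule finite_Lim_measure_decseq[OF _ dec]) auto
  then have 1: "(\<lambda>M. c * prob (Q' M)) \<longlonglongrightarrow> c * prob (space P - C)" unfolding int by (intro tendsto_intros)
  have "(\<lambda>M. prob (Q' M \<inter> C)) \<longlonglongrightarrow> prob (\<Inter>M. Q' M \<inter> C)"
    by (rule finite_Lim_measure_decseq) (use dec in \<open>auto simp: decseq_def\<close>)
  moreover have "(\<Inter>M. Q' M \<inter> C) = {}" using int by auto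
  ultimately have 2: "(\<lambda>M. prob (Q' M \<inter> C)) \<longlonglongrightarrow> 0" by simp
  have "c * prob (space P - C) \<le> 0" by (rule LIMSEQ_le[OF 1 2]) (use Q'_bound in blast)
  then have "prob (space P - C) = 0" using c by (simp add: mult_le_0_iff measure_le_0_iff)
  then have "AE w in P. w \<notin> space P - C" by (intro AE_not_in) (auto simp: null_sets_def emeasure_eq_measure)
  then show ?thesis by (rule AE_mp) (intro AE_I2, auto simp: C_def crossing_def)
qed

end

section \<open>Transition kernels with bounded jumps\<close>

locale bounded_jump = prob_space M for M :: "(real^'d) measure" +
  fixes S :: "(real^'d) set" and x :: "real^'d" and B :: real
  assumes sets_M: "sets M = sets (restrict_space borel S)"
    and jump: "AE y in M. norm (y - x) \<le> B"
begin

lemma borel_imp_M: "f \<in> borel_measurable borel \<Longrightarrow> f \<in> borel_measurable M"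
  using measurable_restrict_space1[of f borel borel S] measurable_cong_sets[OF sets_M refl, of borel] by blast

lemma integrable_jump:
  fixes f :: "real^'d \<Rightarrow> 'b::{banach, second_countable_topology}"
  assumes "f \<in> borel_measurable borel" "\<And>y. norm (y - x) \<le> B \<Longrightarrow> norm (f y) \<le> c"
  shows "integrable M f"
proof (rule integrable_const_bound[of _ c])
  show "AE y in M. norm (f y) \<le> c" using jump by eventually_elim (rule assms(2))
qed (rule borel_imp_M[OF assms(1)])

lemma integrable_continuous_jump:
  fixes f :: "real^'d \<Rightarrow> 'b::euclidean_space"
  assumes f: "continuous_on UNIV f"
  shows "integrable M f"
proof -
  have "bounded (f ` cball x B)"
    by (intro compact_imp_bounded compact_continuous_image continuous_on_subset[OF f]) auto
  then obtain c where "\<forall>y\<in>cball x B. norm (f y) \<le> c" by (auto simp: bounded_iff)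
  then show ?thesis
    by (intro integrable_jump[of f c] borel_measurable_continuous_onI[OF f])
      (auto simp: dist_norm norm_minus_commute)
qed

abbreviation outer :: "real^'d \<Rightarrow> real^'d^'d" where
  "outer y \<equiv> \<chi> i j. (y - x) $ i * (y - x) $ j"

lemma integral_linear_outer:
  fixes L :: "real^'d^'d \<Rightarrow> real"
  assumes "linear L"
  shows "(LINT y|M. L (outer y)) = L (LINT y|M. outer y)"
proof -
  have "integrable M outer" by (rule integrable_continuous_jump) (intro continuous_intros)
  then show ?thesis using assms by (intro integral_bounded_linear) (simp add: linear_conv_bounded_linear)
qed

lemma trace_outer: "trace (LINT y|M. outer y) = (LINT y|M. (norm (y - x))\<^sup>2)"
proof -
  have "linear (trace :: real^'d^'d \<Rightarrow> real)"
    by (rule linearI) (auto simp: trace_def sum.distrib sum_distrib_left)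
  then show ?thesis
    by (subst integral_linear_outer[symmetric])
      (auto simp: trace_def power2_norm_eq_inner inner_vec_def)
qed

lemma quadratic_outer: "v \<bullet> ((LINT y|M. outer y) *v v) = (LINT y|M. (v \<bullet> (y - x))\<^sup>2)"
proof -
  have lin: "linear (\<lambda>A :: real^'d^'d. v \<bullet> (A *v v))"
    by (rule linearI)
      (auto simp: matrix_vector_mult_def inner_vec_def sum.distrib sum_distrib_left algebra_simps)
  have "outer y *v v = (v \<bullet> (y - x)) *\<^sub>R (y - x)" for y
    unfolding vec_eq_iff matrix_vector_mult_def inner_vec_def
    by (simp add: sum_distrib_left mult_ac)
  then have "v \<bullet> (outer y *v v) = (v \<bullet> (y - x))\<^sup>2" for y
    by (simp add: power2_eq_square)
  then show ?thesis using integral_linear_outer[OF lin] by simp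
qed

lemma inner_mean: "(LINT y|M. v \<bullet> (y - x)) = v \<bullet> (LINT y|M. y - x)"
  by (rule integral_inner_right) (intro integrable_continuous_jump continuous_intros)

lemma integral_norm_square:
  assumes "(LINT y|M. y - x) = 0"
  shows "(LINT y|M. (norm y)\<^sup>2) = (norm x)\<^sup>2 + (LINT y|M. (norm (y - x))\<^sup>2)"
proof -
  have "(norm y)\<^sup>2 = (norm x)\<^sup>2 + 2 * (x \<bullet> (y - x)) + (norm (y - x))\<^sup>2" for y
    unfolding power2_norm_eq_inner by (simp add: inner_diff_left inner_diff_right inner_commute[of y x])
  then have "(LINT y|M. (norm y)\<^sup>2) = (LINT y|M. (norm x)\<^sup>2 + 2 * (x \<bullet> (y - x)) + (norm (y - x))\<^sup>2)"
    by (rule Bochner_Integration.integral_cong[OF refl])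
  also have "\<dots> = (norm x)\<^sup>2 + 2 * (LINT y|M. x \<bullet> (y - x)) + (LINT y|M. (norm (y - x))\<^sup>2)"
  proof -
    have "integrable M (\<lambda>y. x \<bullet> (y - x))" "integrable M (\<lambda>y. (norm (y - x))\<^sup>2)"
      by (intro integrable_continuous_jump continuous_intros)+
    then show ?thesis by (simp add: prob_space)
  qed
  finally show ?thesis using assms by (simp add: inner_mean)
qed

lemma climb_prob:
  assumes mean: "(LINT y|M. y - x) = 0" and B: "0 < B" and x: "x \<noteq> 0"
    and Q: "U / 2 \<le> (LINT y|M. (sgn x \<bullet> (y - x))\<^sup>2)"
  shows "U / (8 * B\<^sup>2) \<le> measure M {y \<in> space M. norm x + U / (8 * B) \<le> norm y}"
proof -
  define u where "u y = sgn x \<bullet> (y - x)" for y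
  define A where "A = {y \<in> space M. norm x + U / (8 * B) \<le> norm y}"
  have A [measurable]: "A \<in> sets M"
  proof -
    have [measurable]: "(norm :: real^'d \<Rightarrow> real) \<in> borel_measurable M"
      by (rule borel_imp_M) measurable
    show ?thesis unfolding A_def by measurable
  qed
  have ns: "norm (sgn x) = 1" using x by (simp add: norm_sgn)
  have ub: "\<bar>u y\<bar> \<le> norm (y - x)" for y
    unfolding u_def using Cauchy_Schwarz_ineq2[of "sgn x" "y - x"] ns by simp
  have up: "norm x + u y \<le> norm y" for y
  proof -
    have "sgn x \<bullet> x = norm x" using x by (simp add: sgn_div_norm dot_square_norm power2_eq_square)
    then have "norm x + u y = sgn x \<bullet> y" by (simp add: u_def inner_diff_right)
    also have "\<dots> \<le> norm y" using norm_cauchy_schwarz[of "sgn x" y] ns by simp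
    finally show ?thesis .
  qed
  have pt: "(u y)\<^sup>2 \<le> 2 * B * (U / (8 * B)) + 2 * B\<^sup>2 * indicator A y - B * u y"
    if y: "norm (y - x) \<le> B" "y \<in> space M" "0 \<le> U" for y
  proof -
    have u: "\<bar>u y\<bar> \<le> B" using ub[of y] y by simp
    show ?thesis
    proof (cases "u y \<ge> 0")
      case False
      have "(u y)\<^sup>2 = (- u y) * (- u y)" by (simp add: power2_eq_square)
      also have "\<dots> \<le> B * (- u y)" using u False by (intro mult_right_mono) auto
      also have "\<dots> \<le> 2 * B * (U / (8 * B)) + 2 * B\<^sup>2 * indicator A y - B * u y" using B y by (simp add: indicator_def)
      finally show ?thesis .
    next
      case True
      have 1: "(u y)\<^sup>2 \<le> B * u y" unfolding power2_eq_square using u True by (intro mult_right_mono) auto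
      show ?thesis
      proof (cases "y \<in> A")
        case True
        have "2 * (B * u y) \<le> 2 * B\<^sup>2" using u B mult_left_mono[of "u y" B B] by (simp add: power2_eq_square)
        then show ?thesis using 1 True B y by simp
      next
        case False
        then have "u y \<le> U / (8 * B)" using up[of y] y by (auto simp: A_def)
        then have "B * u y \<le> B * (U / (8 * B))" using B by (intro mult_left_mono) auto
        then show ?thesis using 1 False B by simp
      qed
    qed
  qed
  show ?thesis
  proof (cases "0 \<le> U")
    case True
    have intA: "integrable M (indicator A :: _ \<Rightarrow> real)" by (simp add: emeasure_eq_measure)
    have iu: "integrable M u" "integrable M (\<lambda>y. (u y)\<^sup>2)"
      unfolding u_def by (intro integrable_continuous_jump continuous_intros)+
    have "U / 2 \<le> (LINT y|M. (u y)\<^sup>2)" using Q by (simp add: u_def)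
    also have "\<dots> \<le> (LINT y|M. 2 * B * (U / (8 * B)) + 2 * B\<^sup>2 * indicator A y - B * u y)"
    proof (rule integral_mono_AE)
      show "AE y in M. (u y)\<^sup>2 \<le> 2 * B * (U / (8 * B)) + 2 * B\<^sup>2 * indicator A y - B * u y"
        using jump AE_space by eventually_elim (use pt True in auto)
    qed (use iu intA in auto)
    also have "\<dots> = 2 * B * (U / (8 * B)) + 2 * B\<^sup>2 * measure M A - B * (LINT y|M. u y)"
      using iu intA sets.sets_into_space[OF A] by (simp add: prob_space Int_absorb2)
    also have "(LINT y|M. u y) = 0" using mean by (simp add: u_def inner_mean)
    finally have "U / 2 \<le> U / 4 + 2 * B\<^sup>2 * measure M A" using B by simp
    then show ?thesis using B by (simp add: A_def field_simps)
  next
    case False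
    then have "U / (8 * B\<^sup>2) \<le> 0" using B by (simp add: divide_nonpos_nonneg)
    then show ?thesis by (rule order_trans) simp
  qed
qed

lemma integrable_norm_powr:
  assumes "B < norm x" "0 \<le> a"
  shows "integrable M (\<lambda>y. norm y powr - a)"
proof (rule integrable_jump)
  fix y assume "norm (y - x) \<le> B"
  then have "norm x - B \<le> norm y" using norm_triangle_ineq2[of x y] by (simp add: norm_minus_commute)
  then show "norm (norm y powr - a) \<le> (norm x - B) powr - a" using assms by (auto intro!: powr_mono2')
qed measurable

lemma integral_norm_powr:
  assumes mean: "(LINT y|M. y - x) = 0" and x: "B < norm x" "0 < norm x" and \<alpha>: "0 < \<alpha>"
    and exp: "\<And>\<theta>. norm \<theta> \<le> B \<Longrightarrow>
       \<bar>norm (x + \<theta>) powr (-2 * \<alpha>) - norm x powr (-2 * \<alpha>) *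
          (1 - \<alpha> * (2 * (x \<bullet> \<theta>) + (norm \<theta>)\<^sup>2) / (norm x)\<^sup>2 + 2 * \<alpha> * (\<alpha> + 1) * (sgn x \<bullet> \<theta>)\<^sup>2 / (norm x)\<^sup>2)\<bar>
       \<le> e * norm x powr (-2 * \<alpha>) / (norm x)\<^sup>2"
  shows "\<bar>(LINT y|M. norm y powr (-2 * \<alpha>)) - norm x powr (-2 * \<alpha>) *
      (1 - (\<alpha> * (LINT y|M. (norm (y - x))\<^sup>2) - 2 * \<alpha> * (\<alpha> + 1) * (LINT y|M. (sgn x \<bullet> (y - x))\<^sup>2)) / (norm x)\<^sup>2)\<bar>
    \<le> e * norm x powr (-2 * \<alpha>) / (norm x)\<^sup>2"
proof -
  define r where "r = norm x"
  define c where "c = r powr (-2 * \<alpha>)"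
  define f where "f y = c * (1 - \<alpha> * (2 * (x \<bullet> (y - x)) + (norm (y - x))\<^sup>2) / r\<^sup>2
      + 2 * \<alpha> * (\<alpha> + 1) * (sgn x \<bullet> (y - x))\<^sup>2 / r\<^sup>2)" for y
  have r: "r > 0" using x by (simp add: r_def)
  have i1: "integrable M (\<lambda>y. norm y powr (-2 * \<alpha>))"
    using integrable_norm_powr[of "2 * \<alpha>"] x \<alpha> by simp
  have i2: "integrable M f" unfolding f_def
    by (intro integrable_continuous_jump continuous_intros) (use r in auto)
  have "\<bar>(LINT y|M. norm y powr (-2 * \<alpha>)) - (LINT y|M. f y)\<bar> = \<bar>LINT y|M. norm y powr (-2 * \<alpha>) - f y\<bar>"
    using i1 i2 by simp
  also have "\<dots> \<le> (LINT y|M. \<bar>norm y powr (-2 * \<alpha>) - f y\<bar>)" by (rule integral_abs_bound)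
  also have "\<dots> \<le> (LINT y|M. e * c / r\<^sup>2)"
  proof (rule integral_mono_AE)
    show "AE y in M. \<bar>norm y powr (-2 * \<alpha>) - f y\<bar> \<le> e * c / r\<^sup>2"
      using jump
    proof eventually_elim
      case (elim y)
      then show ?case using exp[of "y - x"] by (simp add: f_def c_def r_def)
    qed
  qed (use i1 i2 in auto)
  also have "\<dots> = e * c / r\<^sup>2" by (simp add: prob_space)
  finally have "\<bar>(LINT y|M. norm y powr (-2 * \<alpha>)) - (LINT y|M. f y)\<bar> \<le> e * c / r\<^sup>2" .
  moreover have "(LINT y|M. f y) = c * (1 - (\<alpha> * (LINT y|M. (norm (y - x))\<^sup>2)
      - 2 * \<alpha> * (\<alpha> + 1) * (LINT y|M. (sgn x \<bullet> (y - x))\<^sup>2)) / r\<^sup>2)"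
  proof -
    have j: "integrable M (\<lambda>y. x \<bullet> (y - x))" "integrable M (\<lambda>y. (norm (y - x))\<^sup>2)"
      "integrable M (\<lambda>y. (sgn x \<bullet> (y - x))\<^sup>2)"
      by (intro integrable_continuous_jump continuous_intros)+
    have "(LINT y|M. f y) = c * (1 - \<alpha> * (2 * (LINT y|M. x \<bullet> (y - x)) + (LINT y|M. (norm (y - x))\<^sup>2)) / r\<^sup>2
        + 2 * \<alpha> * (\<alpha> + 1) * (LINT y|M. (sgn x \<bullet> (y - x))\<^sup>2) / r\<^sup>2)"
      unfolding f_def using j by (simp add: prob_space)
    also have "(LINT y|M. x \<bullet> (y - x)) = 0" using mean by (simp add: inner_mean)
    finally show ?thesis by (simp add: diff_divide_distrib)
  qed
  ultimately show ?thesis by (simp add: c_def r_def)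
qed

end

section \<open>The joint law of consecutive positions\<close>

context markov_process
begin

abbreviation \<F> :: "nat \<Rightarrow> 'w measure" where
  "\<F> \<equiv> natural_filtration P X"

abbreviation \<S> :: "'a measure" where
  "\<S> \<equiv> restrict_space borel S"

lemma sets_natural_filtration:
  "sets (\<F> n) = sigma_sets (space P) (\<Union>i\<in>{..n}. {X i -` A \<inter> space P | A. A \<in> sets borel})"
  unfolding natural_filtration_def by (rule sets_measure_of) auto

lemma subalgebra_natural_filtration: "subalgebra P (\<F> n)"
proof -
  have "(\<Union>i\<in>{..n}. {X i -` A \<inter> space P | A. A \<in> sets borel}) \<subseteq> sets P"
    using process_measurable by (auto intro: measurable_sets)
  moreover have "space (\<F> n) = space P"
    unfolding natural_filtration_def by (rule space_measure_of) auto
  ultimately show ?thesis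
    unfolding subalgebra_def sets_natural_filtration by (simp add: sets.sigma_sets_subset)
qed

lemma natural_filtration_mono: "m \<le> n \<Longrightarrow> sets (\<F> m) \<subseteq> sets (\<F> n)"
  unfolding sets_natural_filtration by (intro sigma_sets_mono' UN_mono) auto

lemma process_adapted: "X n \<in> borel_measurable (\<F> n)"
proof (rule measurableI)
  fix A :: "'a set" assume "A \<in> sets borel"
  then have "X n -` A \<inter> space P \<in> sets (\<F> n)"
    unfolding sets_natural_filtration by (intro sigma_sets.Basic) auto
  then show "X n -` A \<inter> space (\<F> n) \<in> sets (\<F> n)"
    using subalgebra_natural_filtration[of n] by (simp add: subalgebra_def)
qed simp

context
  fixes s\<^sub>0 :: 'a
  assumes s0: "s\<^sub>0 \<in> S"
begin

definition Y :: "nat \<Rightarrow> 'w \<Rightarrow> 'a" where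
  "Y n w = (if X n w \<in> S then X n w else s\<^sub>0)"

lemma Y_in_S: "Y n w \<in> S"
  using s0 by (simp add: Y_def)

lemma AE_Y: "AE w in P. \<forall>n. Y n w = X n w"
  unfolding AE_all_countable
proof
  fix n
  show "AE w in P. Y n w = X n w"
    using process_in_state_space[of n] by eventually_elim (simp add: Y_def)
qed

lemma Y_adapted: "Y n \<in> \<F> n \<rightarrow>\<^sub>M \<S>"
proof -
  note [measurable] = process_adapted[of n] state_space_measurable
  have "Y n \<in> borel_measurable (\<F> n)" unfolding Y_def by measurable
  then show ?thesis by (rule measurable_restrict_space2[rotated]) (simp add: Y_in_S)
qed

lemma Y_measurable [measurable]: "Y n \<in> P \<rightarrow>\<^sub>M \<S>"
  by (rule measurable_from_subalg[OF subalgebra_natural_filtration Y_adapted])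

lemma kernel_prob: "x \<in> S \<Longrightarrow> prob_space (K x)"
  and sets_kernel: "x \<in> S \<Longrightarrow> sets (K x) = sets \<S>"
  using measurable_space[OF kernel, of x] by (auto simp: space_prob_algebra space_restrict_space)

lemma transition:
  assumes D: "D \<in> sets (\<F> n)" and A: "A \<in> sets \<S>"
  shows "emeasure P (D \<inter> Y (Suc n) -` A) = (\<integral>\<^sup>+w. indicator D w * emeasure (K (Y n w)) A \<partial>P)"
proof -
  have DP [measurable]: "D \<in> sets P"
    using D subalgebra_natural_filtration[of n] by (auto simp: subalgebra_def)
  have "finite_measure_subalgebra P (\<F> n)"
    by (simp add: finite_measure_subalgebra_def finite_measure_subalgebra_axioms_def
        subalgebra_natural_filtration finite_measure_axioms)
  then interpret sub: finite_measure_subalgebra P "\<F> n" .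
  note [measurable] = process_measurable
  have "A \<in> sets borel" using A state_space_measurable by (auto simp: sets_restrict_space)
  then have AX [measurable]: "{w \<in> space P. X (Suc n) w \<in> A} \<in> sets P" by measurable
  have Am [measurable]: "A \<in> sets \<S>" by fact
  have Km [measurable]: "(\<lambda>w. measure (K (Y n w)) A) \<in> borel_measurable P"
  proof -
    have "K \<in> \<S> \<rightarrow>\<^sub>M subprob_algebra \<S>" using kernel by (rule measurable_prob_algebraD)
    then show ?thesis by measurable
  qed
  have AY: "D \<inter> Y (Suc n) -` A = {w \<in> D. Y (Suc n) w \<in> A}" by auto
  have AYm: "{w \<in> D. Y (Suc n) w \<in> A} \<in> sets P" by measurable
  have K1: "measure (K (Y n w)) A \<le> 1" for w
    using kernel_prob[OF Y_in_S] by (rule prob_space.prob_le_1)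
  have "prob {w \<in> D. Y (Suc n) w \<in> A} = prob (D \<inter> {w \<in> space P. X (Suc n) w \<in> A})"
    by (rule finite_measure_eq_AE)
      (use AE_Y sets.sets_into_space[OF DP] AYm in \<open>auto elim!: eventually_mono\<close>)
  also have "\<dots> = (\<integral>w\<in>D. indicator {w \<in> space P. X (Suc n) w \<in> A} w \<partial>P)"
    using sets.sets_into_space[OF DP]
    by (simp add: set_lebesgue_integral_def indicator_inter_arith[symmetric] Int_absorb2 le_infI1)
  also have "\<dots> = (\<integral>w\<in>D. real_cond_exp P (\<F> n) (indicator {w \<in> space P. X (Suc n) w \<in> A}) w \<partial>P)"
    by (rule sub.real_cond_exp_intA) (use D in \<open>auto simp: emeasure_eq_measure\<close>)
  also have "\<dots> = (\<integral>w\<in>D. measure (K (Y n w)) A \<partial>P)"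
    unfolding set_lebesgue_integral_def
  proof (rule integral_cong_AE)
    show "AE w in P. indicator D w *\<^sub>R real_cond_exp P (\<F> n) (indicator {w \<in> space P. X (Suc n) w \<in> A}) w
        = indicator D w *\<^sub>R measure (K (Y n w)) A"
      using markov_property[OF A, of n] AE_Y by eventually_elim simp
  qed measurable
  finally have eq: "prob {w \<in> D. Y (Suc n) w \<in> A} = (\<integral>w. indicator D w * measure (K (Y n w)) A \<partial>P)"
    by (simp add: set_lebesgue_integral_def)
  have "emeasure P {w \<in> D. Y (Suc n) w \<in> A} = (\<integral>\<^sup>+w. ennreal (indicator D w * measure (K (Y n w)) A) \<partial>P)"
    unfolding emeasure_eq_measure eq
    by (rule nn_integral_eq_integral[symmetric])
      (auto intro!: integrable_const_bound[of _ 1] simp: indicator_def K1)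
  also have "\<dots> = (\<integral>\<^sup>+w. indicator D w * emeasure (K (Y n w)) A \<partial>P)"
    by (intro nn_integral_cong)
      (auto simp: indicator_def finite_measure.emeasure_eq_measure[OF prob_space.finite_measure[OF kernel_prob[OF Y_in_S]]])
  finally show ?thesis by (simp add: AY)
qed

lemma joint_law:
  assumes D: "D \<in> sets (\<F> n)" and g: "g \<in> borel_measurable (\<S> \<Otimes>\<^sub>M \<S>)"
  shows "(\<integral>\<^sup>+w. indicator D w * g (Y n w, Y (Suc n) w) \<partial>P)
    = (\<integral>\<^sup>+w. indicator D w * (\<integral>\<^sup>+y. g (Y n w, y) \<partial>K (Y n w)) \<partial>P)"
proof -
  have DP [measurable]: "D \<in> sets P"
    using D subalgebra_natural_filtration[of n] by (auto simp: subalgebra_def)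
  note [measurable] = g
  have Ks [measurable]: "K \<in> \<S> \<rightarrow>\<^sub>M subprob_algebra \<S>" using kernel by (rule measurable_prob_algebraD)
  let ?D = "density P (indicator D)"
  let ?k = "\<lambda>x. distr (K x) (\<S> \<Otimes>\<^sub>M \<S>) (Pair x)"
  have k [measurable]: "?k \<in> \<S> \<rightarrow>\<^sub>M subprob_algebra (\<S> \<Otimes>\<^sub>M \<S>)"
    by (rule measurable_distr2[OF _ Ks]) measurable
  define N1 where "N1 = distr ?D (\<S> \<Otimes>\<^sub>M \<S>) (\<lambda>w. (Y n w, Y (Suc n) w))"
  define N2 where "N2 = distr ?D \<S> (Y n) \<bind> ?k"
  have space_S: "space \<S> = S" by (simp add: space_restrict_space)
  have Sne: "S \<noteq> {}" using s0 by auto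
  have sets2: "sets N2 = sets (\<S> \<Otimes>\<^sub>M \<S>)"
    unfolding N2_def by (rule sets_bind) (use Sne space_S sets_kernel in auto)
  have N1_integral: "(\<integral>\<^sup>+z. f z \<partial>N1) = (\<integral>\<^sup>+w. indicator D w * f (Y n w, Y (Suc n) w) \<partial>P)"
    if [measurable]: "f \<in> borel_measurable (\<S> \<Otimes>\<^sub>M \<S>)" for f
    unfolding N1_def by (simp add: nn_integral_distr nn_integral_density)
  have "N1 = N2"
  proof (rule measure_eqI_generator_eq[where \<Omega>="S \<times> S" and A="\<lambda>_. S \<times> S"
        and E="{a \<times> b |a b. a \<in> sets \<S> \<and> b \<in> sets \<S>}"])
    show "Int_stable {a \<times> b |a b. a \<in> sets \<S> \<and> b \<in> sets \<S>}"
      by (rule Int_stable_pair_measure_generator)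
    show "{a \<times> b |a b. a \<in> sets \<S> \<and> b \<in> sets \<S>} \<subseteq> Pow (S \<times> S)"
      using pair_measure_closed[of \<S> \<S>] by (simp add: space_S)
    show "sets N1 = sigma_sets (S \<times> S) {a \<times> b |a b. a \<in> sets \<S> \<and> b \<in> sets \<S>}"
      unfolding N1_def by (simp add: sets_pair_measure space_S)
    show "sets N2 = sigma_sets (S \<times> S) {a \<times> b |a b. a \<in> sets \<S> \<and> b \<in> sets \<S>}"
      unfolding sets2 by (simp add: sets_pair_measure space_S)
    show "range (\<lambda>_::nat. S \<times> S) \<subseteq> {a \<times> b |a b. a \<in> sets \<S> \<and> b \<in> sets \<S>}"
      using sets.top[of \<S>] by (auto simp: space_S)
    show "(\<Union>i::nat. S \<times> S) = S \<times> S" by simp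
    have "emeasure ?D (space ?D) = (\<integral>\<^sup>+w. indicator D w \<partial>P)"
      by (simp add: emeasure_density cong: nn_integral_cong)
    then have "finite_measure ?D" by (intro finite_measureI) (simp add: emeasure_eq_measure)
    then have "finite_measure N1"
      unfolding N1_def by (rule finite_measure.finite_measure_distr) measurable
    then show "emeasure N1 (S \<times> S) \<noteq> \<infinity>" for i :: nat
      by (simp add: finite_measure.emeasure_eq_measure)
    fix Z assume "Z \<in> {a \<times> b |a b. a \<in> sets \<S> \<and> b \<in> sets \<S>}"
    then obtain a b where Z: "Z = a \<times> b" and [measurable]: "a \<in> sets \<S>" "b \<in> sets \<S>" by auto
    have ma: "Y n -` a \<inter> space P \<in> sets (\<F> n)"
      using measurable_sets[OF Y_adapted, of a n] subalgebra_natural_filtration[of n]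
      by (simp add: subalgebra_def)
    have "emeasure N1 Z = (\<integral>\<^sup>+w. indicator D w * indicator (a \<times> b) (Y n w, Y (Suc n) w) \<partial>P)"
    proof -
      have "emeasure N1 Z = (\<integral>\<^sup>+z. indicator Z z \<partial>N1)"
        by (rule nn_integral_indicator[symmetric]) (simp add: N1_def Z)
      also have "\<dots> = (\<integral>\<^sup>+w. indicator D w * indicator (a \<times> b) (Y n w, Y (Suc n) w) \<partial>P)"
        unfolding Z by (rule N1_integral) measurable
      finally show ?thesis .
    qed
    also have "\<dots> = emeasure P ((D \<inter> (Y n -` a \<inter> space P)) \<inter> Y (Suc n) -` b)"
    proof -
      define T where "T = {w \<in> space P. w \<in> D \<and> Y n w \<in> a \<and> Y (Suc n) w \<in> b}"
      have [measurable]: "T \<in> sets P" unfolding T_def by measurable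
      have "(\<integral>\<^sup>+w. indicator D w * indicator (a \<times> b) (Y n w, Y (Suc n) w) \<partial>P) = (\<integral>\<^sup>+w. indicator T w \<partial>P)"
        by (intro nn_integral_cong) (auto simp: T_def split: split_indicator)
      also have "\<dots> = emeasure P T" by (rule nn_integral_indicator) measurable
      also have "T = (D \<inter> (Y n -` a \<inter> space P)) \<inter> Y (Suc n) -` b" by (auto simp: T_def)
      finally show ?thesis .
    qed
    also have "\<dots> = (\<integral>\<^sup>+w. indicator (D \<inter> (Y n -` a \<inter> space P)) w * emeasure (K (Y n w)) b \<partial>P)"
      using D ma by (intro transition) auto
    also have "\<dots> = (\<integral>\<^sup>+w. indicator D w * emeasure (?k (Y n w)) Z \<partial>P)"
    proof (rule nn_integral_cong)
      fix w assume w: "w \<in> space P"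
      have "emeasure (?k (Y n w)) Z = emeasure (K (Y n w)) (Pair (Y n w) -` Z \<inter> space (K (Y n w)))"
      proof (rule emeasure_distr)
        show "Pair (Y n w) \<in> K (Y n w) \<rightarrow>\<^sub>M \<S> \<Otimes>\<^sub>M \<S>"
          unfolding measurable_cong_sets[OF sets_kernel[OF Y_in_S] refl]
          by (rule measurable_Pair1') (simp add: space_S Y_in_S)
        show "Z \<in> sets (\<S> \<Otimes>\<^sub>M \<S>)" unfolding Z by measurable
      qed
      also have "Pair (Y n w) -` Z \<inter> space (K (Y n w)) = (if Y n w \<in> a then b else {})"
        using sets.sets_into_space[of b \<S>] sets_eq_imp_space_eq[OF sets_kernel[OF Y_in_S, of n w]]
        by (auto simp: Z)
      finally show "indicator (D \<inter> (Y n -` a \<inter> space P)) w * emeasure (K (Y n w)) b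
          = indicator D w * emeasure (?k (Y n w)) Z" using w by (auto split: split_indicator)
    qed
    also have "\<dots> = emeasure N2 Z"
      unfolding N2_def by (subst emeasure_bind[where N="\<S> \<Otimes>\<^sub>M \<S>"])
        (auto simp: Z space_S Sne nn_integral_distr nn_integral_density)
    finally show "emeasure N1 Z = emeasure N2 Z" .
  qed
  have "(\<integral>\<^sup>+w. indicator D w * g (Y n w, Y (Suc n) w) \<partial>P) = (\<integral>\<^sup>+z. g z \<partial>N1)"
    by (rule N1_integral[OF g, symmetric])
  also have "\<dots> = (\<integral>\<^sup>+x. \<integral>\<^sup>+z. g z \<partial>?k x \<partial>distr ?D \<S> (Y n))"
    unfolding \<open>N1 = N2\<close> N2_def by (rule nn_integral_bind[where B="\<S> \<Otimes>\<^sub>M \<S>"]) auto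
  also have "\<dots> = (\<integral>\<^sup>+w. indicator D w * (\<integral>\<^sup>+z. g z \<partial>?k (Y n w)) \<partial>P)"
    by (simp add: nn_integral_distr nn_integral_density)
  also have "\<dots> = (\<integral>\<^sup>+w. indicator D w * (\<integral>\<^sup>+y. g (Y n w, y) \<partial>K (Y n w)) \<partial>P)"
  proof (intro nn_integral_cong arg_cong2[where f=times] refl nn_integral_distr g)
    fix w
    show "Pair (Y n w) \<in> K (Y n w) \<rightarrow>\<^sub>M \<S> \<Otimes>\<^sub>M \<S>"
      unfolding measurable_cong_sets[OF sets_kernel[OF Y_in_S] refl]
      by (rule measurable_Pair1') (simp add: space_S Y_in_S)
  qed (use g in simp)
  finally show ?thesis .
qed

end
end

section \<open>Cut annuli of centred walks\<close>

lemma SUP_tendsto_0_D: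
  fixes g :: "'a::real_normed_vector \<Rightarrow> real"
  assumes lim: "((\<lambda>r::real. SUP x\<in>{x\<in>S. r \<le> norm x}. \<bar>g x\<bar>) \<longlongrightarrow> 0) at_top"
    and bd: "\<And>x. x \<in> S \<Longrightarrow> \<bar>g x\<bar> \<le> c" and e: "0 < e"
  obtains \<rho> where "\<And>x. x \<in> S \<Longrightarrow> \<rho> \<le> norm x \<Longrightarrow> \<bar>g x\<bar> \<le> e"
proof -
  have "\<forall>\<^sub>F r in at_top. (SUP x\<in>{x\<in>S. r \<le> norm x}. \<bar>g x\<bar>) < e"
    using order_tendstoD(2)[OF lim e] .
  then obtain \<rho> where \<rho>: "(SUP x\<in>{x\<in>S. \<rho> \<le> norm x}. \<bar>g x\<bar>) < e"
    by (auto simp: eventually_at_top_linorder)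
  have "\<bar>g x\<bar> \<le> e" if "x \<in> S" "\<rho> \<le> norm x" for x
  proof -
    have "\<bar>g x\<bar> \<le> (SUP x\<in>{x\<in>S. \<rho> \<le> norm x}. \<bar>g x\<bar>)"
      using that bd by (intro cSUP_upper) (auto simp: bdd_above_def)
    then show ?thesis using \<rho> by simp
  qed
  then show ?thesis using that by blast
qed

lemma cut_annuli_infinite:
  fixes x :: "nat \<Rightarrow> 'a::euclidean_space"
  assumes h: "0 \<le> h" and r: "0 \<le> r" and H: "h < H" "k * B < H" and k: "1 \<le> k" and B: "0 \<le> B" and \<delta>: "0 < \<delta>"
    and jump: "\<And>n. norm (x (Suc n)) \<le> norm (x n) + B"
    and m: "0 < m" and before: "\<And>n. n < m \<Longrightarrow> norm (x n) \<le> r" and start: "r < norm (x m)"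
    and climb: "\<And>j. j < N \<Longrightarrow> norm (x (m + j)) + \<delta> \<le> norm (x (m + Suc j))"
    and after: "\<And>j. r + H \<le> norm (x (m + N + j))"
  shows "infinite {A. cut_annulus h k x A}"
proof -
  define ann where "ann b = {z::'a. r < norm z \<and> norm z < b}" for b
  define c where "c = max (r + h) (r + k * B)"
  have cH: "c < r + H" using H by (simp add: c_def)
  have c0: "r \<le> c" using h by (simp add: c_def)
  have up: "norm (x (m + i)) \<le> norm (x (m + j))" if "i \<le> j" "j \<le> N" for i j
    using that
  proof (induction j rule: dec_induct)
    case (step j)
    have "norm (x (m + i)) \<le> norm (x (m + j))" using step by simp
    also have "\<dots> \<le> norm (x (m + Suc j))" using climb[of j] step \<delta> by simp
    finally show ?case .
  qed simp
  have slow: "norm (x (m + j)) \<le> r + (j + 1) * B" for j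
  proof (induction j)
    case 0
    have "norm (x m) \<le> norm (x (m - 1)) + B" using jump[of "m - 1"] m by simp
    then show ?case using before[of "m - 1"] m by simp
  next
    case (Suc j)
    then show ?case using jump[of "m + j"] by (simp add: algebra_simps)
  qed
  have cut: "cut_annulus h k x (ann b)" if b: "c < b" "b < r + H" for b
  proof -
    have ex: "\<exists>j. b \<le> norm (x (m + j))" using after[of 0] b by (intro exI[of _ N]) simp
    define L where "L = (LEAST j. b \<le> norm (x (m + j)))"
    have L: "b \<le> norm (x (m + L))" using LeastI_ex[OF ex] by (simp add: L_def)
    have below: "norm (x (m + j)) < b" if "j < L" for j
      using not_less_Least[of j "\<lambda>j. b \<le> norm (x (m + j))"] that by (simp add: L_def)
    have LN: "L \<le> N" unfolding L_def by (rule Least_le) (use after[of 0] b in simp)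
    have kL: "k \<le> L"
    proof (rule ccontr)
      assume "\<not> k \<le> L"
      then have "real (L + 1) * B \<le> k * B" using B by (intro mult_right_mono) auto
      then have "norm (x (m + L)) \<le> r + k * B" using slow[of L] by (simp add: algebra_simps)
      then show False using L b by (simp add: c_def)
    qed
    have above: "r < norm (x (m + j))" if "j \<le> N" for j using up[of 0 j] that start by simp
    have later: "b \<le> norm (x n)" if "n > m + (L - 1)" for n
    proof (cases "n \<le> m + N")
      case True
      then have "norm (x (m + L)) \<le> norm (x (m + (n - m)))" using that k kL by (intro up) auto
      then show ?thesis using L that by simp
    next
      case False
      then show ?thesis using after[of "n - m - N"] b by simp
    qed
    have inside: "x n \<in> ann b" if "n \<in> {m..m + (L - 1)}" for n
      using above[of "n - m"] below[of "n - m"] that LN k kL by (auto simp: ann_def)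
    have incr: "norm (x n) < norm (x (Suc n))" if "n \<in> {m..<m + (L - 1)}" for n
    proof -
      have "n - m < N" "m + (n - m) = n" "m + Suc (n - m) = Suc n" using that LN by auto
      then show ?thesis using climb[of "n - m"] \<delta> by simp
    qed
    have "\<exists>m l. k \<le> l + 1 \<and> (\<forall>n<m. norm (x n) \<le> r) \<and> (\<forall>n>m + l. b \<le> norm (x n)) \<and>
        (\<forall>n\<in>{m..m + l}. x n \<in> ann b) \<and> (\<forall>n\<in>{m..<m + l}. norm (x n) < norm (x (Suc n)))"
      by (rule exI[of _ m], rule exI[of _ "L - 1"]) (use before later inside incr kL in auto)
    moreover have "h \<le> b - r" using b by (simp add: c_def)
    moreover have "ann b = {z. r < norm z \<and> norm z < b}" by (simp add: ann_def)
    ultimately show ?thesis unfolding cut_annulus_def using r by blast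
  qed
  have "inj_on ann {c<..<r + H}"
  proof (rule linorder_inj_onI')
    fix b1 b2 assume b: "b1 \<in> {c<..<r + H}" "b2 \<in> {c<..<r + H}" "b1 < b2"
    obtain z :: 'a where z: "norm z = b1" using vector_choose_size[of b1] b c0 r by auto
    then have "z \<in> ann b2" "z \<notin> ann b1" using b c0 by (auto simp: ann_def)
    then show "ann b1 \<noteq> ann b2" by blast
  qed
  then have "infinite (ann ` {c<..<r + H})" using cH by (simp add: finite_image_iff)
  then show ?thesis by (rule infinite_super[rotated]) (use cut in auto)
qed

locale centred_walk = markov_process P X S K
  for P :: "'w measure" and X :: "nat \<Rightarrow> 'w \<Rightarrow> real^'d" and S K +
  fixes B \<epsilon> U V :: real
  assumes zero_in_S: "0 \<in> S" and B_ge_1: "1 \<le> B"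
    and jump_bound: "x \<in> S \<Longrightarrow> AE y in K x. norm (y - x) \<le> B"
    and mean_zero: "x \<in> S \<Longrightarrow> (LINT y|K x. y - x) = 0"
    and eps_pos: "0 < \<epsilon>" and U_pos: "0 < U" and transience: "2 * U < V"
    and var_ge: "x \<in> S \<Longrightarrow> \<epsilon> \<le> (LINT y|K x. (norm (y - x))\<^sup>2)"
    and radial_lim: "0 < e \<Longrightarrow> \<exists>\<rho>. \<forall>x\<in>S. \<rho> \<le> norm x \<longrightarrow> \<bar>(LINT y|K x. (sgn x \<bullet> (y - x))\<^sup>2) - U\<bar> \<le> e"
    and total_lim: "0 < e \<Longrightarrow> \<exists>\<rho>. \<forall>x\<in>S. \<rho> \<le> norm x \<longrightarrow> \<bar>(LINT y|K x. (norm (y - x))\<^sup>2) - V\<bar> \<le> e"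
begin

lemma bounded_jump_kernel: "x \<in> S \<Longrightarrow> bounded_jump (K x) S x B"
  using kernel_prob[OF zero_in_S] sets_kernel[OF zero_in_S] jump_bound
  by (simp add: bounded_jump_def bounded_jump_axioms_def)

lemma lyapunov_drift:
  assumes \<alpha>: "0 < \<alpha>"
  defines "g \<equiv> V - 2 * (\<alpha> + 1) * U"
  assumes g: "g \<noteq> 0"
  obtains \<rho> where "B < \<rho>" "\<And>x. x \<in> S \<Longrightarrow> \<rho> \<le> norm x \<Longrightarrow>
     \<bar>(LINT y|K x. norm y powr (-2 * \<alpha>)) - norm x powr (-2 * \<alpha>) * (1 - \<alpha> * g / (norm x)\<^sup>2)\<bar>
       \<le> norm x powr (-2 * \<alpha>) * (\<alpha> * \<bar>g\<bar> / (norm x)\<^sup>2)"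
proof -
  define \<eta> where "\<eta> = \<bar>g\<bar> / 2 / (2 * \<alpha> + 3)"
  have \<eta>: "\<eta> > 0" using g \<alpha> by (simp add: \<eta>_def)
  have B0: "B > 0" using B_ge_1 by simp
  have e: "\<alpha> * \<bar>g\<bar> / 2 > 0" using \<alpha> g by simp
  obtain \<rho>1 where r1: "\<And>x \<theta> :: real^'d. norm x \<ge> \<rho>1 \<Longrightarrow> norm \<theta> \<le> B \<Longrightarrow>
       \<bar>norm (x + \<theta>) powr (-2 * \<alpha>) - norm x powr (-2 * \<alpha>) *
          (1 - \<alpha> * (2 * (x \<bullet> \<theta>) + (norm \<theta>)\<^sup>2) / (norm x)\<^sup>2 + 2 * \<alpha> * (\<alpha> + 1) * (sgn x \<bullet> \<theta>)\<^sup>2 / (norm x)\<^sup>2)\<bar>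
       \<le> \<alpha> * \<bar>g\<bar> / 2 * norm x powr (-2 * \<alpha>) / (norm x)\<^sup>2"
    using norm_powr_expansion[OF \<alpha> B0 e, where 'a="real^'d"] by blast
  obtain \<rho>2 where r2: "\<forall>x\<in>S. \<rho>2 \<le> norm x \<longrightarrow> \<bar>(LINT y|K x. (sgn x \<bullet> (y - x))\<^sup>2) - U\<bar> \<le> \<eta>"
    using radial_lim[OF \<eta>] by blast
  obtain \<rho>3 where r3: "\<forall>x\<in>S. \<rho>3 \<le> norm x \<longrightarrow> \<bar>(LINT y|K x. (norm (y - x))\<^sup>2) - V\<bar> \<le> \<eta>"
    using total_lim[OF \<eta>] by blast
  define \<rho> where "\<rho> = Max {B + 1, \<rho>1, \<rho>2, \<rho>3}"
  have \<rho>: "B < \<rho>" "\<rho>1 \<le> \<rho>" "\<rho>2 \<le> \<rho>" "\<rho>3 \<le> \<rho>" by (auto simp: \<rho>_def less_max_iff_disj)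
  show ?thesis
  proof (rule that[OF \<rho>(1)])
    fix x assume x: "x \<in> S" "\<rho> \<le> norm x"
    interpret J: bounded_jump "K x" S x B by (rule bounded_jump_kernel[OF x(1)])
    define n where "n = norm x"
    define c where "c = n powr (-2 * \<alpha>)"
    define T where "T = (LINT y|K x. (norm (y - x))\<^sup>2)"
    define Q where "Q = (LINT y|K x. (sgn x \<bullet> (y - x))\<^sup>2)"
    have x_norm: "B < norm x" "0 < norm x" "\<rho>1 \<le> norm x" using x \<rho> B0 by linarith+
    then have n: "n > 0" by (simp add: n_def)
    have triangle: "\<bar>a - c\<bar> \<le> \<bar>a - b\<bar> + \<bar>b - c\<bar>" for a b c :: real by linarith
    have expand: "\<bar>(LINT y|K x. norm y powr (-2 * \<alpha>)) - c * (1 - (\<alpha> * T - 2 * \<alpha> * (\<alpha> + 1) * Q) / n\<^sup>2)\<bar>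
        \<le> \<alpha> * \<bar>g\<bar> / 2 * c / n\<^sup>2"
      unfolding c_def n_def T_def Q_def
      by (rule J.integral_norm_powr[OF mean_zero[OF x(1)] _ _ \<alpha> r1]) (use x_norm in auto)
    have limit: "\<bar>c * (1 - (\<alpha> * T - 2 * \<alpha> * (\<alpha> + 1) * Q) / n\<^sup>2) - c * (1 - \<alpha> * g / n\<^sup>2)\<bar> \<le> \<alpha> * \<bar>g\<bar> / 2 * c / n\<^sup>2"
    proof -
      have TQ: "\<bar>T - V\<bar> \<le> \<eta>" "\<bar>Q - U\<bar> \<le> \<eta>" using r2 r3 x \<rho> by (auto simp: T_def Q_def)
      have "\<bar>2 * (\<alpha> + 1) * (Q - U) - (T - V)\<bar> \<le> 2 * (\<alpha> + 1) * \<bar>Q - U\<bar> + \<bar>T - V\<bar>"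
        using \<alpha> by (intro order_trans[OF abs_triangle_ineq4]) (simp add: abs_mult)
      also have "\<dots> \<le> 2 * (\<alpha> + 1) * \<eta> + \<eta>" using TQ \<alpha> by (intro add_mono mult_left_mono) auto
      also have "\<dots> = (2 * \<alpha> + 3) * \<eta>" by (simp add: algebra_simps)
      also have "\<dots> = \<bar>g\<bar> / 2"
      proof -
        have "(2 * \<alpha> + 3) * (a / (2 * \<alpha> + 3)) = a" for a using \<alpha> by (simp add: add_eq_0_iff)
        then show ?thesis unfolding \<eta>_def .
      qed
      finally have err: "\<bar>2 * (\<alpha> + 1) * (Q - U) - (T - V)\<bar> \<le> \<bar>g\<bar> / 2" .
      have "c * (1 - (\<alpha> * T - 2 * \<alpha> * (\<alpha> + 1) * Q) / n\<^sup>2) - c * (1 - \<alpha> * g / n\<^sup>2)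
          = \<alpha> * c / n\<^sup>2 * (2 * (\<alpha> + 1) * (Q - U) - (T - V))"
        using n by (simp add: g_def field_simps)
      also have "\<bar>\<dots>\<bar> = \<alpha> * c / n\<^sup>2 * \<bar>2 * (\<alpha> + 1) * (Q - U) - (T - V)\<bar>"
        using \<alpha> by (simp add: abs_mult c_def)
      also have "\<dots> \<le> \<alpha> * c / n\<^sup>2 * (\<bar>g\<bar> / 2)"
        using \<alpha> by (intro mult_left_mono err) (simp add: c_def)
      also have "\<dots> = \<alpha> * \<bar>g\<bar> / 2 * c / n\<^sup>2" by (simp add: mult_ac)
      finally show ?thesis .
    qed
    have "\<bar>(LINT y|K x. norm y powr (-2 * \<alpha>)) - c * (1 - \<alpha> * g / n\<^sup>2)\<bar>
        \<le> \<alpha> * \<bar>g\<bar> / 2 * c / n\<^sup>2 + \<alpha> * \<bar>g\<bar> / 2 * c / n\<^sup>2"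
      by (rule order_trans[OF triangle add_mono[OF expand limit]])
    also have "\<dots> = c * (\<alpha> * \<bar>g\<bar> / n\<^sup>2)" by (simp add: mult_ac)
    finally show "\<bar>(LINT y|K x. norm y powr (-2 * \<alpha>)) - norm x powr (-2 * \<alpha>) * (1 - \<alpha> * g / (norm x)\<^sup>2)\<bar>
       \<le> norm x powr (-2 * \<alpha>) * (\<alpha> * \<bar>g\<bar> / (norm x)\<^sup>2)"
      by (simp add: c_def n_def)
  qed
qed

abbreviation Z :: "nat \<Rightarrow> 'w \<Rightarrow> real^'d" where
  "Z \<equiv> Y 0"

lemma Z_measurable [measurable]: "Z n \<in> P \<rightarrow>\<^sub>M \<S>"
  by (rule Y_measurable[OF zero_in_S])

lemma norm_measurable_S [measurable]: "norm \<in> borel_measurable \<S>"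
  by (intro measurable_restrict_space1) measurable

text \<open>The jumps of the process are bounded only almost surely; suppressing larger ones makes
  those of \<open>R\<close> bounded everywhere.\<close>

primrec R :: "nat \<Rightarrow> 'w \<Rightarrow> real" where
  "R 0 w = norm (Z 0 w)"
| "R (Suc n) w = (if \<bar>norm (Z (Suc n) w) - R n w\<bar> \<le> B then norm (Z (Suc n) w) else R n w)"

lemma R_nonneg: "0 \<le> R n w"
  by (induction n) auto

lemma R_step: "\<bar>R (Suc n) w - R n w\<bar> \<le> B"
  using B_ge_1 by auto

lemma R_adapted: "R n \<in> borel_measurable (\<F> n)"
proof -
  have norm_Z: "(\<lambda>w. norm (Z n w)) \<in> borel_measurable (\<F> n)" for n
    using measurable_compose[OF Y_adapted[OF zero_in_S] norm_measurable_S] .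
  show ?thesis
  proof (induction n)
    case 0
    have "R 0 = (\<lambda>w. norm (Z 0 w))" by auto
    then show ?case using norm_Z[of 0] by simp
  next
    case (Suc n)
    have [measurable]: "R n \<in> borel_measurable (\<F> (Suc n))"
      using Suc natural_filtration_mono[of n "Suc n"] subalgebra_natural_filtration
      by (auto simp: measurable_def subalgebra_def)
    note [measurable] = norm_Z[of "Suc n"]
    have "(\<lambda>w. if \<bar>norm (Z (Suc n) w) - R n w\<bar> \<le> B then norm (Z (Suc n) w) else R n w)
        \<in> borel_measurable (\<F> (Suc n))" by measurable
    moreover have "R (Suc n) = (\<lambda>w. if \<bar>norm (Z (Suc n) w) - R n w\<bar> \<le> B then norm (Z (Suc n) w) else R n w)"
      by auto
    ultimately show ?case by simp
  qed
qed

lemma R_measurable [measurable]: "R n \<in> borel_measurable P"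
  by (rule measurable_from_subalg[OF subalgebra_natural_filtration R_adapted])

lemma sets_F_P: "D \<in> sets (\<F> n) \<Longrightarrow> D \<in> sets P"
  using subalgebra_natural_filtration[of n] by (auto simp: subalgebra_def)

lemma norm_Z_measurable [measurable]: "(\<lambda>w. norm (Z n w)) \<in> borel_measurable P"
  using measurable_compose[OF Z_measurable norm_measurable_S] .

lemma AE_R: "AE w in P. \<forall>n. R n w = norm (Z n w)"
proof -
  have "AE w in P. \<forall>n. \<bar>norm (Z (Suc n) w) - norm (Z n w)\<bar> \<le> B"
    unfolding AE_all_countable
  proof
    fix n
    let ?g = "\<lambda>z. indicator {z. B < \<bar>norm (snd z) - norm (fst z)\<bar>} z :: ennreal"
    have gm: "?g \<in> borel_measurable (\<S> \<Otimes>\<^sub>M \<S>)"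
      by measurable
    have inner0: "(\<integral>\<^sup>+y. ?g (Z n w, y) \<partial>K (Z n w)) = 0" for w
    proof -
      have "AE y in K (Z n w). ?g (Z n w, y) = 0"
        using jump_bound[OF Y_in_S[OF zero_in_S]]
      proof eventually_elim
        case (elim y)
        then show ?case using norm_triangle_ineq3[of y "Z n w"] by (simp add: indicator_def)
      qed
      then show ?thesis by (subst nn_integral_cong_AE[where v="\<lambda>_. 0"]) auto
    qed
    have "(\<integral>\<^sup>+w. indicator (space P) w * ?g (Z n w, Z (Suc n) w) \<partial>P) = 0"
      using joint_law[OF zero_in_S sets.top gm, of n] subalgebra_natural_filtration[of n] inner0
      by (simp add: subalgebra_def)
    then have "AE w in P. indicator (space P) w * ?g (Z n w, Z (Suc n) w) = 0"
      by (subst (asm) nn_integral_0_iff_AE) measurable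
    then show "AE w in P. \<bar>norm (Z (Suc n) w) - norm (Z n w)\<bar> \<le> B"
      using AE_space by eventually_elim (simp add: indicator_def split: if_splits)
  qed
  then show ?thesis
  proof eventually_elim
    case (elim w)
    have "R n w = norm (Z n w)" for n by (induction n) (use elim in auto)
    then show ?case by blast
  qed
qed

lemma integral_R_nn:
  fixes u :: "real \<Rightarrow> real"
  assumes D: "D \<in> sets P" and u: "u \<in> borel_measurable borel" "\<And>t. 0 \<le> u t"
  shows "(\<integral>w. indicator D w * u (R n w) \<partial>P) = enn2real (\<integral>\<^sup>+w. indicator D w * ennreal (u (R n w)) \<partial>P)"
proof -
  note [measurable] = D u(1)
  have "(\<integral>w. indicator D w * u (R n w) \<partial>P) = enn2real (\<integral>\<^sup>+w. ennreal (indicator D w * u (R n w)) \<partial>P)"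
    by (rule integral_eq_nn_integral) (use u(2) in auto)
  also have "(\<integral>\<^sup>+w. ennreal (indicator D w * u (R n w)) \<partial>P) = (\<integral>\<^sup>+w. indicator D w * ennreal (u (R n w)) \<partial>P)"
    by (intro nn_integral_cong) (auto split: split_indicator)
  finally show ?thesis .
qed

lemma nn_integral_R_finite:
  fixes u :: "real \<Rightarrow> real"
  assumes "\<And>w. w \<in> D \<Longrightarrow> u (R n w) \<le> c"
  shows "(\<integral>\<^sup>+w. indicator D w * ennreal (u (R n w)) \<partial>P) < \<infinity>"
proof -
  have "(\<integral>\<^sup>+w. indicator D w * ennreal (u (R n w)) \<partial>P) \<le> (\<integral>\<^sup>+w. ennreal c \<partial>P)"
    using assms by (intro nn_integral_mono) (auto split: split_indicator intro: ennreal_leI)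
  also have "\<dots> < \<infinity>" by (simp add: emeasure_space_1)
  finally show ?thesis .
qed

lemma nn_integral_R_Suc:
  fixes u :: "real \<Rightarrow> real"
  assumes D: "D \<in> sets (\<F> n)" and u: "u \<in> borel_measurable borel"
  shows "(\<integral>\<^sup>+w. indicator D w * ennreal (u (R (Suc n) w)) \<partial>P)
    = (\<integral>\<^sup>+w. indicator D w * (\<integral>\<^sup>+y. ennreal (u (norm y)) \<partial>K (Z n w)) \<partial>P)"
proof -
  have gm: "(\<lambda>z. ennreal (u (norm (snd z)))) \<in> borel_measurable (\<S> \<Otimes>\<^sub>M \<S>)"
    using u by measurable
  have "(\<integral>\<^sup>+w. indicator D w * ennreal (u (R (Suc n) w)) \<partial>P)
      = (\<integral>\<^sup>+w. indicator D w * ennreal (u (norm (Z (Suc n) w))) \<partial>P)"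
    by (rule nn_integral_cong_AE) (use AE_R in \<open>auto elim!: eventually_mono simp del: R.simps\<close>)
  also have "\<dots> = (\<integral>\<^sup>+w. indicator D w * (\<integral>\<^sup>+y. ennreal (u (norm y)) \<partial>K (Z n w)) \<partial>P)"
    using joint_law[OF zero_in_S D gm] by simp
  finally show ?thesis .
qed

lemma kernel_integral_mono:
  fixes u v :: "real \<Rightarrow> real"
  assumes D: "D \<in> sets (\<F> n)" and u: "u \<in> borel_measurable borel" "\<And>t. 0 \<le> u t"
    and v: "v \<in> borel_measurable borel" "\<And>t. 0 \<le> v t"
    and I: "\<And>w. w \<in> D \<Longrightarrow> I (R n w)"
  shows "(\<And>x. x \<in> S \<Longrightarrow> I (norm x) \<Longrightarrow> (\<integral>\<^sup>+y. ennreal (u (norm y)) \<partial>K x) \<le> ennreal (v (norm x))) \<Longrightarrow>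
      (\<And>w. w \<in> D \<Longrightarrow> v (R n w) \<le> c) \<Longrightarrow>
      (\<integral>w. indicator D w * u (R (Suc n) w) \<partial>P) \<le> (\<integral>w. indicator D w * v (R n w) \<partial>P)"
    and "(\<And>x. x \<in> S \<Longrightarrow> I (norm x) \<Longrightarrow> ennreal (v (norm x)) \<le> (\<integral>\<^sup>+y. ennreal (u (norm y)) \<partial>K x)) \<Longrightarrow>
      (\<And>w. w \<in> D \<Longrightarrow> u (R (Suc n) w) \<le> c) \<Longrightarrow>
      (\<integral>w. indicator D w * v (R n w) \<partial>P) \<le> (\<integral>w. indicator D w * u (R (Suc n) w) \<partial>P)"
proof -
  assume kern: "\<And>x. x \<in> S \<Longrightarrow> I (norm x) \<Longrightarrow> (\<integral>\<^sup>+y. ennreal (u (norm y)) \<partial>K x) \<le> ennreal (v (norm x))"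
    and bd: "\<And>w. w \<in> D \<Longrightarrow> v (R n w) \<le> c"
  have "(\<integral>\<^sup>+w. indicator D w * ennreal (u (R (Suc n) w)) \<partial>P) \<le> (\<integral>\<^sup>+w. indicator D w * ennreal (v (R n w)) \<partial>P)"
    unfolding nn_integral_R_Suc[OF D u(1)]
  proof (rule nn_integral_mono_AE)
    show "AE w in P. indicator D w * (\<integral>\<^sup>+y. ennreal (u (norm y)) \<partial>K (Z n w)) \<le> indicator D w * ennreal (v (R n w))"
      using AE_R
    proof eventually_elim
      case (elim w)
      show ?case
      proof (cases "w \<in> D")
        case True
        have "I (norm (Z n w))" using I[OF True] elim by simp
        then show ?thesis using True kern[OF Y_in_S[OF zero_in_S]] elim by simp
      qed simp
    qed
  qed
  then show "(\<integral>w. indicator D w * u (R (Suc n) w) \<partial>P) \<le> (\<integral>w. indicator D w * v (R n w) \<partial>P)"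
    unfolding integral_R_nn[OF sets_F_P[OF D] u] integral_R_nn[OF sets_F_P[OF D] v]
    using nn_integral_R_finite[of D v n c, OF bd] by (intro enn2real_mono) auto
next
  assume kern: "\<And>x. x \<in> S \<Longrightarrow> I (norm x) \<Longrightarrow> ennreal (v (norm x)) \<le> (\<integral>\<^sup>+y. ennreal (u (norm y)) \<partial>K x)"
    and bd: "\<And>w. w \<in> D \<Longrightarrow> u (R (Suc n) w) \<le> c"
  have "(\<integral>\<^sup>+w. indicator D w * ennreal (v (R n w)) \<partial>P) \<le> (\<integral>\<^sup>+w. indicator D w * ennreal (u (R (Suc n) w)) \<partial>P)"
    unfolding nn_integral_R_Suc[OF D u(1)]
  proof (rule nn_integral_mono_AE)
    show "AE w in P. indicator D w * ennreal (v (R n w)) \<le> indicator D w * (\<integral>\<^sup>+y. ennreal (u (norm y)) \<partial>K (Z n w))"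
      using AE_R
    proof eventually_elim
      case (elim w)
      show ?case
      proof (cases "w \<in> D")
        case True
        have "I (norm (Z n w))" using I[OF True] elim by simp
        then show ?thesis using True kern[OF Y_in_S[OF zero_in_S]] elim by simp
      qed simp
    qed
  qed
  then show "(\<integral>w. indicator D w * v (R n w) \<partial>P) \<le> (\<integral>w. indicator D w * u (R (Suc n) w) \<partial>P)"
    unfolding integral_R_nn[OF sets_F_P[OF D] u] integral_R_nn[OF sets_F_P[OF D] v]
    using nn_integral_R_finite[of D u "Suc n" c, OF bd] by (intro enn2real_mono) auto
qed

lemma nn_integral_kernel_powr:
  assumes x: "x \<in> S" "B < norm x" and a: "0 \<le> a"
  shows "(\<integral>\<^sup>+y. ennreal (norm y powr - a) \<partial>K x) = ennreal (LINT y|K x. norm y powr - a)"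
proof -
  interpret J: bounded_jump "K x" S x B by (rule bounded_jump_kernel[OF x(1)])
  show ?thesis by (rule nn_integral_eq_integral[OF J.integrable_norm_powr[OF x(2) a]]) simp
qed

lemma nn_integral_kernel_square:
  assumes x: "x \<in> S"
  shows "ennreal ((norm x)\<^sup>2 + \<epsilon>) \<le> (\<integral>\<^sup>+y. ennreal ((norm y)\<^sup>2) \<partial>K x)"
proof -
  interpret J: bounded_jump "K x" S x B by (rule bounded_jump_kernel[OF x])
  have eq: "(\<integral>\<^sup>+y. ennreal ((norm y)\<^sup>2) \<partial>K x) = ennreal (LINT y|K x. (norm y)\<^sup>2)"
    by (rule nn_integral_eq_integral[OF J.integrable_continuous_jump]) (auto intro!: continuous_intros)
  show ?thesis
    unfolding eq J.integral_norm_square[OF mean_zero[OF x]] by (rule ennreal_leI) (simp add: var_ge[OF x])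
qed

lemma climb_R:
  assumes \<rho>: "\<And>x. x \<in> S \<Longrightarrow> \<rho> \<le> norm x \<Longrightarrow> U / 2 \<le> (LINT y|K x. (sgn x \<bullet> (y - x))\<^sup>2)" "0 < \<rho>"
    and D: "D \<in> sets (\<F> n)" "\<And>w. w \<in> D \<Longrightarrow> \<rho> \<le> R n w"
  shows "U / (8 * B\<^sup>2) * prob D \<le> prob {w \<in> D. R n w + U / (8 * B) \<le> R (Suc n) w}"
proof -
  note [measurable] = sets_F_P[OF D(1)]
  define \<delta> where "\<delta> = U / (8 * B)"
  define p where "p = U / (8 * B\<^sup>2)"
  have p: "0 \<le> p" using U_pos by (simp add: p_def)
  define G where "G = {w \<in> D. R n w + \<delta> \<le> R (Suc n) w}"
  have [measurable]: "G \<in> sets P" unfolding G_def by measurable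
  let ?g = "\<lambda>z. indicator {z. norm (fst z) + \<delta> \<le> norm (snd z)} z :: ennreal"
  have gm: "?g \<in> borel_measurable (\<S> \<Otimes>\<^sub>M \<S>)" by measurable
  have "ennreal p * emeasure P D = (\<integral>\<^sup>+w. indicator D w * ennreal p \<partial>P)"
    by (subst nn_integral_multc) (auto simp: mult.commute)
  also have "\<dots> \<le> (\<integral>\<^sup>+w. indicator D w * (\<integral>\<^sup>+y. ?g (Z n w, y) \<partial>K (Z n w)) \<partial>P)"
  proof (rule nn_integral_mono_AE)
    show "AE w in P. indicator D w * ennreal p \<le> indicator D w * (\<integral>\<^sup>+y. ?g (Z n w, y) \<partial>K (Z n w))"
      using AE_R
    proof eventually_elim
      case (elim w)
      show ?case
      proof (cases "w \<in> D")
        case True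
        define x where "x = Z n w"
        have x: "x \<in> S" "\<rho> \<le> norm x" using Y_in_S[OF zero_in_S] D(2)[OF True] elim by (simp_all add: x_def)
        interpret J: bounded_jump "K x" S x B by (rule bounded_jump_kernel[OF x(1)])
        have nm [measurable]: "norm \<in> borel_measurable (K x)" by (rule J.borel_imp_M) measurable
        have "p \<le> measure (K x) {y \<in> space (K x). norm x + \<delta> \<le> norm y}"
          unfolding p_def \<delta>_def
          by (rule J.climb_prob[OF mean_zero[OF x(1)] _ _ \<rho>(1)[OF x]]) (use x \<rho>(2) B_ge_1 in auto)
        then have "ennreal p \<le> emeasure (K x) {y \<in> space (K x). norm x + \<delta> \<le> norm y}"
          by (simp add: J.emeasure_eq_measure ennreal_leI)
        also have "\<dots> = (\<integral>\<^sup>+y. indicator {y \<in> space (K x). norm x + \<delta> \<le> norm y} y \<partial>K x)"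
          by (rule nn_integral_indicator[symmetric]) measurable
        also have "\<dots> = (\<integral>\<^sup>+y. ?g (x, y) \<partial>K x)"
          by (intro nn_integral_cong) (auto split: split_indicator)
        finally show ?thesis using True by (simp add: x_def)
      qed simp
    qed
  qed
  also have "\<dots> = (\<integral>\<^sup>+w. indicator D w * ?g (Z n w, Z (Suc n) w) \<partial>P)"
    by (rule joint_law[OF zero_in_S D(1) gm, symmetric])
  also have "\<dots> = (\<integral>\<^sup>+w. indicator G w \<partial>P)"
  proof (rule nn_integral_cong_AE)
    show "AE w in P. indicator D w * ?g (Z n w, Z (Suc n) w) = indicator G w"
      using AE_R
    proof eventually_elim
      case (elim w)
      have "w \<in> G \<longleftrightarrow> w \<in> D \<and> norm (Z n w) + \<delta> \<le> norm (Z (Suc n) w)"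
        unfolding G_def using elim by (simp del: R.simps)
      then show ?case by (simp add: indicator_def)
    qed
  qed
  also have "\<dots> = emeasure P G" by simp
  finally have "ennreal (p * prob D) \<le> ennreal (prob G)"
    using p by (simp add: emeasure_eq_measure ennreal_mult)
  then show ?thesis by (simp add: p_def G_def \<delta>_def)
qed

lemma lamperti_R:
  obtains r\<^sub>0 \<beta> \<gamma> where "lamperti P \<F> R B r\<^sub>0 (U / (8 * B)) (U / (8 * B\<^sup>2)) \<epsilon> \<beta> \<gamma>"
proof -
  have B0: "B > 0" using B_ge_1 by simp
  define \<alpha>1 where "\<alpha>1 = min (1 / 2) ((V - 2 * U) / (4 * U))"
  define \<alpha>2 where "\<alpha>2 = V / U"
  have \<alpha>1: "0 < \<alpha>1" "2 * \<alpha>1 \<le> 1" using U_pos transience by (auto simp: \<alpha>1_def)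
  have g1: "V - 2 * (\<alpha>1 + 1) * U > 0"
  proof -
    have "\<alpha>1 \<le> (V - 2 * U) / (4 * U)" by (simp add: \<alpha>1_def)
    then have "\<alpha>1 * (4 * U) \<le> V - 2 * U" using U_pos by (simp add: pos_le_divide_eq)
    then show ?thesis using transience by (simp add: algebra_simps)
  qed
  have \<alpha>2: "0 < \<alpha>2" "1 \<le> 2 * \<alpha>2" using U_pos transience by (auto simp: \<alpha>2_def)
  have g2: "V - 2 * (\<alpha>2 + 1) * U < 0" using U_pos transience by (simp add: \<alpha>2_def algebra_simps)
  obtain \<rho>1 where \<rho>1: "B < \<rho>1" "\<And>x. x \<in> S \<Longrightarrow> \<rho>1 \<le> norm x \<Longrightarrow>
     \<bar>(LINT y|K x. norm y powr (-2 * \<alpha>1)) - norm x powr (-2 * \<alpha>1) * (1 - \<alpha>1 * (V - 2 * (\<alpha>1 + 1) * U) / (norm x)\<^sup>2)\<bar>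
       \<le> norm x powr (-2 * \<alpha>1) * (\<alpha>1 * \<bar>V - 2 * (\<alpha>1 + 1) * U\<bar> / (norm x)\<^sup>2)"
    using lyapunov_drift[OF \<alpha>1(1)] g1 by (metis less_irrefl)
  obtain \<rho>2 where \<rho>2: "B < \<rho>2" "\<And>x. x \<in> S \<Longrightarrow> \<rho>2 \<le> norm x \<Longrightarrow>
     \<bar>(LINT y|K x. norm y powr (-2 * \<alpha>2)) - norm x powr (-2 * \<alpha>2) * (1 - \<alpha>2 * (V - 2 * (\<alpha>2 + 1) * U) / (norm x)\<^sup>2)\<bar>
       \<le> norm x powr (-2 * \<alpha>2) * (\<alpha>2 * \<bar>V - 2 * (\<alpha>2 + 1) * U\<bar> / (norm x)\<^sup>2)"
    using lyapunov_drift[OF \<alpha>2(1)] g2 by (metis less_irrefl)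
  obtain \<rho>3 where \<rho>3: "\<forall>x\<in>S. \<rho>3 \<le> norm x \<longrightarrow> \<bar>(LINT y|K x. (sgn x \<bullet> (y - x))\<^sup>2) - U\<bar> \<le> U / 2"
    using radial_lim[of "U / 2"] U_pos by auto
  define r\<^sub>0 where "r\<^sub>0 = Max {\<rho>1, \<rho>2, \<rho>3, 2 * B}"
  have r0: "\<rho>1 \<le> r\<^sub>0" "\<rho>2 \<le> r\<^sub>0" "\<rho>3 \<le> r\<^sub>0" "2 * B \<le> r\<^sub>0" by (auto simp: r\<^sub>0_def)
  have r01: "1 \<le> r\<^sub>0" using r0 B_ge_1 by linarith
  have super: "(LINT y|K x. norm y powr - (2 * \<alpha>1)) \<le> norm x powr - (2 * \<alpha>1)" if "x \<in> S" "r\<^sub>0 \<le> norm x" for x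
  proof -
    have "(LINT y|K x. norm y powr (-2 * \<alpha>1)) \<le> norm x powr (-2 * \<alpha>1) * (1 - \<alpha>1 * (V - 2 * (\<alpha>1 + 1) * U) / (norm x)\<^sup>2)
        + norm x powr (-2 * \<alpha>1) * (\<alpha>1 * \<bar>V - 2 * (\<alpha>1 + 1) * U\<bar> / (norm x)\<^sup>2)"
      using \<rho>1(2)[OF that(1) order_trans[OF r0(1) that(2)]] unfolding abs_diff_le_iff by (rule conjunct2)
    then show ?thesis using g1 by (simp add: right_diff_distrib)
  qed
  have sub: "norm x powr - (2 * \<alpha>2) \<le> (LINT y|K x. norm y powr - (2 * \<alpha>2))" if "x \<in> S" "r\<^sub>0 \<le> norm x" for x
  proof -
    have "norm x powr (-2 * \<alpha>2) * (1 - \<alpha>2 * (V - 2 * (\<alpha>2 + 1) * U) / (norm x)\<^sup>2)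
        - norm x powr (-2 * \<alpha>2) * (\<alpha>2 * \<bar>V - 2 * (\<alpha>2 + 1) * U\<bar> / (norm x)\<^sup>2) \<le> (LINT y|K x. norm y powr (-2 * \<alpha>2))"
      using \<rho>2(2)[OF that(1) order_trans[OF r0(2) that(2)]] unfolding abs_diff_le_iff by (rule conjunct1)
    moreover have "c * (1 - a * g / m) - c * (a * \<bar>g\<bar> / m) = c" if "g < 0" for a c g m :: real
      using that by (simp add: right_diff_distrib)
    note this[OF g2]
    ultimately show ?thesis by (simp only: mult_minus_left)
  qed
  have "lamperti P \<F> R B r\<^sub>0 (U / (8 * B)) (U / (8 * B\<^sup>2)) \<epsilon> (2 * \<alpha>2) (2 * \<alpha>1)"
  proof (intro lamperti.intro lamperti_axioms.intro)
    show "prob_space P" by (rule prob_space_axioms)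
    show "subalgebra P (\<F> n)" for n by (rule subalgebra_natural_filtration)
    show "sets (\<F> m) \<subseteq> sets (\<F> n)" if "m \<le> n" for m n by (rule natural_filtration_mono[OF that])
    show "R n \<in> borel_measurable (\<F> n)" for n by (rule R_adapted)
    show "0 \<le> R n w" for n w by (rule R_nonneg)
    show "\<bar>R (Suc n) w - R n w\<bar> \<le> B" for n w by (rule R_step)
  next
    fix D n assume D: "D \<in> sets (\<F> n)" "\<And>w. w \<in> D \<Longrightarrow> r\<^sub>0 \<le> R n w"
    show "U / (8 * B\<^sup>2) * prob D \<le> prob {w \<in> D. R n w + U / (8 * B) \<le> R (Suc n) w}"
    proof (rule climb_R[OF _ _ D])
      show "U / 2 \<le> (LINT y|K x. (sgn x \<bullet> (y - x))\<^sup>2)" if "x \<in> S" "r\<^sub>0 \<le> norm x" for x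
      proof -
        have "\<bar>(LINT y|K x. (sgn x \<bullet> (y - x))\<^sup>2) - U\<bar> \<le> U / 2"
          using \<rho>3 that(1) order_trans[OF r0(3) that(2)] by blast
        then show ?thesis by linarith
      qed
    qed (use r01 in auto)
    show "(\<integral>w. indicator D w * R (Suc n) w powr - (2 * \<alpha>1) \<partial>P) \<le> (\<integral>w. indicator D w * R n w powr - (2 * \<alpha>1) \<partial>P)"
    proof (rule kernel_integral_mono(1)[OF D(1), where I="\<lambda>r. r\<^sub>0 \<le> r" and c="r\<^sub>0 powr - (2 * \<alpha>1)"
          and u="\<lambda>r. r powr - (2 * \<alpha>1)" and v="\<lambda>r. r powr - (2 * \<alpha>1)"])
      show "(\<integral>\<^sup>+y. ennreal (norm y powr - (2 * \<alpha>1)) \<partial>K x) \<le> ennreal (norm x powr - (2 * \<alpha>1))"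
        if "x \<in> S" "r\<^sub>0 \<le> norm x" for x
        using super[OF that] that r0 \<rho>1 \<alpha>1 by (subst nn_integral_kernel_powr) (auto intro: ennreal_leI)
      show "R n w powr - (2 * \<alpha>1) \<le> r\<^sub>0 powr - (2 * \<alpha>1)" if "w \<in> D" for w
        using D(2)[OF that] r01 \<alpha>1 by (intro powr_mono2') auto
    qed (use D(2) in auto)
    show "(\<integral>w. indicator D w * R n w powr - (2 * \<alpha>2) \<partial>P) \<le> (\<integral>w. indicator D w * R (Suc n) w powr - (2 * \<alpha>2) \<partial>P)"
    proof (rule kernel_integral_mono(2)[OF D(1), where I="\<lambda>r. r\<^sub>0 \<le> r" and c="(r\<^sub>0 - B) powr - (2 * \<alpha>2)"
          and u="\<lambda>r. r powr - (2 * \<alpha>2)" and v="\<lambda>r. r powr - (2 * \<alpha>2)"])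
      show "ennreal (norm x powr - (2 * \<alpha>2)) \<le> (\<integral>\<^sup>+y. ennreal (norm y powr - (2 * \<alpha>2)) \<partial>K x)"
        if "x \<in> S" "r\<^sub>0 \<le> norm x" for x
        using sub[OF that] that r0 \<rho>2 \<alpha>2 by (subst nn_integral_kernel_powr) (auto intro: ennreal_leI)
      show "R (Suc n) w powr - (2 * \<alpha>2) \<le> (r\<^sub>0 - B) powr - (2 * \<alpha>2)" if "w \<in> D" for w
        using D(2)[OF that] R_step[of n w] r0 B0 \<alpha>2 by (intro powr_mono2') linarith+
    qed (use D(2) in auto)
  next
    fix D n s assume D: "D \<in> sets (\<F> n)" "\<And>w. w \<in> D \<Longrightarrow> R n w \<le> s"
    have "(\<integral>w. indicator D w * ((R n w)\<^sup>2 + \<epsilon>) \<partial>P) \<le> (\<integral>w. indicator D w * (R (Suc n) w)\<^sup>2 \<partial>P)"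
    proof (rule kernel_integral_mono(2)[OF D(1), where I="\<lambda>r. True" and c="(s + B)\<^sup>2"
          and u="\<lambda>r. r\<^sup>2" and v="\<lambda>r. r\<^sup>2 + \<epsilon>"])
      show "(R (Suc n) w)\<^sup>2 \<le> (s + B)\<^sup>2" if "w \<in> D" for w
        using D(2)[OF that] R_step[of n w] R_nonneg[of "Suc n" w] by (intro power_mono) linarith+
    qed (use eps_pos nn_integral_kernel_square in \<open>auto intro: add_nonneg_nonneg\<close>)
    also have "(\<integral>w. indicator D w * ((R n w)\<^sup>2 + \<epsilon>) \<partial>P) = (\<integral>w. indicator D w * (R n w)\<^sup>2 \<partial>P) + \<epsilon> * prob D"
    proof -
      note [measurable] = sets_F_P[OF D(1)]
      have i1: "integrable P (\<lambda>w. indicator D w * (R n w)\<^sup>2)"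
      proof (rule integrable_const_bound[of _ "s\<^sup>2"])
        show "AE w in P. norm (indicator D w * (R n w)\<^sup>2) \<le> s\<^sup>2"
          using D(2) R_nonneg by (intro AE_I2) (auto simp: indicator_def intro!: power_mono)
      qed measurable
      have i2: "integrable P (\<lambda>w. indicator D w * \<epsilon>)"
        by (rule integrable_const_bound[of _ "\<bar>\<epsilon>\<bar>"]) (auto simp: indicator_def)
      have "(\<integral>w. indicator D w * ((R n w)\<^sup>2 + \<epsilon>) \<partial>P) = (\<integral>w. indicator D w * (R n w)\<^sup>2 + indicator D w * \<epsilon> \<partial>P)"
        by (simp add: distrib_left)
      also have "\<dots> = (\<integral>w. indicator D w * (R n w)\<^sup>2 \<partial>P) + (\<integral>w. indicator D w * \<epsilon> \<partial>P)"
        by (rule Bochner_Integration.integral_add[OF i1 i2])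
      finally show ?thesis using sets.sets_into_space[OF sets_F_P[OF D(1)]] by (simp add: Int_absorb2 mult.commute)
    qed
    finally show "\<epsilon> * prob D + (\<integral>w. indicator D w * (R n w)\<^sup>2 \<partial>P) \<le> (\<integral>w. indicator D w * (R (Suc n) w)\<^sup>2 \<partial>P)"
      by simp
  qed (use B0 U_pos eps_pos \<alpha>1 \<alpha>2 r01 r0 in auto)
  then show ?thesis by (rule that)
qed

theorem AE_infinite_cut_annuli:
  "AE w in P. \<forall>h>0. \<forall>k\<ge>1. infinite {A. cut_annulus h k (\<lambda>n. X n w) A}"
proof -
  obtain r\<^sub>0 \<beta> \<gamma> where "lamperti P \<F> R B r\<^sub>0 (U / (8 * B)) (U / (8 * B\<^sup>2)) \<epsilon> \<beta> \<gamma>"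
    by (rule lamperti_R)
  then interpret L: lamperti P \<F> R B r\<^sub>0 "U / (8 * B)" "U / (8 * B\<^sup>2)" \<epsilon> \<beta> \<gamma> .
  define \<delta> where "\<delta> = U / (8 * B)"
  have \<delta>: "0 < \<delta>" using U_pos B_ge_1 by (simp add: \<delta>_def)
  define N where "N H = nat \<lceil>(real H + 1) / \<delta>\<rceil>" for H :: nat
  have N: "real H + 1 \<le> N H * \<delta>" for H
  proof -
    have "(real H + 1) / \<delta> \<le> N H" unfolding N_def by linarith
    then show ?thesis using \<delta> by (simp add: pos_divide_le_eq)
  qed
  have "AE w in P. \<forall>H\<in>{0<..}. \<exists>i m. w \<in> L.cut_at H (N H) i m"
    by (intro AE_ball_countable[THEN iffD2] ballI L.AE_crossing) (use N in \<open>auto simp: \<delta>_def\<close>)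
  then show ?thesis using AE_R AE_Y[OF zero_in_S]
  proof eventually_elim
    case (elim w)
    have RX: "R n w = norm (X n w)" for n using elim by simp
    show ?case
    proof (intro allI impI)
      fix h :: real and k :: nat assume h: "0 < h" and k: "1 \<le> k"
      obtain H :: nat where H: "max h (k * B) < real H" using reals_Archimedean2 by blast
      then have "0 < H" using h by (intro gr0I) auto
      then obtain i m where cut: "w \<in> L.cut_at H (N H) i m" using elim by blast
      have path: "0 < m" "\<forall>n<m. norm (X n w) \<le> real i" "real i < norm (X m w)"
          "\<forall>j<N H. norm (X (m + j) w) + \<delta> \<le> norm (X (m + Suc j) w)"
          "\<forall>j. real i + real H \<le> norm (X (m + N H + j) w)"
        using cut unfolding L.cut_at_def L.first_passage_def mem_Collect_eq RX \<delta>_def by simp_all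
      show "infinite {A. cut_annulus h k (\<lambda>n. X n w) A}"
      proof (rule cut_annuli_infinite[where r="real i" and H="real H" and B=B and \<delta>=\<delta> and m=m and N="N H"])
        show "norm (X (Suc n) w) \<le> norm (X n w) + B" for n
          using R_step[of n w] unfolding RX by simp
        show "0 < m" "\<And>n. n < m \<Longrightarrow> norm (X n w) \<le> real i" "real i < norm (X m w)"
          "\<And>j. j < N H \<Longrightarrow> norm (X (m + j) w) + \<delta> \<le> norm (X (m + Suc j) w)"
          "\<And>j. real i + real H \<le> norm (X (m + N H + j) w)"
          by (use path in blast)+
      qed (use h k H B_ge_1 \<delta> in auto)
    qed
  qed
qed

end

theorem theorem2p1:
  fixes P :: "'w measure"
    and \<xi> :: "nat \<Rightarrow> 'w \<Rightarrow> real^'d"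
    and S :: "(real^'d) set"
    and K :: "real^'d \<Rightarrow> (real^'d) measure"
    and B \<epsilon>\<^sub>0 U V :: real
  assumes dim: "2 \<le> CARD('d)"
    and unbounded: "\<not> bounded S"
    and zero: "0 \<in> S"
    and markov: "markov_process P \<xi> S K"
    and bounded_increments: "\<And>x. x \<in> S \<Longrightarrow> AE y in K x. norm (y - x) \<le> B"
    and zero_drift: "\<And>x. x \<in> S \<Longrightarrow> mean_drift K x = 0"
    and eps: "0 < \<epsilon>\<^sub>0"
    and nondegenerate: "\<And>x. x \<in> S \<Longrightarrow> \<epsilon>\<^sub>0 \<le> trace (incr_cov K x)"
    and UV: "0 < U" "U \<le> V"
    and radial: "((\<lambda>r::real. SUP x\<in>{x\<in>S. r \<le> norm x}.
                   \<bar>sgn x \<bullet> (incr_cov K x *v sgn x) - U\<bar>) \<longlongrightarrow> 0) at_top"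
    and total: "((\<lambda>r::real. SUP x\<in>{x\<in>S. r \<le> norm x}.
                   \<bar>trace (incr_cov K x) - V\<bar>) \<longlongrightarrow> 0) at_top"
    and transient: "2 * U < V"
  shows "AE w in P. \<forall>h>0. \<forall>k\<ge>1. infinite {A. cut_annulus h k (\<lambda>n. \<xi> n w) A}"
proof -
  interpret markov_process P \<xi> S K by (rule markov)
  define B' where "B' = max B 1"
  have jump: "AE y in K x. norm (y - x) \<le> B'" if "x \<in> S" for x
    using bounded_increments[OF that] by eventually_elim (simp add: B'_def)
  have J: "bounded_jump (K x) S x B'" if "x \<in> S" for x
    using kernel_prob[OF zero that] sets_kernel[OF zero that] jump[OF that]
    by (simp add: bounded_jump_def bounded_jump_axioms_def)
  define Q where "Q x = (LINT y|K x. (sgn x \<bullet> (y - x))\<^sup>2)" for x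
  define T where "T x = (LINT y|K x. (norm (y - x))\<^sup>2)" for x
  have QT: "sgn x \<bullet> (incr_cov K x *v sgn x) = Q x" "trace (incr_cov K x) = T x" if "x \<in> S" for x
    using bounded_jump.quadratic_outer[OF J[OF that]] bounded_jump.trace_outer[OF J[OF that]]
    by (simp_all add: incr_cov_def Q_def T_def)
  have bound: "\<bar>Q x\<bar> \<le> B'\<^sup>2" "\<bar>T x\<bar> \<le> B'\<^sup>2" if x: "x \<in> S" for x
  proof -
    interpret J: bounded_jump "K x" S x B' by (rule J[OF x])
    have "AE y in K x. (norm (y - x))\<^sup>2 \<le> B'\<^sup>2"
      using J.jump by eventually_elim (simp add: power_mono)
    then have "T x \<le> (LINT y|K x. B'\<^sup>2)" unfolding T_def
      by (intro integral_mono_AE J.integrable_continuous_jump) (auto intro!: continuous_intros)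
    moreover have "Q x \<le> T x" unfolding Q_def T_def
    proof (intro integral_mono J.integrable_continuous_jump continuous_intros)
      fix y
      have "\<bar>sgn x \<bullet> (y - x)\<bar> \<le> norm (sgn x) * norm (y - x)" by (rule Cauchy_Schwarz_ineq2)
      also have "\<dots> \<le> 1 * norm (y - x)" by (intro mult_right_mono) (auto simp: norm_sgn)
      finally have "\<bar>sgn x \<bullet> (y - x)\<bar>\<^sup>2 \<le> (1 * norm (y - x))\<^sup>2" by (rule power_mono) simp
      then show "(sgn x \<bullet> (y - x))\<^sup>2 \<le> (norm (y - x))\<^sup>2" by simp
    qed
    moreover have "0 \<le> Q x" unfolding Q_def by (rule integral_nonneg_AE) simp
    ultimately show "\<bar>Q x\<bar> \<le> B'\<^sup>2" "\<bar>T x\<bar> \<le> B'\<^sup>2" by (simp_all add: J.prob_space)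
  qed
  have "centred_walk P \<xi> S K B' \<epsilon>\<^sub>0 U V"
  proof (intro centred_walk.intro centred_walk_axioms.intro markov zero jump eps UV(1) transient)
    show "1 \<le> B'" by (simp add: B'_def)
    show "(LINT y|K x. y - x) = 0" if "x \<in> S" for x using zero_drift[OF that] by (simp add: mean_drift_def)
    show "\<epsilon>\<^sub>0 \<le> (LINT y|K x. (norm (y - x))\<^sup>2)" if "x \<in> S" for x
      using nondegenerate[OF that] QT[OF that] by (simp add: T_def)
    fix e :: real assume e: "0 < e"
    have "\<bar>sgn x \<bullet> (incr_cov K x *v sgn x) - U\<bar> \<le> B'\<^sup>2 + U" if "x \<in> S" for x
      using bound[OF that] QT[OF that] UV by linarith
    from SUP_tendsto_0_D[OF radial this e]
    show "\<exists>\<rho>. \<forall>x\<in>S. \<rho> \<le> norm x \<longrightarrow> \<bar>(LINT y|K x. (sgn x \<bullet> (y - x))\<^sup>2) - U\<bar> \<le> e"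
      using QT unfolding Q_def by metis
    have "\<bar>trace (incr_cov K x) - V\<bar> \<le> B'\<^sup>2 + V" if "x \<in> S" for x
      using bound[OF that] QT[OF that] UV by linarith
    from SUP_tendsto_0_D[OF total this e]
    show "\<exists>\<rho>. \<forall>x\<in>S. \<rho> \<le> norm x \<longrightarrow> \<bar>(LINT y|K x. (norm (y - x))\<^sup>2) - V\<bar> \<le> e"
      using QT unfolding T_def by metis
  qed
  then show ?thesis by (rule centred_walk.AE_infinite_cut_annuli)
qed

end
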